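(* Let $V_{14}$ be a $14$-dimensional complex vector space with non-degenerate quadratic form $q$, let $\Delta_{14}$ be a half-spin representation of $\mathrm{Spin}_{14}=\mathrm{Spin}(V_{14},q)$, and let $[\psi]$ be a generic element of $\mathbb{P}(\Delta_{14})$ (an element of the open $\mathrm{Spin}_{14}$-orbit). Then: (1) There exists a unique orthogonal decomposition $V_{14}=V_7\oplus V_7'$ (with $\dim V_7=\dim V_7'=7$) preserved by the stabilizer of $[\psi]$ in $\mathrm{Spin}_{14}$. (2) Under the induced isomorphism $\Delta_{14}\simeq\Delta_7\otimes\Delta_7'$, we have $[\psi]=[\chi\otimes\chi']$ for some $[\chi]$ and $[\chi']$ generic inside $\mathbb{P}(\Delta_7)$ and $\mathbb{P}(\Delta_7')$, respectively.
   Context: The action of $\mathbb{C}^*\times\mathrm{Spin}_{14}$ on $\Delta_{14}$ has an open orbit, so $\mathrm{Spin}_{14}$ has an open orbit in $\mathbb{P}(\Delta_{14})$. The decomposition in (1) is an unordered pair: an element of the stabilizer is allowed to exchange $V_7$ and $V_7'$. $\Delta_7$ and $\Delta_7'$ denote the ($8$-dimensional) spin representations of $\mathrm{Spin}(V_7)$ and $\mathrm{Spin}(V_7')$. Given an orthogonal decomposition $V_{14}=V_7\oplus V_7'$ (so that $q$ is non-degenerate on each summand), the restriction of $\Delta_{14}$ to $\mathrm{Spin}(V_7)\times\mathrm{Spin}(V_7')$ is isomorphic to the irreducible representation $\Delta_7\otimes\Delta_7'$, by an equivariant isomorphism unique up to scalar; this is the induced isomorphism. (It can be realized through the Borel–Weil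 theorem: sending isotropic $3$-dimensional subspaces $E_3\subset V_7$, $E_3'\subset V_7'$ to the maximal isotropic subspace, in the appropriate family, containing $E_3\oplus E_3'$ defines a morphism of spinor varieties $S_7\times S_7'\to S_{14}$, and one restricts sections of the positive generator of $\mathrm{Pic}(S_{14})$.) On $\Delta_7$ there is a $\mathrm{Spin}_7$-invariant non-degenerate quadratic form; generic elements of $\mathbb{P}(\Delta_7)$ are those outside the corresponding invariant quadric (the open $\mathrm{Spin}_7$-orbit), and similarly for $\Delta_7'$. *)

theory Defs
  imports Complex_Main "HOL-Library.Poly_Mapping" "HOL-Algebra.Algebraic_Closure_Type"
    "HOL-Algebra.Generated_Groups" "HOL-Algebra.Generated_Rings"
begin

section \<open>Quadratic spaces\<close>

text \<open>A complex vector space is a type \<open>'v :: ab_group_add\<close> with a scalar multiplication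
  \<open>s :: complex \<Rightarrow> 'v \<Rightarrow> 'v\<close> such that \<open>vector_space s\<close>; \<open>(*)\<close> is the one of \<open>complex\<close> itself.
  The qualified names \<open>Modules.module.span\<close> and \<open>Modules.module.subspace\<close> avoid the locale
  \<open>module\<close> of HOL-Algebra.\<close>

definition polar_form :: "('v::ab_group_add \<Rightarrow> complex) \<Rightarrow> 'v \<Rightarrow> 'v \<Rightarrow> complex" where
  "polar_form q u v = q (u + v) - q u - q v"

definition quadratic_form :: "(complex \<Rightarrow> 'v::ab_group_add \<Rightarrow> 'v) \<Rightarrow> ('v \<Rightarrow> complex) \<Rightarrow> bool" where
  "quadratic_form s q \<longleftrightarrow>
     (\<forall>c v. q (s c v) = c\<^sup>2 * q v) \<and> (\<forall>u. Vector_Spaces.linear s (*) (polar_form q u))"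

definition nondegenerate :: "('v::ab_group_add \<Rightarrow> complex) \<Rightarrow> bool" where
  "nondegenerate q \<longleftrightarrow> (\<forall>u. (\<forall>v. polar_form q u v = 0) \<longrightarrow> u = 0)"

definition orthogonal_decomposition ::
  "(complex \<Rightarrow> 'v::ab_group_add \<Rightarrow> 'v) \<Rightarrow> ('v \<Rightarrow> complex) \<Rightarrow> 'v set \<Rightarrow> 'v set \<Rightarrow> bool" where
  "orthogonal_decomposition s q W W' \<longleftrightarrow>
     Modules.module.subspace s W \<and> Modules.module.subspace s W' \<and>
     (\<forall>w\<in>W. \<forall>w'\<in>W'. polar_form q w w' = 0) \<and>
     W \<inter> W' = {0} \<and> (\<forall>v. \<exists>w\<in>W. \<exists>w'\<in>W'. v = w + w')"


section \<open>The Clifford algebra\<close>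

datatype 'v word = Word (letters: "'v list")

instantiation word :: (type) monoid_add
begin

definition zero_word :: "'a word" where "0 = Word []"
definition plus_word :: "'a word \<Rightarrow> 'a word \<Rightarrow> 'a word" where
  "w + w' = Word (letters w @ letters w')"

instance by standard (auto simp: zero_word_def plus_word_def)

end

text \<open>Since addition of words is concatenation, the convolution product makes
  \<open>'v word \<Rightarrow>\<^sub>0 complex\<close> the free associative unital complex algebra on the set of all \<open>v :: 'v\<close>.
  The first two families of relations below cut it down to the tensor algebra of the vector
  space; the third one gives the Clifford algebra, with the convention \<open>v\<^sup>2 = q v\<close>.\<close>

type_synonym 'v free_alg = "'v word \<Rightarrow>\<^sub>0 complex"
type_synonym 'v cl = "'v free_alg set"

definition free_gen :: "'v \<Rightarrow> 'v free_alg" where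
  "free_gen v = Poly_Mapping.single (Word [v]) 1"

definition free_scalar :: "complex \<Rightarrow> 'v free_alg" where
  "free_scalar c = Poly_Mapping.single 0 c"

definition clifford_relations ::
  "(complex \<Rightarrow> 'v::ab_group_add \<Rightarrow> 'v) \<Rightarrow> ('v \<Rightarrow> complex) \<Rightarrow> 'v free_alg set" where
  "clifford_relations s q =
     {free_gen (u + v) - (free_gen u + free_gen v) | u v. True} \<union>
     {free_gen (s c v) - free_scalar c * free_gen v | c v. True} \<union>
     {free_gen v * free_gen v - free_scalar (q v) | v. True}"

definition clifford_ideal ::
  "(complex \<Rightarrow> 'v::ab_group_add \<Rightarrow> 'v) \<Rightarrow> ('v \<Rightarrow> complex) \<Rightarrow> 'v free_alg set" where
  "clifford_ideal s q = Idl\<^bsub>ring_of_type_algebra\<^esub> (clifford_relations s q)"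

definition clifford_algebra ::
  "(complex \<Rightarrow> 'v::ab_group_add \<Rightarrow> 'v) \<Rightarrow> ('v \<Rightarrow> complex) \<Rightarrow> 'v cl ring" where
  "clifford_algebra s q = ring_of_type_algebra Quot clifford_ideal s q"

definition clifford_class ::
  "(complex \<Rightarrow> 'v::ab_group_add \<Rightarrow> 'v) \<Rightarrow> ('v \<Rightarrow> complex) \<Rightarrow> 'v free_alg \<Rightarrow> 'v cl" where
  "clifford_class s q x = clifford_ideal s q +>\<^bsub>ring_of_type_algebra\<^esub> x"

definition cl_vec ::
  "(complex \<Rightarrow> 'v::ab_group_add \<Rightarrow> 'v) \<Rightarrow> ('v \<Rightarrow> complex) \<Rightarrow> 'v \<Rightarrow> 'v cl" where
  "cl_vec s q v = clifford_class s q (free_gen v)"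

definition cl_scalar ::
  "(complex \<Rightarrow> 'v::ab_group_add \<Rightarrow> 'v) \<Rightarrow> ('v \<Rightarrow> complex) \<Rightarrow> complex \<Rightarrow> 'v cl" where
  "cl_scalar s q c = clifford_class s q (free_scalar c)"

lemma ring_free_alg: "ring (ring_of_type_algebra :: 'v free_alg ring)"
proof -
  have "\<exists>y. x + y = 0" for x :: "'v free_alg"
    using add.right_inverse by blast
  then show ?thesis
    unfolding ring_of_type_algebra_def using add.right_inverse
    by unfold_locales (auto simp: algebra_simps Units_def)
qed

lemma ideal_clifford_ideal: "ideal (clifford_ideal s q) ring_of_type_algebra"
  unfolding clifford_ideal_def
  by (rule ring.genideal_ideal[OF ring_free_alg]) (simp add: ring_of_type_algebra_def)

lemma ring_clifford_algebra: "ring (clifford_algebra s q)"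
  unfolding clifford_algebra_def by (rule ideal.quotient_is_ring[OF ideal_clifford_ideal])

lemma clifford_class_hom:
  "clifford_class s q \<in> ring_hom ring_of_type_algebra (clifford_algebra s q)"
  using ideal.rcos_ring_hom[OF ideal_clifford_ideal]
  by (simp add: clifford_class_def[abs_def] clifford_algebra_def)

lemma clifford_class_add:
  "clifford_class s q (x + y) =
     clifford_class s q x \<oplus>\<^bsub>clifford_algebra s q\<^esub> clifford_class s q y"
  using ring_hom_add[OF clifford_class_hom, of x y] by (simp add: ring_of_type_algebra_def)

lemma clifford_class_mult:
  "clifford_class s q (x * y) =
     clifford_class s q x \<otimes>\<^bsub>clifford_algebra s q\<^esub> clifford_class s q y"
  using ring_hom_mult[OF clifford_class_hom, of x y] by (simp add: ring_of_type_algebra_def)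

lemma clifford_class_eqI:
  assumes "x - y \<in> clifford_relations s q"
  shows "clifford_class s q x = clifford_class s q y"
proof -
  interpret I: ideal "clifford_ideal s q" "ring_of_type_algebra :: 'a free_alg ring"
    by (rule ideal_clifford_ideal)
  have sub: "clifford_relations s q \<subseteq> clifford_ideal s q"
    unfolding clifford_ideal_def
    by (rule ring.genideal_self[OF ring_free_alg]) (simp add: ring_of_type_algebra_def)
  then have "x - y \<in> clifford_ideal s q" using assms by blast
  moreover have "x = (x - y) \<oplus>\<^bsub>ring_of_type_algebra\<^esub> y"
    by (simp add: ring_of_type_algebra_def)
  ultimately have "x \<in> clifford_class s q y"
    unfolding clifford_class_def a_r_coset_def' by blast
  then show ?thesis
    unfolding clifford_class_def
    using I.a_repr_independence'[of x y] by (simp add: ring_of_type_algebra_def)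
qed

lemma cl_vec_add: "cl_vec s q (u + v) = cl_vec s q u \<oplus>\<^bsub>clifford_algebra s q\<^esub> cl_vec s q v"
  unfolding cl_vec_def clifford_class_add[symmetric]
  by (rule clifford_class_eqI) (auto simp: clifford_relations_def)

lemma cl_vec_scale: "cl_vec s q (s c v) = cl_scalar s q c \<otimes>\<^bsub>clifford_algebra s q\<^esub> cl_vec s q v"
  unfolding cl_vec_def cl_scalar_def clifford_class_mult[symmetric]
  by (rule clifford_class_eqI) (auto simp: clifford_relations_def)

lemma cl_vec_square: "cl_vec s q v \<otimes>\<^bsub>clifford_algebra s q\<^esub> cl_vec s q v = cl_scalar s q (q v)"
  unfolding cl_vec_def cl_scalar_def clifford_class_mult[symmetric]
  by (rule clifford_class_eqI) (auto simp: clifford_relations_def)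


section \<open>Spin groups and spin representations\<close>

text \<open>For a non-degenerate subspace \<open>W\<close>, the inclusion of \<open>W\<close> in the ambient space \<open>V\<close> identifies
  the Clifford algebra of \<open>W\<close> with the subalgebra of the Clifford algebra of \<open>V\<close> generated by \<open>W\<close>.
  The even Clifford algebra and the spin group of \<open>W\<close> are therefore taken inside the Clifford
  algebra of \<open>V\<close>; \<open>W = UNIV\<close> gives those of \<open>V\<close>, and the homomorphism from the product of two spin
  groups \<open>Spin(W) \<times> Spin(W')\<close> to \<open>Spin(V)\<close> is multiplication.\<close>

definition even_clifford ::
  "(complex \<Rightarrow> 'v::ab_group_add \<Rightarrow> 'v) \<Rightarrow> ('v \<Rightarrow> complex) \<Rightarrow> 'v set \<Rightarrow> 'v cl set" where
  "even_clifford s q W =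
     generate_ring (clifford_algebra s q)
       (range (cl_scalar s q) \<union>
        {cl_vec s q u \<otimes>\<^bsub>clifford_algebra s q\<^esub> cl_vec s q v | u v. u \<in> W \<and> v \<in> W})"

text \<open>Products of an even number of unit vectors.\<close>

definition spin_group ::
  "(complex \<Rightarrow> 'v::ab_group_add \<Rightarrow> 'v) \<Rightarrow> ('v \<Rightarrow> complex) \<Rightarrow> 'v set \<Rightarrow> 'v cl set" where
  "spin_group s q W =
     generate (clifford_algebra s q)
       {cl_vec s q u \<otimes>\<^bsub>clifford_algebra s q\<^esub> cl_vec s q v | u v.
          u \<in> W \<and> v \<in> W \<and> q u = 1 \<and> q v = 1}"

text \<open>The image of \<open>W\<close> under the vector representation of \<open>g\<close>. No sign twist is needed, \<open>g\<close> being
  even.\<close>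

definition spin_image ::
  "(complex \<Rightarrow> 'v::ab_group_add \<Rightarrow> 'v) \<Rightarrow> ('v \<Rightarrow> complex) \<Rightarrow> 'v cl \<Rightarrow> 'v set \<Rightarrow> 'v set" where
  "spin_image s q g W =
     {w. \<exists>v\<in>W. cl_vec s q w =
        g \<otimes>\<^bsub>clifford_algebra s q\<^esub> cl_vec s q v \<otimes>\<^bsub>clifford_algebra s q\<^esub> inv\<^bsub>clifford_algebra s q\<^esub> g}"

definition even_clifford_module ::
  "(complex \<Rightarrow> 'v::ab_group_add \<Rightarrow> 'v) \<Rightarrow> ('v \<Rightarrow> complex) \<Rightarrow> 'v set \<Rightarrow>
   (complex \<Rightarrow> 's::ab_group_add \<Rightarrow> 's) \<Rightarrow> ('v cl \<Rightarrow> 's \<Rightarrow> 's) \<Rightarrow> bool" where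
  "even_clifford_module s q W t \<rho> \<longleftrightarrow>
     vector_space t \<and>
     (\<forall>x\<in>even_clifford s q W. Vector_Spaces.linear t t (\<rho> x)) \<and>
     (\<forall>c. \<rho> (cl_scalar s q c) = t c) \<and>
     (\<forall>x\<in>even_clifford s q W. \<forall>y\<in>even_clifford s q W.
        \<rho> (x \<oplus>\<^bsub>clifford_algebra s q\<^esub> y) = (\<lambda>z. \<rho> x z + \<rho> y z) \<and>
        \<rho> (x \<otimes>\<^bsub>clifford_algebra s q\<^esub> y) = \<rho> x \<circ> \<rho> y)"

text \<open>The spin representation (\<open>dim W\<close> odd) and the two half-spin representations (\<open>dim W\<close> even)
  are the restrictions to the spin group of the simple modules over the even Clifford algebra.
  The action \<open>\<rho>\<close> of the whole even Clifford algebra is kept as data; its values elsewhere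
  are irrelevant.\<close>

definition spin_representation ::
  "(complex \<Rightarrow> 'v::ab_group_add \<Rightarrow> 'v) \<Rightarrow> ('v \<Rightarrow> complex) \<Rightarrow> 'v set \<Rightarrow>
   (complex \<Rightarrow> 's::ab_group_add \<Rightarrow> 's) \<Rightarrow> ('v cl \<Rightarrow> 's \<Rightarrow> 's) \<Rightarrow> bool" where
  "spin_representation s q W t \<rho> \<longleftrightarrow>
     even_clifford_module s q W t \<rho> \<and>
     (\<exists>z::'s. z \<noteq> 0) \<and>
     (\<forall>U. Modules.module.subspace t U \<and> (\<forall>x\<in>even_clifford s q W. \<rho> x ` U \<subseteq> U) \<longrightarrow>
        U = {0} \<or> U = UNIV)"


section \<open>Projective space and generic spinors\<close>

text \<open>Points of the projective space are lines, as sets of vectors; \<open>[z]\<close> is the line spanned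
  by \<open>z \<noteq> 0\<close>.\<close>

definition proj_point :: "(complex \<Rightarrow> 's::ab_group_add \<Rightarrow> 's) \<Rightarrow> 's \<Rightarrow> 's set" where
  "proj_point t z = Modules.module.span t {z}"

inductive_set polynomial_functions ::
  "(complex \<Rightarrow> 's::ab_group_add \<Rightarrow> 's) \<Rightarrow> ('s \<Rightarrow> complex) set"
  for t :: "complex \<Rightarrow> 's \<Rightarrow> 's" where
  const: "(\<lambda>_. c) \<in> polynomial_functions t"
| linear: "Vector_Spaces.linear t (*) f \<Longrightarrow> f \<in> polynomial_functions t"
| add: "f \<in> polynomial_functions t \<Longrightarrow> g \<in> polynomial_functions t \<Longrightarrow>
          (\<lambda>z. f z + g z) \<in> polynomial_functions t"
| mult: "f \<in> polynomial_functions t \<Longrightarrow> g \<in> polynomial_functions t \<Longrightarrow>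
          (\<lambda>z. f z * g z) \<in> polynomial_functions t"

definition homogeneous_polynomials ::
  "(complex \<Rightarrow> 's::ab_group_add \<Rightarrow> 's) \<Rightarrow> ('s \<Rightarrow> complex) set" where
  "homogeneous_polynomials t =
     {f \<in> polynomial_functions t. \<exists>d::nat. \<forall>c z. f (t c z) = c ^ d * f z}"

text \<open>The complements of the common zero loci of sets of homogeneous polynomials.\<close>

definition zariski_open :: "(complex \<Rightarrow> 's::ab_group_add \<Rightarrow> 's) \<Rightarrow> 's set set \<Rightarrow> bool" where
  "zariski_open t U \<longleftrightarrow>
     (\<exists>F \<subseteq> homogeneous_polynomials t. U = {proj_point t z | z. z \<noteq> 0 \<and> (\<exists>f\<in>F. f z \<noteq> 0)})"

definition proj_orbit ::
  "(complex \<Rightarrow> 's::ab_group_add \<Rightarrow> 's) \<Rightarrow> ('g \<Rightarrow> 's \<Rightarrow> 's) \<Rightarrow> 'g set \<Rightarrow> 's \<Rightarrow> 's set set" where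
  "proj_orbit t \<rho> G z = {proj_point t (\<rho> g z) | g. g \<in> G}"

definition in_open_orbit ::
  "(complex \<Rightarrow> 's::ab_group_add \<Rightarrow> 's) \<Rightarrow> ('g \<Rightarrow> 's \<Rightarrow> 's) \<Rightarrow> 'g set \<Rightarrow> 's \<Rightarrow> bool" where
  "in_open_orbit t \<rho> G z \<longleftrightarrow> z \<noteq> 0 \<and> zariski_open t (proj_orbit t \<rho> G z)"

definition proj_stabilizer ::
  "(complex \<Rightarrow> 's::ab_group_add \<Rightarrow> 's) \<Rightarrow> ('g \<Rightarrow> 's \<Rightarrow> 's) \<Rightarrow> 'g set \<Rightarrow> 's \<Rightarrow> 'g set" where
  "proj_stabilizer t \<rho> G z = {g \<in> G. proj_point t (\<rho> g z) = proj_point t z}"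

text \<open>\<open>[z]\<close> lies outside the invariant quadric. For the spin representation in dimension 7, the
  invariant non-degenerate quadratic form \<open>Q\<close> exists and is unique up to a scalar.\<close>

definition off_invariant_quadric ::
  "(complex \<Rightarrow> 's::ab_group_add \<Rightarrow> 's) \<Rightarrow> ('g \<Rightarrow> 's \<Rightarrow> 's) \<Rightarrow> 'g set \<Rightarrow> 's \<Rightarrow> bool" where
  "off_invariant_quadric t \<rho> G z \<longleftrightarrow>
     (\<exists>Q. quadratic_form t Q \<and> nondegenerate Q \<and> (\<forall>g\<in>G. \<forall>x. Q (\<rho> g x) = Q x) \<and> Q z \<noteq> 0)"


section \<open>Tensor products\<close>

text \<open>The tensor product of two vector spaces is the quotient of the vector space
  \<open>('a \<times> 'b) \<Rightarrow>\<^sub>0 complex\<close> freely spanned by all pairs by the subspace \<open>tensor_relations\<close>; its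
  elements are the cosets \<open>tensor_class\<close>.\<close>

definition free_scale :: "complex \<Rightarrow> ('a \<Rightarrow>\<^sub>0 complex) \<Rightarrow> ('a \<Rightarrow>\<^sub>0 complex)" where
  "free_scale c f = Poly_Mapping.map ((*) c) f"

definition tensor_relations ::
  "(complex \<Rightarrow> 'a::ab_group_add \<Rightarrow> 'a) \<Rightarrow> (complex \<Rightarrow> 'b::ab_group_add \<Rightarrow> 'b) \<Rightarrow>
   ('a \<times> 'b \<Rightarrow>\<^sub>0 complex) set" where
  "tensor_relations s t = Modules.module.span free_scale
     ({Poly_Mapping.single (x + x', y) 1
         - (Poly_Mapping.single (x, y) 1 + Poly_Mapping.single (x', y) 1) | x x' y. True} \<union>
      {Poly_Mapping.single (x, y + y') 1
         - (Poly_Mapping.single (x, y) 1 + Poly_Mapping.single (x, y') 1) | x y y'. True} \<union>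
      {Poly_Mapping.single (s c x, y) 1 - Poly_Mapping.single (x, y) c | c x y. True} \<union>
      {Poly_Mapping.single (x, t c y) 1 - Poly_Mapping.single (x, y) c | c x y. True})"

definition tensor_class ::
  "(complex \<Rightarrow> 'a::ab_group_add \<Rightarrow> 'a) \<Rightarrow> (complex \<Rightarrow> 'b::ab_group_add \<Rightarrow> 'b) \<Rightarrow>
   ('a \<times> 'b \<Rightarrow>\<^sub>0 complex) \<Rightarrow> ('a \<times> 'b \<Rightarrow>\<^sub>0 complex) set" where
  "tensor_class s t f = {g. g - f \<in> tensor_relations s t}"

definition pure_tensor ::
  "(complex \<Rightarrow> 'a::ab_group_add \<Rightarrow> 'a) \<Rightarrow> (complex \<Rightarrow> 'b::ab_group_add \<Rightarrow> 'b) \<Rightarrow>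
   'a \<Rightarrow> 'b \<Rightarrow> ('a \<times> 'b \<Rightarrow>\<^sub>0 complex) set" where
  "pure_tensor s t x y = tensor_class s t (Poly_Mapping.single (x, y) 1)"

text \<open>Linear isomorphisms from the tensor product to a vector space with scalar
  multiplication \<open>r\<close>.\<close>

definition tensor_isomorphism ::
  "(complex \<Rightarrow> 'a::ab_group_add \<Rightarrow> 'a) \<Rightarrow> (complex \<Rightarrow> 'b::ab_group_add \<Rightarrow> 'b) \<Rightarrow>
   (complex \<Rightarrow> 's::ab_group_add \<Rightarrow> 's) \<Rightarrow> (('a \<times> 'b \<Rightarrow>\<^sub>0 complex) set \<Rightarrow> 's) \<Rightarrow> bool" where
  "tensor_isomorphism s t r \<Phi> \<longleftrightarrow>
     bij_betw \<Phi> (range (tensor_class s t)) UNIV \<and>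
     (\<forall>f g. \<Phi> (tensor_class s t (f + g)) = \<Phi> (tensor_class s t f) + \<Phi> (tensor_class s t g)) \<and>
     (\<forall>c f. \<Phi> (tensor_class s t (free_scale c f)) = r c (\<Phi> (tensor_class s t f)))"

text \<open>Isomorphisms that are equivariant under \<open>Spin(W) \<times> Spin(W')\<close>. It suffices to ask for
  equivariance on pure tensors, since they span.\<close>

definition equivariant_tensor_isomorphism ::
  "(complex \<Rightarrow> 'v::ab_group_add \<Rightarrow> 'v) \<Rightarrow> ('v \<Rightarrow> complex) \<Rightarrow> 'v set \<Rightarrow> 'v set \<Rightarrow>
   (complex \<Rightarrow> 'a::ab_group_add \<Rightarrow> 'a) \<Rightarrow> ('v cl \<Rightarrow> 'a \<Rightarrow> 'a) \<Rightarrow>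
   (complex \<Rightarrow> 'b::ab_group_add \<Rightarrow> 'b) \<Rightarrow> ('v cl \<Rightarrow> 'b \<Rightarrow> 'b) \<Rightarrow>
   (complex \<Rightarrow> 's::ab_group_add \<Rightarrow> 's) \<Rightarrow> ('v cl \<Rightarrow> 's \<Rightarrow> 's) \<Rightarrow>
   (('a \<times> 'b \<Rightarrow>\<^sub>0 complex) set \<Rightarrow> 's) \<Rightarrow> bool" where
  "equivariant_tensor_isomorphism s q W W' ta \<rho>a tb \<rho>b t \<rho> \<Phi> \<longleftrightarrow>
     tensor_isomorphism ta tb t \<Phi> \<and>
     (\<forall>g\<in>spin_group s q W. \<forall>h\<in>spin_group s q W'. \<forall>x y.
        \<Phi> (pure_tensor ta tb (\<rho>a g x) (\<rho>b h y)) =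
        \<rho> (g \<otimes>\<^bsub>clifford_algebra s q\<^esub> h) (\<Phi> (pure_tensor ta tb x y)))"


section \<open>Decompositions preserved by the stabilizer\<close>

text \<open>As the pair is unordered, an element of the stabilizer may exchange the two summands.\<close>

definition preserved_decomposition ::
  "(complex \<Rightarrow> 'v::ab_group_add \<Rightarrow> 'v) \<Rightarrow> ('v \<Rightarrow> complex) \<Rightarrow>
   (complex \<Rightarrow> 's::ab_group_add \<Rightarrow> 's) \<Rightarrow> ('v cl \<Rightarrow> 's \<Rightarrow> 's) \<Rightarrow> 's \<Rightarrow> 'v set \<Rightarrow> 'v set \<Rightarrow> bool" where
  "preserved_decomposition s q t \<rho> z W W' \<longleftrightarrow>
     orthogonal_decomposition s q W W' \<and>
     vector_space.dim s W = 7 \<and> vector_space.dim s W' = 7 \<and>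
     (\<forall>g\<in>proj_stabilizer t \<rho> (spin_group s q UNIV) z. spin_image s q g ` {W, W'} = {W, W'})"

end

theory Submission
  imports Defs
begin

text \<open>Fix an orthonormal basis \<open>e 0, \<dots>, e 13\<close> of \<open>V\<close>. On an even Clifford module, multiplying \<open>e i\<close> by the volume
  element of \<open>e 0, \<dots>, e 6\<close> gives seven anticommuting operators \<open>f i\<close> with square \<open>-1\<close>; the last seven
  vectors give operators \<open>f' j\<close> commuting with them. A spinor is adapted to \<open>e\<close> if
  \<open>f k (f (k + 1) x) = f (k + 3) x\<close> for all \<open>k\<close> modulo 7, and likewise for \<open>f'\<close>: it behaves like \<open>1 \<otimes> 1\<close> in
  (octonions \<open>\<otimes>\<close> octonions). Adapted spinors exist because the triple products along Fano lines are
  commuting involutions; for adapted \<open>x\<close> the 64 vectors \<open>x\<close>, \<open>f i x\<close>, \<open>f' j x\<close>, \<open>f i (f' j x)\<close> form a basis of the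
  half-spin module, so \<open>x\<close> is unique up to a scalar and the tangent space of its orbit, together with
  \<open>x\<close>, is everything. A polynomial vanishing on the cone over the orbit then has all its derivatives
  vanishing there, hence is zero: the orbit is dense, meets the open orbit, and every generic spinor is
  adapted to some orthonormal basis.

  Let \<open>x\<close> be adapted. If \<open>u\<close> and \<open>w\<close> are independent and \<open>u w x = 0\<close>, both lie in the span \<open>V7\<close> of the first
  seven vectors or both in the span \<open>V7'\<close> of the last seven; conversely isotropic such pairs connect a
  spanning set of each summand. As the stabilizer carries \<open>e\<close> to other bases to which \<open>x\<close> is adapted, it
  preserves \<open>{V7, V7'}\<close>. For uniqueness, the unipotent elements \<open>1 + w u\<close> lie in the stabilizer, and their
  squares preserve each summand of a preserved decomposition, which forces \<open>u, w\<close> into one summand.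

  In the simple module of \<open>V7\<close> the same equations single out a line \<open>[\<chi>]\<close>, with \<open>\<chi>\<close> and the \<open>f i \<chi>\<close> orthonormal
  for the invariant form. Matching the bases gives the equivariant isomorphism, and any equivariant
  isomorphism sends \<open>\<chi> \<otimes> \<chi>'\<close> to an adapted spinor, that is, to a multiple of \<open>\<psi>\<close>.\<close>

declare One_nat_def [simp del] \<comment> \<open>keeps the index 1 a numeral in rewrite rules\<close>

lemma all_less_7: "(\<forall>k<7. P k) \<longleftrightarrow> P 0 \<and> P 1 \<and> P 2 \<and> P 3 \<and> P 4 \<and> P 5 \<and> P (6::nat)"
  by (simp add: numeral_eq_Suc All_less_Suc One_nat_def conj_ac)

lemma all_less_8: "(\<forall>k<8. P k) \<longleftrightarrow> P 0 \<and> P 1 \<and> P 2 \<and> P 3 \<and> P 4 \<and> P 5 \<and> P 6 \<and> P (7::nat)"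
  by (simp add: numeral_eq_Suc All_less_Suc One_nat_def conj_ac)

lemma sum_less_8:
  "(\<Sum>k<8. g k) = g 0 + g 1 + g 2 + g 3 + g 4 + g 5 + g 6 + g (7::nat)"
  by (simp add: numeral_eq_Suc One_nat_def)

section \<open>Octonionic operators\<close>

text \<open>Octonion units are indexed by residues modulo 7, with lines \<open>{k, k + 1, k + 3}\<close> of the Fano plane.
  With \<open>F 0 = id\<close> and \<open>F (i + 1) = f i\<close>, the table below is read off from
  \<open>f j (F a x) = oct_sign j a * F (oct_index j a) x\<close>; the residues 1, 2, 4 are the squares modulo 7.\<close>

definition oct_index :: "nat \<Rightarrow> nat \<Rightarrow> nat" where
  "oct_index j a = (if a = 0 then Suc j else let d = (a + 6 - j) mod 7 in
     if d = 0 then 0 else if d \<in> {1, 2, 4} then Suc ((j + 3 * d) mod 7)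
     else Suc ((j + 5 * d) mod 7))"

definition oct_sign :: "nat \<Rightarrow> nat \<Rightarrow> complex" where
  "oct_sign j a = (if a = 0 \<or> (a + 6 - j) mod 7 \<in> {1, 2, 4} then 1 else - 1)"

lemma oct_index_less: "j < 7 \<Longrightarrow> a < 8 \<Longrightarrow> oct_index j a < 8"
  by (auto simp: oct_index_def Let_def)

text \<open>Multiplication by an octonion unit permutes the units up to sign and has square -1, so
  the permutation is an involution. Later expansions reindex their sums by it.\<close>

lemma oct_index_involution:
  assumes "j < 7" "a < 8" shows "oct_index j (oct_index j a) = a"
proof -
  have "\<forall>j<7. \<forall>a<8. oct_index j (oct_index j a) = a"
    unfolding all_less_7 all_less_8 by (simp add: oct_index_def)
  then show ?thesis using assms by blast
qed

lemma oct_sign_square [simp]: "oct_sign j a * oct_sign j a = 1"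
  by (simp add: oct_sign_def)

text \<open>The first three axioms describe a module over the complex Clifford algebra on seven
  generators. Its volume element is central with square 1; \<open>vol\<close> fixes the sign
  compatible with the orientation of the Fano lines.\<close>

locale octonion_operators = vector_space t for t :: "complex \<Rightarrow> 's::ab_group_add \<Rightarrow> 's" +
  fixes f :: "nat \<Rightarrow> 's \<Rightarrow> 's"
  assumes lin: "i < 7 \<Longrightarrow> Vector_Spaces.linear t t (f i)"
    and sq: "i < 7 \<Longrightarrow> f i (f i x) = - x"
    and anti: "i < 7 \<Longrightarrow> j < 7 \<Longrightarrow> i \<noteq> j \<Longrightarrow> f i (f j x) = - f j (f i x)"
    and vol: "f 0 (f 1 (f 2 (f 3 (f 4 (f 5 (f 6 x)))))) = - x"
begin

lemma f_add: "i < 7 \<Longrightarrow> f i (x + y) = f i x + f i y"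
  and f_scale: "i < 7 \<Longrightarrow> f i (t c x) = t c (f i x)"
  using lin[of i] by (simp_all add: Vector_Spaces.linear_iff)

lemma f_minus: "i < 7 \<Longrightarrow> f i (- x) = - f i x"
  using f_scale[of i "-1" x] by simp

lemma f_diff: "i < 7 \<Longrightarrow> f i (x - y) = f i x - f i y"
  using f_add[of i x "- y"] f_minus[of i y] by simp

lemma f_0: "i < 7 \<Longrightarrow> f i 0 = 0"
  using f_scale[of i 0 0] by simp

lemma f_sum: "i < 7 \<Longrightarrow> f i (sum g A) = (\<Sum>a\<in>A. f i (g a))"
  by (induction A rule: infinite_finite_induct) (simp_all add: f_0 f_add)

lemma f_eq_0_iff: "i < 7 \<Longrightarrow> f i x = 0 \<longleftrightarrow> x = 0"
  using sq[of i x] f_0[of i] by auto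

text \<open>Oriented so that rewriting puts every monomial into increasing order of indices; with
  \<open>sq\<close> and \<open>f_minus\<close>, identities between monomials become
  computations.\<close>

lemma sort:
  "f 1 (f 0 x) = - f 0 (f 1 x)" "f 2 (f 0 x) = - f 0 (f 2 x)" "f 3 (f 0 x) = - f 0 (f 3 x)"
  "f 4 (f 0 x) = - f 0 (f 4 x)" "f 5 (f 0 x) = - f 0 (f 5 x)" "f 6 (f 0 x) = - f 0 (f 6 x)"
  "f 2 (f 1 x) = - f 1 (f 2 x)" "f 3 (f 1 x) = - f 1 (f 3 x)" "f 4 (f 1 x) = - f 1 (f 4 x)"
  "f 5 (f 1 x) = - f 1 (f 5 x)" "f 6 (f 1 x) = - f 1 (f 6 x)" "f 3 (f 2 x) = - f 2 (f 3 x)"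
  "f 4 (f 2 x) = - f 2 (f 4 x)" "f 5 (f 2 x) = - f 2 (f 5 x)" "f 6 (f 2 x) = - f 2 (f 6 x)"
  "f 4 (f 3 x) = - f 3 (f 4 x)" "f 5 (f 3 x) = - f 3 (f 5 x)" "f 6 (f 3 x) = - f 3 (f 6 x)"
  "f 5 (f 4 x) = - f 4 (f 5 x)" "f 6 (f 4 x) = - f 4 (f 6 x)" "f 6 (f 5 x) = - f 5 (f 6 x)"
  by (rule anti; simp)+

text \<open>These are the equations satisfied by the octonion unit 1 under left multiplication along
  the oriented lines. The name refers to the stabilizer of a non-null spinor in Spin(7), a group of
  type G2. The equations are linear, and 0 is allowed.\<close>

definition g2_spinor :: "'s \<Rightarrow> bool" where
  "g2_spinor x \<longleftrightarrow> (\<forall>k<7. f k (f ((k + 1) mod 7) x) = f ((k + 3) mod 7) x)"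

lemma g2_spinorD:
  assumes "g2_spinor x"
  shows "f 0 (f 1 x) = f 3 x" "f 1 (f 2 x) = f 4 x" "f 2 (f 3 x) = f 5 x" "f 3 (f 4 x) = f 6 x"
    "f 4 (f 5 x) = f 0 x" "f 5 (f 6 x) = f 1 x" "f 0 (f 6 x) = - f 2 x"
  using assms unfolding g2_spinor_def all_less_7
  by (simp_all add: sort flip: One_nat_def) (metis minus_minus)

text \<open>Applying \<open>f k\<close> turns \<open>f k y = z\<close> into
  \<open>f k z = - y\<close>. The seven defining equations and these 14 consequences cover all pairs
  of distinct indices.\<close>

lemma g2_spinor_prod:
  assumes x: "g2_spinor x"
  shows
    "f 1 (f 3 x) = f 0 x" "f 2 (f 4 x) = f 1 x" "f 3 (f 5 x) = f 2 x" "f 4 (f 6 x) = f 3 x"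
    "f 0 (f 5 x) = - f 4 x" "f 1 (f 6 x) = - f 5 x" "f 0 (f 2 x) = f 6 x"
    "f 0 (f 3 x) = - f 1 x" "f 1 (f 4 x) = - f 2 x" "f 2 (f 5 x) = - f 3 x"
    "f 3 (f 6 x) = - f 4 x" "f 0 (f 4 x) = f 5 x" "f 1 (f 5 x) = f 6 x" "f 2 (f 6 x) = f 0 x"
proof -
  have a: "f k y = z \<Longrightarrow> f k z = - y" if "k < 7" for k y z using sq[OF that, of y] by auto
  note D = g2_spinorD[OF x]
  show "f 1 (f 3 x) = f 0 x"
    using a[of 1 "f 0 x" "- f 3 x"] D(1) by (simp add: sort f_minus)
  show "f 2 (f 4 x) = f 1 x"
    using a[of 2 "f 1 x" "- f 4 x"] D(2) by (simp add: sort f_minus)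
  show "f 3 (f 5 x) = f 2 x"
    using a[of 3 "f 2 x" "- f 5 x"] D(3) by (simp add: sort f_minus)
  show "f 4 (f 6 x) = f 3 x"
    using a[of 4 "f 3 x" "- f 6 x"] D(4) by (simp add: sort f_minus)
  show "f 0 (f 5 x) = - f 4 x"
    using a[of 5 "f 4 x" "- f 0 x"] D(5) by (simp add: sort f_minus minus_equation_iff)
  show "f 1 (f 6 x) = - f 5 x"
    using a[of 6 "f 5 x" "- f 1 x"] D(6) by (simp add: sort f_minus minus_equation_iff)
  show "f 0 (f 2 x) = f 6 x"
    using a[of 0 "f 6 x" "- f 2 x"] D(7) by (simp add: sort f_minus)
  show "f 0 (f 3 x) = - f 1 x"
    using a[of 0 "f 1 x" "f 3 x"] D(1) by (simp add: sort f_minus)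
  show "f 1 (f 4 x) = - f 2 x"
    using a[of 1 "f 2 x" "f 4 x"] D(2) by (simp add: sort f_minus)
  show "f 2 (f 5 x) = - f 3 x"
    using a[of 2 "f 3 x" "f 5 x"] D(3) by (simp add: sort f_minus)
  show "f 3 (f 6 x) = - f 4 x"
    using a[of 3 "f 4 x" "f 6 x"] D(4) by (simp add: sort f_minus)
  show "f 0 (f 4 x) = f 5 x"
    using a[of 4 "f 5 x" "f 0 x"] D(5) by (simp add: sort f_minus)
  show "f 1 (f 5 x) = f 6 x"
    using a[of 5 "f 6 x" "f 1 x"] D(6) by (simp add: sort f_minus)
  show "f 2 (f 6 x) = f 0 x"
    using a[of 6 "f 0 x" "f 2 x"] D(7) by (simp add: sort f_minus)
qed

definition F :: "nat \<Rightarrow> 's \<Rightarrow> 's" where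
  "F a x = (if a = 0 then x else f (a - 1) x)"

lemma F_0 [simp]: "F 0 x = x" and F_Suc [simp]: "F (Suc i) x = f i x"
  by (simp_all add: F_def One_nat_def)

lemma F_numeral: "F (Suc 0) x = f 0 x" "F 1 x = f 0 x" "F 2 x = f 1 x" "F 3 x = f 2 x" "F 4 x = f 3 x" "F 5 x = f 4 x"
  "F 6 x = f 5 x" "F 7 x = f 6 x"
  by (simp_all add: F_def flip: One_nat_def)

lemma F_add: "a < 8 \<Longrightarrow> F a (x + y) = F a x + F a y"
  and F_scale: "a < 8 \<Longrightarrow> F a (t c x) = t c (F a x)"
  and F_sum: "a < 8 \<Longrightarrow> F a (sum g A) = (\<Sum>b\<in>A. F a (g b))"
  by (auto simp: F_def f_add f_scale f_sum)

lemma f_F: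
  assumes "g2_spinor x" "j < 7" "a < 8"
  shows "f j (F a x) = t (oct_sign j a) (F (oct_index j a) x)"
proof -
  have "\<forall>j<7. \<forall>a<8. f j (F a x) = t (oct_sign j a) (F (oct_index j a) x)"
    unfolding all_less_7 all_less_8
    by (simp add: oct_sign_def oct_index_def F_numeral sort sq g2_spinorD[OF assms(1)]
        g2_spinor_prod[OF assms(1)] flip: One_nat_def)
  then show ?thesis using assms by blast
qed

lemma subspace_g2_spinor: "subspace {x. g2_spinor x}"
proof (rule subspaceI)
qed (simp_all add: g2_spinor_def f_0 f_add f_scale)

lemma g2_spinor_scale: "g2_spinor x \<Longrightarrow> g2_spinor (t c x)"
  and g2_spinor_sum: "(\<And>a. a \<in> A \<Longrightarrow> g2_spinor (h a)) \<Longrightarrow> g2_spinor (sum h A)"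
  using subspace_scale[OF subspace_g2_spinor, of x c]
    subspace_sum[OF subspace_g2_spinor, of A h] by auto

definition fano_line :: "nat \<Rightarrow> 's \<Rightarrow> 's" where
  "fano_line k x = f k (f (k + 1) (f (k + 3) x))"

text \<open>The operators \<open>fano_line k\<close> are commuting involutions, equal to \<open>-1\<close> on \<open>g2_spinor\<close>s, and each
  \<open>f i\<close> anticommutes with one of the first three: they separate the eight summands \<open>F a\<close>.\<close>

lemma fano_line_g2_spinor:
  assumes "g2_spinor x" shows "fano_line 0 x = - x" "fano_line 1 x = - x" "fano_line 2 x = - x"
  by (simp_all add: fano_line_def g2_spinor_prod[OF assms] sq flip: One_nat_def)

lemma g2_spinor_component_0:
  assumes g: "\<And>a. a < 8 \<Longrightarrow> g2_spinor (y a)" and s: "(\<Sum>a<8. F a (y a)) = 0"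
  shows "y 0 = 0"
proof -
  note D = g[THEN g2_spinorD(1)] g[THEN g2_spinorD(2)] g[THEN g2_spinorD(3)] g[THEN g2_spinorD(4)]
    g[THEN g2_spinorD(5)] g[THEN g2_spinorD(6)] g[THEN g2_spinorD(7)]
  have l: "fano_line 0 (y a) = - y a" "fano_line 1 (y a) = - y a" "fano_line 2 (y a) = - y a" if "a < 8" for a
    using that g by (simp_all add: fano_line_g2_spinor)
  have s': "y 0 + f 0 (y 1) + f 1 (y 2) + f 2 (y 3) + f 3 (y 4) + f 4 (y 5) + f 5 (y 6) + f 6 (y 7) = 0"
    using s by (simp add: sum_less_8 F_numeral)
  have two: "t 2 x = x + x" for x using scale_left_distrib[of 1 1 x] by simp
  have lin0: "fano_line k (u + v) = fano_line k u + fano_line k v" "fano_line k (- u) = - fano_line k u" if "k < 4" for k u v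
    using that by (simp_all add: fano_line_def f_add f_minus)
  have c: "fano_line 0 (f 0 x) = f 0 (fano_line 0 x)" "fano_line 0 (f 1 x) = f 1 (fano_line 0 x)"
    "fano_line 0 (f 2 x) = - f 2 (fano_line 0 x)" "fano_line 0 (f 3 x) = f 3 (fano_line 0 x)"
    "fano_line 0 (f 4 x) = - f 4 (fano_line 0 x)" "fano_line 0 (f 5 x) = - f 5 (fano_line 0 x)"
    "fano_line 0 (f 6 x) = - f 6 (fano_line 0 x)" "fano_line 1 (f 0 x) = - f 0 (fano_line 1 x)"
    "fano_line 1 (f 1 x) = f 1 (fano_line 1 x)" "fano_line 1 (f 3 x) = - f 3 (fano_line 1 x)"
    "fano_line 2 (f 1 x) = - f 1 (fano_line 2 x)" for x
    by (simp_all add: fano_line_def sort sq f_minus)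
  \<comment> \<open>Each involution acts on a summand by a sign, negative exactly when it commutes
    with the operator in front. Subtracting the transformed relation keeps the negated summands,
    doubled: eight terms become four, then two, then one.\<close>
  have "fano_line 0 (y 0 + f 0 (y 1) + f 1 (y 2) + f 2 (y 3) + f 3 (y 4) + f 4 (y 5) + f 5 (y 6) + f 6 (y 7)) = 0"
    unfolding s' by (simp add: fano_line_def f_0)
  then have "- y 0 - f 0 (y 1) - f 1 (y 2) + f 2 (y 3) - f 3 (y 4) + f 4 (y 5) + f 5 (y 6) + f 6 (y 7) = 0"
    by (simp add: lin0 c l f_minus)
  note e = arg_cong2[OF s' this, of "(-)"]
  have "t 2 (y 0 + f 0 (y 1) + f 1 (y 2) + f 3 (y 4)) = 0"
    unfolding two using e by (simp add: algebra_simps)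
  then have s1: "y 0 + f 0 (y 1) + f 1 (y 2) + f 3 (y 4) = 0" by simp
  have "fano_line 1 (y 0 + f 0 (y 1) + f 1 (y 2) + f 3 (y 4)) = 0"
    unfolding s1 by (simp add: fano_line_def f_0)
  then have "- y 0 + f 0 (y 1) - f 1 (y 2) + f 3 (y 4) = 0"
    by (simp add: lin0 c l f_minus)
  note e = arg_cong2[OF s1 this, of "(-)"]
  have "t 2 (y 0 + f 1 (y 2)) = 0"
    unfolding two using e by (simp add: algebra_simps)
  then have s2: "y 0 + f 1 (y 2) = 0" by simp
  have "fano_line 2 (y 0 + f 1 (y 2)) = 0"
    unfolding s2 by (simp add: fano_line_def f_0)
  then have "- y 0 + f 1 (y 2) = 0"
    by (simp add: lin0 c l f_minus)
  note e = arg_cong2[OF s2 this, of "(-)"]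
  have "t 2 (y 0) = 0"
    unfolding two using e by (simp add: algebra_simps)
  then show ?thesis by simp
qed

text \<open>Applying \<open>f j\<close> with \<open>a = Suc j\<close> permutes the summands up to
  sign and moves component \<open>a\<close> to position 0.\<close>

lemma g2_spinor_components:
  assumes g: "\<And>a. a < 8 \<Longrightarrow> g2_spinor (y a)" and s: "(\<Sum>a<8. F a (y a)) = 0" and a: "a < 8"
  shows "y a = 0"
proof (cases a)
  case 0
  then show ?thesis using g2_spinor_component_0[OF g s] by simp
next
  case (Suc j)
  then have j: "j < 7" using a by simp
  have "0 = f j (\<Sum>a<8. F a (y a))" using s j by (simp add: f_0)
  also have "\<dots> = (\<Sum>a<8. t (oct_sign j a) (F (oct_index j a) (y a)))"
    using j g by (simp add: f_sum f_F)
  also have "\<dots> = (\<Sum>a<8. t (oct_sign j (oct_index j a)) (F a (y (oct_index j a))))"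
    by (rule sum.reindex_bij_witness[of _ "oct_index j" "oct_index j"])
       (use j in \<open>auto simp: oct_index_involution oct_index_less\<close>)
  also have "\<dots> = (\<Sum>a<8. F a (t (oct_sign j (oct_index j a)) (y (oct_index j a))))"
    by (simp add: F_scale)
  finally have "t (oct_sign j (oct_index j 0)) (y (oct_index j 0)) = 0"
    by (intro g2_spinor_component_0[of "\<lambda>a. t (oct_sign j (oct_index j a)) (y (oct_index j a))"])
       (auto intro!: g2_spinor_scale g simp: oct_index_less j)
  then show ?thesis using Suc j by (simp add: oct_sign_def oct_index_def split: if_splits)
qed

lemma F_independent:
  assumes "g2_spinor x" "x \<noteq> 0" "(\<Sum>a<8. t (c a) (F a x)) = 0" "a < 8"
  shows "c a = 0"
proof -
  have "t (c a) x = 0"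
    using assms by (intro g2_spinor_components[of "\<lambda>a. t (c a) x"]) (auto intro: g2_spinor_scale simp: F_scale)
  then show ?thesis using assms by simp
qed

lemma f_F_sum:
  assumes "g2_spinor x" "j < 7"
  shows "f j (\<Sum>a<8. t (c a) (F a x)) =
    (\<Sum>a<8. t (oct_sign j (oct_index j a) * c (oct_index j a)) (F a x))"
proof -
  have "f j (\<Sum>a<8. t (c a) (F a x)) = (\<Sum>a<8. t (oct_sign j a * c a) (F (oct_index j a) x))"
    using assms by (simp add: f_sum f_F f_scale mult.commute)
  also have "\<dots> = (\<Sum>a<8. t (oct_sign j (oct_index j a) * c (oct_index j a)) (F a x))"
    by (rule sum.reindex_bij_witness[of _ "oct_index j" "oct_index j"])
       (use assms in \<open>auto simp: oct_index_involution oct_index_less\<close>)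
  finally show ?thesis .
qed

text \<open>Three line products acting as -1 force the same for the other four, with the help of
  \<open>vol\<close>. Each of the seven triple relations is then a defining equation.\<close>

lemma g2_spinorI:
  assumes l: "fano_line 0 x = - x" "fano_line 1 x = - x" "fano_line 2 x = - x"
  shows "g2_spinor x"
proof -
  have a: "f j (f k x) = f i x" if "f j (f k (f i x)) = - x" "i < 7" "j < 7" "k < 7" "i \<noteq> j" "i \<noteq> k" for i j k
  proof -
    have "f i (f j (f k x)) = - x" using that by (metis anti f_minus minus_minus)
    then have "f i (f i (f j (f k x))) = - f i x" using that f_minus by simp
    then show ?thesis using sq that by simp
  qed
  have m: "fano_line k (- y) = - fano_line k y" if "k < 4" for k y using that by (simp add: fano_line_def f_minus)
  \<comment> \<open>The lines {0, 1, 3} and {2, 3, 5} have symmetric difference {0, 1, 2, 5}, the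
    complement of {3, 4, 6}; the volume element turns their product into the line product for {3, 4,
    6}.\<close>
  have e: "f 0 (f 1 (f 2 (f 3 (f 4 (f 5 (f 6 (fano_line 0 (fano_line 2 x)))))))) = fano_line 3 x"
    by (simp add: fano_line_def sort sq f_minus flip: One_nat_def)
  then have 3: "fano_line 3 x = - x" unfolding vol by (simp add: l m)
  have "f 4 (f 5 (f 0 x)) = fano_line 0 (fano_line 1 (fano_line 2 x))"
    "f 5 (f 6 (f 1 x)) = fano_line 1 (fano_line 2 (fano_line 3 x))"
    by (simp_all add: fano_line_def sort sq f_minus flip: One_nat_def)
  then have 45: "f 4 (f 5 (f 0 x)) = - x" "f 5 (f 6 (f 1 x)) = - x" by (simp_all add: l m 3)
  have "f 6 (f 0 (f 2 x)) = fano_line 2 (fano_line 3 (f 4 (f 5 (f 0 x))))"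
    by (simp_all add: fano_line_def sort sq f_minus flip: One_nat_def)
  then have 6: "f 6 (f 0 (f 2 x)) = - x" by (simp add: l m 3 45)
  show ?thesis unfolding g2_spinor_def all_less_7
    using a[of 0 1 3] a[of 1 2 4] a[of 2 3 5] a[of 3 4 6] a[of 4 5 0] a[of 5 6 1] a[of 6 0 2] l 3 45 6
    by (simp add: fano_line_def flip: One_nat_def)
qed

text \<open>If the involution moves \<open>x\<close>, then \<open>x - fano_line k x\<close> is an
  eigenvector for -1; if it fixes \<open>x\<close>, then \<open>f j x\<close> is one by
  anticommutation. The predicate \<open>P\<close> carries the eigenvalue equations already obtained
  for other lines.\<close>

lemma fano_line_eigenvector:
  assumes U: "subspace U" and k: "k < 3" and x: "x \<in> U" "x \<noteq> 0" and j: "j < 7"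
    and jU: "f j x \<in> U" and lU: "fano_line k x \<in> U"
    and c: "fano_line k (f j x) = - f j (fano_line k x)"
    and P: "P (x - fano_line k x)" "P (f j x)"
  shows "\<exists>y\<in>U. y \<noteq> 0 \<and> fano_line k y = - y \<and> P y"
proof -
  have inv: "fano_line k (fano_line k y) = y" for y
  proof -
    have "k = 0 \<or> k = 1 \<or> k = 2" using k by arith
    then show ?thesis by (elim disjE) (simp_all add: fano_line_def sort sq f_minus flip: One_nat_def)
  qed
  have d: "fano_line k (x - fano_line k x) = fano_line k x - fano_line k (fano_line k x)"
    using k by (simp add: fano_line_def f_diff)
  show ?thesis
  proof (cases "x = fano_line k x")
    case True
    have "fano_line k (f j x) = - f j x" unfolding c by (simp only: True[symmetric])
    moreover have "f j x \<noteq> 0" using x j by (simp add: f_eq_0_iff)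
    ultimately show ?thesis using jU P(2) by (intro bexI[of _ "f j x"]) simp_all
  next
    case False
    have "fano_line k (x - fano_line k x) = - (x - fano_line k x)" unfolding d inv by simp
    moreover have "x - fano_line k x \<in> U" using U x(1) lU by (rule subspace_diff)
    moreover have "x - fano_line k x \<noteq> 0" using False by simp
    ultimately show ?thesis using P(1) by (intro bexI[of _ "x - fano_line k x"]) simp_all
  qed
qed

lemma g2_spinor_exists:
  assumes U: "subspace U" and st: "\<And>j x. j < 7 \<Longrightarrow> x \<in> U \<Longrightarrow> f j x \<in> U" and x: "x \<in> U" "x \<noteq> 0"
  shows "\<exists>y\<in>U. y \<noteq> 0 \<and> g2_spinor y"
proof -
  have lU: "fano_line k y \<in> U" if "k < 3" "y \<in> U" for k y
    using that by (simp add: fano_line_def st)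
  have ld: "fano_line k (y - z) = fano_line k y - fano_line k z" if "k < 3" for k y z
    using that by (simp add: fano_line_def f_diff)
  have lm: "fano_line k (- y) = - fano_line k y" if "k < 3" for k y
    using that by (simp add: fano_line_def f_minus)
  note s = fano_line_def sort sq f_minus f_diff
  have c: "fano_line 0 (f 2 y) = - f 2 (fano_line 0 y)" "fano_line 1 (f 0 y) = - f 0 (fano_line 1 y)"
    "fano_line 2 (f 1 y) = - f 1 (fano_line 2 y)" for y
    by (simp_all add: s flip: One_nat_def)
  have cc: "fano_line 0 (fano_line 1 y) = fano_line 1 (fano_line 0 y)" "fano_line 0 (fano_line 2 y) = fano_line 2 (fano_line 0 y)"
    "fano_line 1 (fano_line 2 y) = fano_line 2 (fano_line 1 y)" "fano_line 0 (f 0 y) = f 0 (fano_line 0 y)"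
    "fano_line 0 (f 1 y) = f 1 (fano_line 0 y)" "fano_line 1 (f 1 y) = f 1 (fano_line 1 y)" for y
    by (simp_all add: s flip: One_nat_def)
  have "\<exists>y\<in>U. y \<noteq> 0 \<and> fano_line 0 y = - y \<and> True"
    by (rule fano_line_eigenvector[where j = 2, OF U _ x]) (simp_all add: x st lU c)
  then obtain y0 where y0: "y0 \<in> U" "y0 \<noteq> 0" "fano_line 0 y0 = - y0" by blast
  have "\<exists>y\<in>U. y \<noteq> 0 \<and> fano_line 1 y = - y \<and> fano_line 0 y = - y"
    by (rule fano_line_eigenvector[where j = 0, OF U _ y0(1,2)]) (simp_all add: y0 st lU c ld lm cc f_minus)
  then obtain y1 where y1: "y1 \<in> U" "y1 \<noteq> 0" "fano_line 1 y1 = - y1" "fano_line 0 y1 = - y1" by blast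
  have "\<exists>y\<in>U. y \<noteq> 0 \<and> fano_line 2 y = - y \<and> (fano_line 0 y = - y \<and> fano_line 1 y = - y)"
    by (rule fano_line_eigenvector[where j = 1, OF U _ y1(1,2)]) (simp_all add: y1 st lU c ld lm cc f_minus)
  then obtain y2 where y2: "y2 \<in> U" "y2 \<noteq> 0" "fano_line 2 y2 = - y2" "fano_line 0 y2 = - y2" "fano_line 1 y2 = - y2"
    by blast
  then show ?thesis using g2_spinorI by blast
qed

end

section \<open>Even Clifford modules\<close>

locale quadratic_space =
  V: vector_space s for s :: "complex \<Rightarrow> 'v::ab_group_add \<Rightarrow> 'v" +
  fixes q :: "'v \<Rightarrow> complex"
  assumes qf: "quadratic_form s q"
begin

abbreviation B :: "'v \<Rightarrow> 'v \<Rightarrow> complex" where "B \<equiv> polar_form q"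
abbreviation R :: "'v cl ring" where "R \<equiv> clifford_algebra s q"
abbreviation vec :: "'v \<Rightarrow> 'v cl" where "vec \<equiv> cl_vec s q"
abbreviation sc :: "complex \<Rightarrow> 'v cl" where "sc \<equiv> cl_scalar s q"

sublocale R: ring R by (rule ring_clifford_algebra)

lemma B_sym: "B u v = B v u"
  by (simp add: polar_form_def algebra_simps)

lemma B_lin: "Vector_Spaces.linear s (*) (B u)"
  using qf by (simp add: quadratic_form_def)

lemma B_addr: "B u (v + w) = B u v + B u w" and B_scaler: "B u (s c v) = c * B u v"
  using B_lin[of u] by (simp_all add: Vector_Spaces.linear_iff)

lemma B_addl: "B (v + w) u = B v u + B w u" and B_scalel: "B (s c v) u = c * B v u"
  by (simp_all add: B_sym[of _ u] B_addr B_scaler)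

lemma B_minusr: "B u (- v) = - B u v" and B_minusl: "B (- v) u = - B v u"
  using B_scaler[of u "-1" v] B_scalel[of "-1" v u] by simp_all

lemma B_diffr: "B u (v - w) = B u v - B u w" and B_diffl: "B (v - w) u = B v u - B w u"
  using B_addr[of u v "- w"] B_addl[of v "- w" u] by (simp_all add: B_minusr B_minusl)

lemma B_0r [simp]: "B u 0 = 0" and B_0l [simp]: "B 0 u = 0"
  using B_scaler[of u 0 0] B_scalel[of 0 0 u] by simp_all

lemma B_sumr: "B u (sum g A) = (\<Sum>a\<in>A. B u (g a))"
  and B_suml: "B (sum g A) u = (\<Sum>a\<in>A. B (g a) u)"
  by (induction A rule: infinite_finite_induct) (simp_all add: B_addr B_addl)

lemmas B_simps = B_addr B_addl B_scaler B_scalel B_minusr B_minusl B_diffr B_diffl B_sumr B_suml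

lemma q_scale: "q (s c v) = c\<^sup>2 * q v"
  using qf by (simp add: quadratic_form_def)

lemma q_add: "q (u + v) = q u + q v + B u v"
  by (simp add: polar_form_def)

lemma B_self: "B u u = 2 * q u"
proof -
  have "q (u + u) = 4 * q u" using q_scale[of 2 u] V.scale_left_distrib[of 1 1 u] by simp
  then show ?thesis by (simp add: polar_form_def)
qed

lemma q_diff: "q (u - v) = q u + q v - B u v"
  using q_add[of u "- v"] q_scale[of "-1" v] by (simp add: B_minusr)

lemma cl_class_closed: "clifford_class s q x \<in> carrier R"
  using ring_hom_closed[OF clifford_class_hom] by (simp add: ring_of_type_algebra_def)

lemma vec_closed [simp, intro]: "vec v \<in> carrier R"
  by (simp add: cl_vec_def cl_class_closed)

lemma sc_closed [simp, intro]: "sc c \<in> carrier R"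
  by (simp add: cl_scalar_def cl_class_closed)

lemma sc_1: "sc 1 = \<one>\<^bsub>R\<^esub>"
  using ring_hom_one[OF clifford_class_hom[of s q]]
  by (simp add: ring_of_type_algebra_def cl_scalar_def free_scalar_def)

lemma sc_mult: "sc c \<otimes>\<^bsub>R\<^esub> sc d = sc (c * d)"
  by (simp add: cl_scalar_def free_scalar_def clifford_class_mult[symmetric] mult_single)

lemma sc_add: "sc c \<oplus>\<^bsub>R\<^esub> sc d = sc (c + d)"
  by (simp add: cl_scalar_def free_scalar_def clifford_class_add[symmetric] single_add)

lemma sc_0: "sc 0 = \<zero>\<^bsub>R\<^esub>"
  using sc_add[of 0 0] sc_closed[of 0] R.add.l_cancel_one by auto

lemma sc_minus: "\<ominus>\<^bsub>R\<^esub> sc c = sc (- c)"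
  using sc_add[of "- c" c] by (simp add: sc_0 R.minus_equality)

lemma uminus_sc: "x \<in> carrier R \<Longrightarrow> \<ominus>\<^bsub>R\<^esub> x = sc (- 1) \<otimes>\<^bsub>R\<^esub> x"
  using R.l_minus[of "\<one>\<^bsub>R\<^esub>" x] by (simp add: sc_minus[symmetric] sc_1)

lemma vec_sc: "vec v \<otimes>\<^bsub>R\<^esub> sc c = sc c \<otimes>\<^bsub>R\<^esub> vec v"
  by (simp add: cl_scalar_def cl_vec_def free_gen_def free_scalar_def
      clifford_class_mult[symmetric] mult_single)

lemma vec_add: "vec (u + v) = vec u \<oplus>\<^bsub>R\<^esub> vec v" by (rule cl_vec_add)

lemma vec_scale: "vec (s c v) = sc c \<otimes>\<^bsub>R\<^esub> vec v" by (rule cl_vec_scale)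

lemma vec_square: "vec v \<otimes>\<^bsub>R\<^esub> vec v = sc (q v)" by (rule cl_vec_square)

lemma vec_anticommute: "vec u \<otimes>\<^bsub>R\<^esub> vec v \<oplus>\<^bsub>R\<^esub> vec v \<otimes>\<^bsub>R\<^esub> vec u = sc (B u v)"
proof -
  let ?x = "vec u \<otimes>\<^bsub>R\<^esub> vec v \<oplus>\<^bsub>R\<^esub> vec v \<otimes>\<^bsub>R\<^esub> vec u"
  have "sc (q (u + v)) = sc (q u) \<oplus>\<^bsub>R\<^esub> (?x \<oplus>\<^bsub>R\<^esub> sc (q v))"
    by (simp add: vec_square[symmetric] vec_add R.l_distr R.r_distr R.a_ac)
  then have "sc (q u + q v) \<oplus>\<^bsub>R\<^esub> sc (B u v) = sc (q u + q v) \<oplus>\<^bsub>R\<^esub> ?x"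
    by (simp add: q_add sc_add[symmetric] R.a_ac)
  then show ?thesis
    using R.add.l_cancel[of "sc (q u + q v)" "sc (B u v)" ?x] by simp
qed

text \<open>For a unit vector \<open>a\<close> this is the negative of the reflection in the
  hyperplane orthogonal to \<open>a\<close>. With this sign \<open>vec a\<close> moves past
  \<open>vec x\<close> without a twist.\<close>

definition reflect :: "'v \<Rightarrow> 'v \<Rightarrow> 'v" where
  "reflect a x = s (B a x) a - x"

lemma vec_reflect:
  assumes "q a = 1" shows "vec a \<otimes>\<^bsub>R\<^esub> vec x = vec (reflect a x) \<otimes>\<^bsub>R\<^esub> vec a"
proof -
  have 1: "vec (reflect a x) \<oplus>\<^bsub>R\<^esub> vec x = sc (B a x) \<otimes>\<^bsub>R\<^esub> vec a"
    by (simp add: vec_add[symmetric] vec_scale[symmetric] reflect_def)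
  have "vec (reflect a x) \<otimes>\<^bsub>R\<^esub> vec a \<oplus>\<^bsub>R\<^esub> vec x \<otimes>\<^bsub>R\<^esub> vec a
      = (vec (reflect a x) \<oplus>\<^bsub>R\<^esub> vec x) \<otimes>\<^bsub>R\<^esub> vec a"
    by (simp add: R.l_distr)
  also have "\<dots> = vec a \<otimes>\<^bsub>R\<^esub> vec x \<oplus>\<^bsub>R\<^esub> vec x \<otimes>\<^bsub>R\<^esub> vec a"
    using assms by (simp add: 1 R.m_assoc vec_square sc_mult vec_anticommute)
  finally show ?thesis by simp
qed

lemma reflect_linear: "Vector_Spaces.linear s s (reflect a)"
  by (simp add: Vector_Spaces.linear_iff V.vector_space_axioms reflect_def B_simps V.scale_left_distrib
      V.scale_right_diff_distrib)

lemma B_reflect: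
  assumes "q a = 1" shows "B (reflect a x) (reflect a y) = B x y"
proof -
  have "B a a = 2" using assms by (simp add: B_self)
  then show ?thesis by (simp add: reflect_def B_simps B_sym[of x a] B_sym[of y a] algebra_simps)
qed

lemma unit_pair:
  assumes "q u = 1" "q v = 1"
  shows "vec u \<otimes>\<^bsub>R\<^esub> vec v \<in> Units R" "inv\<^bsub>R\<^esub> (vec u \<otimes>\<^bsub>R\<^esub> vec v) = vec v \<otimes>\<^bsub>R\<^esub> vec u"
proof -
  have a: "(vec u \<otimes>\<^bsub>R\<^esub> vec v) \<otimes>\<^bsub>R\<^esub> (vec v \<otimes>\<^bsub>R\<^esub> vec u) = \<one>\<^bsub>R\<^esub>" if "q u = 1" "q v = 1" for u v
  proof -
    have "(vec u \<otimes>\<^bsub>R\<^esub> vec v) \<otimes>\<^bsub>R\<^esub> (vec v \<otimes>\<^bsub>R\<^esub> vec u)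
        = vec u \<otimes>\<^bsub>R\<^esub> (vec v \<otimes>\<^bsub>R\<^esub> vec v) \<otimes>\<^bsub>R\<^esub> vec u"
      by (simp add: R.m_assoc)
    then show ?thesis using that by (simp add: vec_square sc_1)
  qed
  show "vec u \<otimes>\<^bsub>R\<^esub> vec v \<in> Units R"
    unfolding Units_def using a[OF assms] a[OF assms(2,1)] by auto
  show "inv\<^bsub>R\<^esub> (vec u \<otimes>\<^bsub>R\<^esub> vec v) = vec v \<otimes>\<^bsub>R\<^esub> vec u"
    using a[OF assms] a[OF assms(2,1)] by (intro R.inv_char) auto
qed

section \<open>The spin group and its action on vectors\<close>

abbreviation Spin :: "'v set \<Rightarrow> 'v cl set" where "Spin \<equiv> spin_group s q"

lemma Spin_pair: "u \<in> W \<Longrightarrow> v \<in> W \<Longrightarrow> q u = 1 \<Longrightarrow> q v = 1 \<Longrightarrow> vec u \<otimes>\<^bsub>R\<^esub> vec v \<in> Spin W"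
  unfolding spin_group_def by (rule generate.incl) auto

lemma Spin_1: "\<one>\<^bsub>R\<^esub> \<in> Spin W"
  unfolding spin_group_def by (rule generate.one)

lemma Spin_mult: "g \<in> Spin W \<Longrightarrow> h \<in> Spin W \<Longrightarrow> g \<otimes>\<^bsub>R\<^esub> h \<in> Spin W"
  unfolding spin_group_def by (rule generate.eng)

text \<open>The inverse of a generator is the generator with its two factors exchanged, so the rule
  has no case for inverses.\<close>

lemma Spin_induct [consumes 1, case_names one pair mult]:
  assumes "g \<in> Spin W" and "P \<one>\<^bsub>R\<^esub>"
    and "\<And>u v. u \<in> W \<Longrightarrow> v \<in> W \<Longrightarrow> q u = 1 \<Longrightarrow> q v = 1 \<Longrightarrow> P (vec u \<otimes>\<^bsub>R\<^esub> vec v)"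
    and "\<And>g h. g \<in> Spin W \<Longrightarrow> h \<in> Spin W \<Longrightarrow> P g \<Longrightarrow> P h \<Longrightarrow> P (g \<otimes>\<^bsub>R\<^esub> h)"
  shows "P g"
  using assms(1) unfolding spin_group_def
proof (induction rule: generate.induct)
  case (inv h)
  then show ?case using assms(3) unit_pair(2) by auto
next
  case (eng h1 h2)
  then show ?case using assms(4) by (simp add: spin_group_def)
qed (use assms in auto)

lemma Spin_Units: "g \<in> Spin W \<Longrightarrow> g \<in> Units R"
  by (induction rule: Spin_induct) (auto intro: unit_pair)

lemma Spin_closed: "g \<in> Spin W \<Longrightarrow> g \<in> carrier R"
  using Spin_Units R.Units_closed by blast

lemma Spin_inverse: "g \<in> Spin W \<Longrightarrow> \<exists>h\<in>Spin W. h \<otimes>\<^bsub>R\<^esub> g = \<one>\<^bsub>R\<^esub> \<and> g \<otimes>\<^bsub>R\<^esub> h = \<one>\<^bsub>R\<^esub>"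
proof (induction rule: Spin_induct)
  case one
  show ?case using Spin_1 by (intro bexI[of _ "\<one>\<^bsub>R\<^esub>"]) simp_all
next
  case (pair u v)
  then show ?case
    using unit_pair[of u v] Spin_pair[of v W u] R.Units_l_inv[of "vec u \<otimes>\<^bsub>R\<^esub> vec v"]
      R.Units_r_inv[of "vec u \<otimes>\<^bsub>R\<^esub> vec v"] by auto
next
  case (mult g h)
  then obtain g' h' where g': "g' \<in> Spin W" "g' \<otimes>\<^bsub>R\<^esub> g = \<one>\<^bsub>R\<^esub>" "g \<otimes>\<^bsub>R\<^esub> g' = \<one>\<^bsub>R\<^esub>"
    and h': "h' \<in> Spin W" "h' \<otimes>\<^bsub>R\<^esub> h = \<one>\<^bsub>R\<^esub>" "h \<otimes>\<^bsub>R\<^esub> h' = \<one>\<^bsub>R\<^esub>" by blast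
  have c: "g \<in> carrier R" "h \<in> carrier R" "g' \<in> carrier R" "h' \<in> carrier R"
    using mult g' h' Spin_closed by auto
  have "(h' \<otimes>\<^bsub>R\<^esub> g') \<otimes>\<^bsub>R\<^esub> (g \<otimes>\<^bsub>R\<^esub> h) = h' \<otimes>\<^bsub>R\<^esub> (g' \<otimes>\<^bsub>R\<^esub> g) \<otimes>\<^bsub>R\<^esub> h"
    "(g \<otimes>\<^bsub>R\<^esub> h) \<otimes>\<^bsub>R\<^esub> (h' \<otimes>\<^bsub>R\<^esub> g') = g \<otimes>\<^bsub>R\<^esub> (h \<otimes>\<^bsub>R\<^esub> h') \<otimes>\<^bsub>R\<^esub> g'"
    using c by (simp_all add: R.m_assoc)
  then have "(h' \<otimes>\<^bsub>R\<^esub> g') \<otimes>\<^bsub>R\<^esub> (g \<otimes>\<^bsub>R\<^esub> h) = \<one>\<^bsub>R\<^esub>" "(g \<otimes>\<^bsub>R\<^esub> h) \<otimes>\<^bsub>R\<^esub> (h' \<otimes>\<^bsub>R\<^esub> g') = \<one>\<^bsub>R\<^esub>"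
    using c g' h' by simp_all
  then show ?case using Spin_mult[OF h'(1) g'(1)] by blast
qed

lemma Spin_even: "g \<in> Spin W \<Longrightarrow> g \<in> even_clifford s q W"
proof (induction rule: Spin_induct)
  case one then show ?case unfolding even_clifford_def by (rule generate_ring.one)
next
  case (pair u v) then show ?case unfolding even_clifford_def by (intro generate_ring.incl) auto
next
  case (mult g h) then show ?case unfolding even_clifford_def by (intro generate_ring.eng_mult)
qed

text \<open>\<open>T\<close> is the action of \<open>g\<close> on vectors. Stated without an
  inverse, the relation composes directly and also covers odd elements such as
  \<open>vec a\<close>.\<close>

definition implements :: "'v cl \<Rightarrow> ('v \<Rightarrow> 'v) \<Rightarrow> bool" where
  "implements g T \<longleftrightarrow> (\<forall>v. g \<otimes>\<^bsub>R\<^esub> vec v = vec (T v) \<otimes>\<^bsub>R\<^esub> g)"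

lemma implements_mult:
  assumes "implements g T" "implements h S" "g \<in> carrier R" "h \<in> carrier R"
  shows "implements (g \<otimes>\<^bsub>R\<^esub> h) (T \<circ> S)"
  unfolding implements_def
proof
  fix v
  have "g \<otimes>\<^bsub>R\<^esub> h \<otimes>\<^bsub>R\<^esub> vec v = g \<otimes>\<^bsub>R\<^esub> (h \<otimes>\<^bsub>R\<^esub> vec v)"
    using assms by (simp add: R.m_assoc)
  also have "\<dots> = (g \<otimes>\<^bsub>R\<^esub> vec (S v)) \<otimes>\<^bsub>R\<^esub> h"
    unfolding assms(2)[unfolded implements_def, rule_format] using assms by (simp add: R.m_assoc)
  also have "\<dots> = vec (T (S v)) \<otimes>\<^bsub>R\<^esub> (g \<otimes>\<^bsub>R\<^esub> h)"
    unfolding assms(1)[unfolded implements_def, rule_format] using assms by (simp add: R.m_assoc)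
  finally show "g \<otimes>\<^bsub>R\<^esub> h \<otimes>\<^bsub>R\<^esub> vec v = vec ((T \<circ> S) v) \<otimes>\<^bsub>R\<^esub> (g \<otimes>\<^bsub>R\<^esub> h)" by simp
qed

lemma implements_vec: "q a = 1 \<Longrightarrow> implements (vec a) (reflect a)"
  by (simp add: implements_def vec_reflect)

definition isometry :: "('v \<Rightarrow> 'v) \<Rightarrow> bool" where
  "isometry T \<longleftrightarrow> Vector_Spaces.linear s s T \<and> (\<forall>u v. B (T u) (T v) = B u v)"

lemma isometry_q: "isometry T \<Longrightarrow> q (T v) = q v"
  using B_self[of "T v"] B_self[of v] by (simp add: isometry_def)

lemma isometry_linear: "isometry T \<Longrightarrow> Vector_Spaces.linear s s T"
  by (simp add: isometry_def)

lemma isometry_B: "isometry T \<Longrightarrow> B (T u) (T v) = B u v"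
  by (simp add: isometry_def)

lemma isometry_reflect: "q a = 1 \<Longrightarrow> isometry (reflect a)"
  by (simp add: isometry_def reflect_linear B_reflect)

lemma isometry_comp: "isometry T \<Longrightarrow> isometry S \<Longrightarrow> isometry (T \<circ> S)"
  by (simp add: isometry_def Vector_Spaces.linear_iff)

lemma Spin_implements:
  "g \<in> Spin W \<Longrightarrow> \<exists>T. isometry T \<and> implements g T"
proof (induction rule: Spin_induct)
  case one
  have "isometry (\<lambda>v. v)"
    by (simp add: isometry_def Vector_Spaces.linear_iff V.vector_space_axioms)
  moreover have "implements \<one>\<^bsub>R\<^esub> (\<lambda>v. v)" by (simp add: implements_def)
  ultimately show ?case by blast
next
  case (pair u v)
  then show ?case
    using isometry_comp[of "reflect u" "reflect v"] implements_mult[of "vec u" _ "vec v"]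
      isometry_reflect implements_vec by blast
next
  case (mult g h)
  then show ?case using isometry_comp implements_mult Spin_closed by meson
qed

end

section \<open>The action of products of two vectors on a module\<close>

locale even_module = quadratic_space s q
  for s :: "complex \<Rightarrow> 'v::ab_group_add \<Rightarrow> 'v" and q +
  fixes W :: "'v set" and t :: "complex \<Rightarrow> 's::ab_group_add \<Rightarrow> 's" and \<rho> :: "'v cl \<Rightarrow> 's \<Rightarrow> 's"
  assumes W: "V.subspace W" and ecm: "even_clifford_module s q W t \<rho>"
begin

sublocale M: vector_space t
  using ecm by (simp add: even_clifford_module_def)

abbreviation Cl0 :: "'v cl set" where "Cl0 \<equiv> even_clifford s q W"

lemma Cl0_subring: "subring Cl0 R"
  unfolding even_clifford_def by (rule R.generate_ring_is_subring) auto

lemma Cl0_mult: "x \<in> Cl0 \<Longrightarrow> y \<in> Cl0 \<Longrightarrow> x \<otimes>\<^bsub>R\<^esub> y \<in> Cl0"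
  using Cl0_subring by (rule subringE(6))

lemma Cl0_sc: "sc c \<in> Cl0"
  unfolding even_clifford_def by (rule generate_ring.incl) auto

lemma Cl0_pair: "u \<in> W \<Longrightarrow> v \<in> W \<Longrightarrow> vec u \<otimes>\<^bsub>R\<^esub> vec v \<in> Cl0"
  unfolding even_clifford_def by (rule generate_ring.incl) auto

lemma rho_add: "x \<in> Cl0 \<Longrightarrow> y \<in> Cl0 \<Longrightarrow> \<rho> (x \<oplus>\<^bsub>R\<^esub> y) z = \<rho> x z + \<rho> y z"
  and rho_mult: "x \<in> Cl0 \<Longrightarrow> y \<in> Cl0 \<Longrightarrow> \<rho> (x \<otimes>\<^bsub>R\<^esub> y) z = \<rho> x (\<rho> y z)"
  and rho_sc: "\<rho> (sc c) z = t c z"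
  and rho_linear: "x \<in> Cl0 \<Longrightarrow> Vector_Spaces.linear t t (\<rho> x)"
  using ecm by (simp_all add: even_clifford_module_def)

lemma rho_1: "\<rho> \<one>\<^bsub>R\<^esub> z = z"
  using rho_sc[of 1 z] by (simp add: sc_1)

definition E :: "'v \<Rightarrow> 'v \<Rightarrow> 's \<Rightarrow> 's" where
  "E u v = \<rho> (vec u \<otimes>\<^bsub>R\<^esub> vec v)"

lemma E_linear: "u \<in> W \<Longrightarrow> v \<in> W \<Longrightarrow> Vector_Spaces.linear t t (E u v)"
  unfolding E_def by (rule rho_linear[OF Cl0_pair])

lemma E_comp:
  assumes "u \<in> W" "v \<in> W" "w \<in> W"
  shows "E u v (E v w z) = t (q v) (E u w z)"
proof -
  have "(vec u \<otimes>\<^bsub>R\<^esub> vec v) \<otimes>\<^bsub>R\<^esub> (vec v \<otimes>\<^bsub>R\<^esub> vec w) = vec u \<otimes>\<^bsub>R\<^esub> (vec v \<otimes>\<^bsub>R\<^esub> vec v) \<otimes>\<^bsub>R\<^esub> vec w"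
    by (simp add: R.m_assoc)
  also have "\<dots> = sc (q v) \<otimes>\<^bsub>R\<^esub> (vec u \<otimes>\<^bsub>R\<^esub> vec w)"
    by (simp add: vec_square vec_sc R.m_assoc)
  finally show ?thesis
    using assms by (simp add: E_def rho_mult[symmetric] Cl0_pair Cl0_sc rho_sc[symmetric])
qed

lemma E_sym: "u \<in> W \<Longrightarrow> v \<in> W \<Longrightarrow> E u v z + E v u z = t (B u v) z"
  by (simp add: E_def rho_add[symmetric] Cl0_pair vec_anticommute rho_sc)

lemma E_self: "u \<in> W \<Longrightarrow> E u u z = t (q u) z"
  by (simp add: E_def vec_square rho_sc)

lemma E_addl: "u \<in> W \<Longrightarrow> u' \<in> W \<Longrightarrow> v \<in> W \<Longrightarrow> E (u + u') v z = E u v z + E u' v z"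
  and E_addr: "u \<in> W \<Longrightarrow> u' \<in> W \<Longrightarrow> v \<in> W \<Longrightarrow> E v (u + u') z = E v u z + E v u' z"
  by (simp_all add: E_def vec_add R.l_distr R.r_distr rho_add Cl0_pair)

lemma E_scalel: "u \<in> W \<Longrightarrow> v \<in> W \<Longrightarrow> E (s c u) v z = t c (E u v z)"
  by (simp add: E_def vec_scale R.m_assoc rho_mult Cl0_pair Cl0_sc rho_sc)

lemma E_scaler: "u \<in> W \<Longrightarrow> v \<in> W \<Longrightarrow> E v (s c u) z = t c (E v u z)"
proof -
  assume "u \<in> W" "v \<in> W"
  moreover have "vec v \<otimes>\<^bsub>R\<^esub> vec (s c u) = sc c \<otimes>\<^bsub>R\<^esub> (vec v \<otimes>\<^bsub>R\<^esub> vec u)"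
    using R.m_assoc[of "vec v" "sc c" "vec u"] by (simp add: vec_scale vec_sc R.m_assoc)
  ultimately show ?thesis by (simp add: E_def rho_mult Cl0_pair Cl0_sc rho_sc)
qed

lemma E_0l: "v \<in> W \<Longrightarrow> E 0 v z = 0" and E_0r: "v \<in> W \<Longrightarrow> E v 0 z = 0"
  using E_scalel[of 0 v 0 z] E_scaler[of 0 v 0 z] W V.subspace_0 by simp_all

lemma E_suml: "finite A \<Longrightarrow> (\<And>a. a \<in> A \<Longrightarrow> g a \<in> W) \<Longrightarrow> v \<in> W \<Longrightarrow> E (sum g A) v z = (\<Sum>a\<in>A. E (g a) v z)"
  by (induction A rule: finite_induct) (simp_all add: E_0l E_addl V.subspace_sum[OF W])

lemma E_sumr: "finite A \<Longrightarrow> (\<And>a. a \<in> A \<Longrightarrow> g a \<in> W) \<Longrightarrow> v \<in> W \<Longrightarrow> E v (sum g A) z = (\<Sum>a\<in>A. E v (g a) z)"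
  by (induction A rule: finite_induct) (simp_all add: E_0r E_addr V.subspace_sum[OF W])

lemma Cl0_invariant:
  assumes U: "M.subspace U" and E: "\<And>u v z. u \<in> W \<Longrightarrow> v \<in> W \<Longrightarrow> z \<in> U \<Longrightarrow> E u v z \<in> U"
  shows "x \<in> Cl0 \<Longrightarrow> z \<in> U \<Longrightarrow> \<rho> x z \<in> U"
proof -
  have "x \<in> Cl0 \<Longrightarrow> \<forall>z\<in>U. \<rho> x z \<in> U"
    unfolding even_clifford_def
  proof (induction rule: generate_ring.induct)
    case one
    then show ?case by (simp add: rho_1)
  next
    case (incl h)
    then show ?case using E U by (auto simp: rho_sc E_def M.subspace_scale)
  next
    case (a_inv h)
    then have h: "h \<in> Cl0" by (simp add: even_clifford_def)
    then have "h \<in> carrier R" using subringE(1)[OF Cl0_subring] by blast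
    then show ?case
      using a_inv h U by (simp add: uminus_sc rho_mult Cl0_sc rho_sc M.subspace_scale M.subspace_neg)
  next
    case (eng_add h1 h2)
    then show ?case using U by (simp add: rho_add even_clifford_def M.subspace_add)
  next
    case (eng_mult h1 h2)
    then show ?case by (simp add: rho_mult even_clifford_def)
  qed
  then show "x \<in> Cl0 \<Longrightarrow> z \<in> U \<Longrightarrow> \<rho> x z \<in> U" by blast
qed

lemma Spin_rho_mult: "g \<in> Spin W \<Longrightarrow> h \<in> Spin W \<Longrightarrow> \<rho> (g \<otimes>\<^bsub>R\<^esub> h) z = \<rho> g (\<rho> h z)"
  by (simp add: rho_mult Spin_even)

lemma Spin_rho_linear: "g \<in> Spin W \<Longrightarrow> Vector_Spaces.linear t t (\<rho> g)"
  by (simp add: rho_linear Spin_even)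

lemma Spin_rho_inj: "g \<in> Spin W \<Longrightarrow> \<rho> g x = \<rho> g y \<Longrightarrow> x = y"
  using Spin_inverse[of g W] by (metis Spin_rho_mult rho_1)

lemma rho_E:
  assumes "g \<in> Spin W" "implements g T" "u \<in> W" "v \<in> W" "T u \<in> W" "T v \<in> W"
  shows "\<rho> g (E u v z) = E (T u) (T v) (\<rho> g z)"
proof -
  have g: "g \<in> carrier R" using assms Spin_closed by blast
  have "g \<otimes>\<^bsub>R\<^esub> (vec u \<otimes>\<^bsub>R\<^esub> vec v) = (vec (T u) \<otimes>\<^bsub>R\<^esub> vec (T v)) \<otimes>\<^bsub>R\<^esub> g"
    using assms g by (metis R.m_assoc implements_def vec_closed)
  then show ?thesis
    using assms by (metis E_def Cl0_pair Spin_even rho_mult)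
qed

end

locale half_spin_module = even_module s q UNIV t \<rho>
  for s :: "complex \<Rightarrow> 'v::ab_group_add \<Rightarrow> 'v" and q and t :: "complex \<Rightarrow> 's::ab_group_add \<Rightarrow> 's" and \<rho> +
  assumes nd: "nondegenerate q" and nz: "\<exists>z::'s. z \<noteq> 0"
begin

text \<open>The Clifford algebra does not collapse: it acts on a module with a nonzero vector, and
  scalars are told apart by their effect on that vector.\<close>

lemma sc_inj: "sc c = sc d \<Longrightarrow> c = d"
proof -
  assume "sc c = sc d"
  moreover obtain z :: 's where "z \<noteq> 0" using nz by blast
  ultimately show "c = d" by (metis M.scale_right_imp_eq rho_sc)
qed

lemma nondegenerateD: "(\<And>w. B u w = 0) \<Longrightarrow> u = 0"
  using nd by (simp add: nondegenerate_def)

lemma vec_inj: "vec u = vec v \<Longrightarrow> u = v"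
proof -
  assume uv: "vec u = vec v"
  have "B u w = B v w" for w
    using vec_anticommute[of u w] vec_anticommute[of v w] uv by (intro sc_inj) simp
  then have "u - v = 0" by (intro nondegenerateD) (simp add: B_diffl)
  then show "u = v" by simp
qed

lemma spin_image_eq:
  assumes g: "g \<in> Spin UNIV" and T: "implements g T"
  shows "spin_image s q g A = T ` A"
proof -
  have "g \<otimes>\<^bsub>R\<^esub> vec v \<otimes>\<^bsub>R\<^esub> inv\<^bsub>R\<^esub> g = vec (T v)" for v
  proof -
    have "g \<in> Units R" using g Spin_Units by blast
    then have "vec (T v) \<otimes>\<^bsub>R\<^esub> g \<otimes>\<^bsub>R\<^esub> inv\<^bsub>R\<^esub> g = vec (T v)"
      using R.m_assoc[of "vec (T v)" g "inv\<^bsub>R\<^esub> g"] by (simp add: R.Units_closed R.Units_r_inv)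
    then show ?thesis using T by (simp add: implements_def)
  qed
  then have "spin_image s q g A = {w. \<exists>v\<in>A. vec w = vec (T v)}" by (simp add: spin_image_def)
  also have "\<dots> = {w. \<exists>v\<in>A. w = T v}" using vec_inj by metis
  finally show ?thesis by blast
qed

end

section \<open>Orthonormal families\<close>

context quadratic_space
begin

text \<open>The polar form of a vector with itself is \<open>2 * q\<close>, so the diagonal value 2
  makes these unit vectors for \<open>q\<close>.\<close>

definition orthonormal :: "(nat \<Rightarrow> 'v) \<Rightarrow> nat \<Rightarrow> bool" where
  "orthonormal e n \<longleftrightarrow> (\<forall>i<n. \<forall>j<n. B (e i) (e j) = (if i = j then 2 else 0))"

lemma orthonormalD: "orthonormal e n \<Longrightarrow> i < n \<Longrightarrow> j < n \<Longrightarrow> B (e i) (e j) = (if i = j then 2 else 0)"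
  by (simp add: orthonormal_def)

lemma orthonormal_q: "orthonormal e n \<Longrightarrow> i < n \<Longrightarrow> q (e i) = 1"
  using B_self[of "e i"] by (simp add: orthonormal_def)

lemma orthonormal_expand:
  assumes e: "orthonormal e n" and w: "w \<in> V.span (e ` {..<n})"
  shows "w = (\<Sum>i<n. s (B (e i) w / 2) (e i))"
  using w
proof (induction rule: V.span_induct_alt)
  case base
  then show ?case by simp
next
  case (step c x y)
  then obtain j where j: "j < n" "x = e j" by auto
  have "(\<Sum>i<n. s (B (e i) (s c x + y) / 2) (e i))
      = (\<Sum>i<n. s (if i = j then c else 0) (e i)) + (\<Sum>i<n. s (B (e i) y / 2) (e i))"
    unfolding sum.distrib[symmetric]
    by (rule sum.cong) (use j e in \<open>auto simp: B_simps orthonormalD add_divide_distrib V.scale_left_distrib\<close>)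
  also have "(\<Sum>i<n. s (if i = j then c else 0) (e i)) = (\<Sum>i<n. if i = j then s c (e i) else 0)"
    by (rule sum.cong) auto
  also have "\<dots> = s c x" using j by simp
  finally show ?case using step by simp
qed

lemma orthonormal_indep:
  assumes e: "orthonormal e n" and z: "(\<Sum>i<n. s (c i) (e i)) = 0" and j: "j < n"
  shows "c j = 0"
proof -
  have "0 = B (e j) (\<Sum>i<n. s (c i) (e i))" by (simp add: z)
  also have "\<dots> = (\<Sum>i<n. if i = j then 2 * c i else 0)"
    by (simp only: B_simps) (rule sum.cong, use e j in \<open>auto simp: orthonormalD\<close>)
  also have "\<dots> = 2 * c j" using j by simp
  finally show ?thesis by simp
qed

lemma orthonormal_inj: "orthonormal e n \<Longrightarrow> inj_on e {..<n}"
  unfolding inj_on_def by (metis lessThan_iff orthonormalD zero_neq_numeral)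

lemma orthonormal_independent:
  assumes e: "orthonormal e n" shows "V.independent (e ` {..<n})"
proof (rule V.independent_if_scalars_zero)
  fix f x assume "(\<Sum>x\<in>e ` {..<n}. s (f x) x) = 0" "x \<in> e ` {..<n}"
  then show "f x = 0"
    using orthonormal_indep[OF e, of "f \<circ> e"] orthonormal_inj[OF e] by (auto simp: sum.reindex)
qed simp

lemma orthonormal_dim: "orthonormal e n \<Longrightarrow> V.dim (V.span (e ` {..<n})) = n"
  using V.dim_span_eq_card_independent[OF orthonormal_independent]
  by (simp add: card_image orthonormal_inj)

lemma isometry_orthonormal: "isometry T \<Longrightarrow> orthonormal e n \<Longrightarrow> orthonormal (T \<circ> e) n"
  by (simp add: orthonormal_def isometry_B)

end

section \<open>From Clifford multiplication to octonionic operators\<close>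

context even_module
begin

lemma E_anti: "u \<in> W \<Longrightarrow> v \<in> W \<Longrightarrow> B u v = 0 \<Longrightarrow> E u v z = - E v u z"
  using E_sym[of u v z] by (simp add: eq_neg_iff_add_eq_0)

lemma E_plus: "u \<in> W \<Longrightarrow> v \<in> W \<Longrightarrow> E u v (x + y) = E u v x + E u v y"
  and E_scale: "u \<in> W \<Longrightarrow> v \<in> W \<Longrightarrow> E u v (t c x) = t c (E u v x)"
  using E_linear[of u v] by (simp_all add: Vector_Spaces.linear_iff)

lemma E_minus: "u \<in> W \<Longrightarrow> v \<in> W \<Longrightarrow> E u v (- x) = - E u v x"
  using E_scale[of u v "-1" x] by simp

lemma E_zero: "u \<in> W \<Longrightarrow> v \<in> W \<Longrightarrow> E u v 0 = 0"
  using E_scale[of u v 0 0] by simp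

lemma E_swap:
  assumes "u \<in> W" "v \<in> W" "w \<in> W" "x \<in> W" and 0: "B v w = 0"
  shows "E u v (E w x z) = - E u w (E v x z)"
proof -
  have a: "vec u \<otimes>\<^bsub>R\<^esub> vec v \<otimes>\<^bsub>R\<^esub> (vec w \<otimes>\<^bsub>R\<^esub> vec x) \<oplus>\<^bsub>R\<^esub> vec u \<otimes>\<^bsub>R\<^esub> vec w \<otimes>\<^bsub>R\<^esub> (vec v \<otimes>\<^bsub>R\<^esub> vec x)
    = vec u \<otimes>\<^bsub>R\<^esub> (vec v \<otimes>\<^bsub>R\<^esub> vec w \<oplus>\<^bsub>R\<^esub> vec w \<otimes>\<^bsub>R\<^esub> vec v) \<otimes>\<^bsub>R\<^esub> vec x"
    by (simp add: R.l_distr R.r_distr R.m_assoc)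
  also have "\<dots> = sc 0" by (simp add: vec_anticommute 0 sc_0)
  finally have "\<rho> (vec u \<otimes>\<^bsub>R\<^esub> vec v \<otimes>\<^bsub>R\<^esub> (vec w \<otimes>\<^bsub>R\<^esub> vec x)
      \<oplus>\<^bsub>R\<^esub> vec u \<otimes>\<^bsub>R\<^esub> vec w \<otimes>\<^bsub>R\<^esub> (vec v \<otimes>\<^bsub>R\<^esub> vec x)) z = 0"
    by (simp add: rho_sc)
  then show ?thesis
    using assms by (simp add: rho_add rho_mult Cl0_mult Cl0_pair E_def eq_neg_iff_add_eq_0)
qed

lemma E_commute:
  assumes "u \<in> W" "v \<in> W" "w \<in> W" "x \<in> W" and "B u w = 0" "B u x = 0" "B v w = 0" "B v x = 0"
  shows "E u v (E w x z) = E w x (E u v z)"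
proof -
  have "E u v (E w x z) = - E u w (E v x z)" by (rule E_swap) fact+
  also have "\<dots> = E w u (E v x z)" using assms by (simp add: E_anti[of u w])
  also have "\<dots> = - E w u (E x v z)" using assms by (simp add: E_anti[of v x] E_minus)
  also have "\<dots> = E w x (E u v z)" using assms E_swap[of w u x v] by simp
  finally show ?thesis .
qed

text \<open>Up to sign this is the product of \<open>e i\<close> with the volume element of \<open>e 0, \<dots>, e 6\<close>, the two factors
  \<open>e 0\<close> being cancelled. The transposition of \<open>e 1\<close> and \<open>e 2\<close> makes the product of the seven
  operators \<open>-1\<close>, as the orientation of the lines \<open>{k, k + 1, k + 3}\<close> requires.\<close>

definition octonion_op :: "(nat \<Rightarrow> 'v) \<Rightarrow> nat \<Rightarrow> 's \<Rightarrow> 's" where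
  "octonion_op e i z = E (e i) (e 0) (E (e 2) (e 1) (E (e 3) (e 4) (E (e 5) (e 6) z)))"

text \<open>The volume element of the seven vectors commutes with each of them and has square -1, so
  multiplying both factors of \<open>e i e j\<close> by it only changes the sign.\<close>

lemma octonion_op_facts:
  assumes e: "orthonormal e 7" and eW: "\<And>i. i < 7 \<Longrightarrow> e i \<in> W"
  shows octonion_op_mult: "\<And>i j z. i < 7 \<Longrightarrow> j < 7 \<Longrightarrow>
      octonion_op e i (octonion_op e j z) = - E (e i) (e j) z"
    and octonion_operators_octonion_op: "octonion_operators t (octonion_op e)"
proof -
  \<comment> \<open>The operators \<open>g 1\<close> to \<open>g 6\<close> anticommute and have
    square -1, \<open>g 0\<close> is the identity, and every \<open>E (e i) (e j)\<close> is a
    monomial in them up to sign. The claims become identities between sorted monomials.\<close>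
  define g where "g i = E (e i) (e 0)" for i
  have gl: "g i (- z) = - g i z" if "i < 7" for i z
    using that eW by (simp add: g_def E_minus)
  have E0: "E (e 0) (e 0) z = z" for z using E_self[of "e 0"] eW orthonormal_q[OF e] by simp
  have Eg: "E (e i) (e j) z = - g i (g j z)" if "i < 7" "j < 7" "j \<noteq> 0" for i j z
  proof -
    have "E (e i) (e j) z = E (e i) (e 0) (E (e 0) (e j) z)"
      using E_comp[of "e i" "e 0" "e j" z] eW that orthonormal_q[OF e, of 0] by simp
    also have "E (e 0) (e j) z = - g j z"
      using E_anti[of "e 0" "e j" z] that eW orthonormalD[OF e, of 0 j] by (simp add: g_def)
    finally show ?thesis using that gl by (simp add: g_def[symmetric])
  qed
  have sq: "g i (g i z) = - z" if "i < 7" "i \<noteq> 0" for i z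
    using Eg[of i i z] E_self[of "e i" z] that eW orthonormal_q[OF e, of i] by (metis M.scale_one minus_minus)
  have an: "g i (g j z) = - g j (g i z)" if "i < 7" "j < 7" "i \<noteq> j" "i \<noteq> 0" "j \<noteq> 0" for i j z
    using Eg[of i j z] Eg[of j i z] E_anti[of "e i" "e j" z] that eW orthonormalD[OF e, of i j]
    by (metis minus_minus zero_neq_numeral M.scale_zero_left)
  note srt = an[of 2 1, simplified] an[of 3 1, simplified] an[of 4 1, simplified] an[of 5 1, simplified]
    an[of 6 1, simplified] an[of 3 2, simplified] an[of 4 2, simplified] an[of 5 2, simplified]
    an[of 6 2, simplified] an[of 4 3, simplified] an[of 5 3, simplified] an[of 6 3, simplified]
    an[of 5 4, simplified] an[of 6 4, simplified] an[of 6 5, simplified]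
  have op0: "octonion_op e 0 z = g 1 (g 2 (g 3 (g 4 (g 5 (g 6 z)))))" for z
    by (simp add: octonion_op_def Eg gl srt E0)
  have op: "octonion_op e i z = g i (g 1 (g 2 (g 3 (g 4 (g 5 (g 6 z))))))" if "i < 7" for i z
    using that by (simp add: octonion_op_def Eg gl srt) (simp add: g_def)
  have g0: "g 0 z = z" for z by (simp add: g_def E0)
  have E00: "E (e i) (e 0) z = g i z" for i z by (simp add: g_def)
  have "\<forall>i<7. \<forall>j<7. octonion_op e i (octonion_op e j z) = - E (e i) (e j) z" for z
    unfolding all_less_7 by (simp add: op0 op Eg E00 g0 gl srt sq)
  then show mult: "octonion_op e i (octonion_op e j z) = - E (e i) (e j) z" if "i < 7" "j < 7" for i j z
    using that by blast
  show "octonion_operators t (octonion_op e)"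
  proof (intro octonion_operators.intro octonion_operators_axioms.intro M.vector_space_axioms)
    fix i :: nat assume i: "i < 7"
    show "Vector_Spaces.linear t t (octonion_op e i)"
      using i eW by (simp add: Vector_Spaces.linear_iff M.vector_space_axioms octonion_op_def E_plus E_scale)
    fix x
    show "octonion_op e i (octonion_op e i x) = - x"
      using mult[OF i i] i eW E_self[of "e i" x] orthonormal_q[OF e] by simp
    fix j :: nat assume j: "j < 7" "i \<noteq> j"
    show "octonion_op e i (octonion_op e j x) = - octonion_op e j (octonion_op e i x)"
      using i j eW E_anti[of "e i" "e j" x] orthonormalD[OF e, of i j] by (simp add: mult)
  next
    fix x
    show "octonion_op e 0 (octonion_op e 1 (octonion_op e 2 (octonion_op e 3
        (octonion_op e 4 (octonion_op e 5 (octonion_op e 6 x)))))) = - x"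
      by (simp add: op0 op gl srt sq)
  qed
qed

lemma octonion_op_commute:
  assumes e: "\<And>i. i < 7 \<Longrightarrow> e i \<in> W" and e': "\<And>i. i < 7 \<Longrightarrow> e' i \<in> W"
    and o: "\<And>i j. i < 7 \<Longrightarrow> j < 7 \<Longrightarrow> B (e i) (e' j) = 0" and ij: "i < 7" "j < 7"
  shows "octonion_op e i (octonion_op e' j z) = octonion_op e' j (octonion_op e i z)"
proof -
  have c: "E (e a) (e b) (E (e' c) (e' d) z) = E (e' c) (e' d) (E (e a) (e b) z)"
    if "a < 7" "b < 7" "c < 7" "d < 7" for a b c d z
    using that e e' o by (intro E_commute) auto
  show ?thesis
    using ij unfolding octonion_op_def by (simp add: c)
qed

lemma orthonormal_invariant:
  assumes U: "M.subspace U" and Wd: "W = V.span (d ` {..<n})"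
    and d: "\<And>i j z. i < n \<Longrightarrow> j < n \<Longrightarrow> z \<in> U \<Longrightarrow> E (d i) (d j) z \<in> U"
    and x: "x \<in> Cl0" "z \<in> U"
  shows "\<rho> x z \<in> U"
proof (rule Cl0_invariant[OF U _ x])
  fix u v z assume u: "u \<in> W" and v: "v \<in> W" and z: "z \<in> U"
  have dW: "i < n \<Longrightarrow> d i \<in> W" for i unfolding Wd by (rule V.span_base) simp
  have 1: "E u (d j) z \<in> U" if j: "j < n" for j
  proof -
    \<comment> \<open>Membership in \<open>W\<close> is carried through the induction because
      additivity of \<open>E\<close> is available only on \<open>W\<close>.\<close>
    have "u \<in> W \<and> E u (d j) z \<in> U"
      using u unfolding Wd
    proof (induction rule: V.span_induct_alt)
      case base
      show ?case using U j V.subspace_0[OF W] by (simp add: E_0l dW M.subspace_0 flip: Wd)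
    next
      case (step c x y)
      have "x \<in> W" "s c x \<in> W" using step dW W V.subspace_scale by auto
      then show ?case using step U j d[OF _ j z] V.subspace_add[OF W]
        by (auto simp: E_addl E_scalel dW simp flip: Wd intro!: M.subspace_add M.subspace_scale)
    qed
    then show ?thesis by blast
  qed
  have "v \<in> W \<and> E u v z \<in> U"
    using v unfolding Wd
  proof (induction rule: V.span_induct_alt)
    case base
    show ?case using U u V.subspace_0[OF W] by (simp add: E_0r M.subspace_0 flip: Wd)
  next
    case (step c x y)
    have "x \<in> W" "s c x \<in> W" using step dW W V.subspace_scale by auto
    then show ?case using step U u 1 V.subspace_add[OF W]
      by (auto simp: E_addr E_scaler simp flip: Wd intro!: M.subspace_add M.subspace_scale)
  qed
  then show "E u v z \<in> U" by blast
qed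

end

locale spin_module = even_module s q W t \<rho>
  for s :: "complex \<Rightarrow> 'v::ab_group_add \<Rightarrow> 'v" and q and W
    and t :: "complex \<Rightarrow> 's::ab_group_add \<Rightarrow> 's" and \<rho> +
  assumes simple: "\<And>U. M.subspace U \<Longrightarrow> (\<forall>x\<in>Cl0. \<rho> x ` U \<subseteq> U) \<Longrightarrow> U = {0} \<or> U = UNIV"
    and nontrivial: "\<exists>z::'s. z \<noteq> 0"
begin

lemma simple_span:
  assumes "M.subspace U" "W = V.span (d ` {..<n})"
    "\<And>i j z. i < n \<Longrightarrow> j < n \<Longrightarrow> z \<in> U \<Longrightarrow> E (d i) (d j) z \<in> U" "x \<in> U" "x \<noteq> 0"
  shows "U = UNIV"
  using simple[OF assms(1)] orthonormal_invariant[OF assms(1-3)] assms(4,5) by blast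

end

lemma spin_moduleI:
  assumes "vector_space s" "quadratic_form s q" "Modules.module.subspace s W" "spin_representation s q W t \<rho>"
  shows "spin_module s q W t \<rho>"
proof -
  interpret quadratic_space s q using assms(1,2) by (simp add: quadratic_space_def quadratic_space_axioms_def)
  interpret even_module s q W t \<rho>
    using assms(3,4) by unfold_locales (simp_all add: spin_representation_def)
  show ?thesis
    using assms(4) by unfold_locales (auto simp: spin_representation_def)
qed

section \<open>Submodules generated by spaces of \<open>g2_spinor\<close>s\<close>

context octonion_operators
begin

text \<open>For a space \<open>K\<close> of \<open>g2_spinor\<close>s this models octonions tensor
  \<open>K\<close>; the multiplication table makes it stable under every \<open>f j\<close>.\<close>

definition octonion_span :: "'s set \<Rightarrow> 's set" where
  "octonion_span K = {\<Sum>a<8. F a (y a) | y. \<forall>a<8. y a \<in> K}"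

lemma octonion_spanI: "(\<And>a. a < 8 \<Longrightarrow> y a \<in> K) \<Longrightarrow> (\<Sum>a<8. F a (y a)) \<in> octonion_span K"
  unfolding octonion_span_def by blast

lemma octonion_span_subspace:
  assumes K: "subspace K" shows "subspace (octonion_span K)"
proof (rule subspaceI)
  have "(\<Sum>a<8. F a 0) = 0" by (rule sum.neutral) (auto simp: F_def f_0)
  then show "0 \<in> octonion_span K" using octonion_spanI[of "\<lambda>_. 0" K] subspace_0[OF K] by simp
next
  fix x y assume "x \<in> octonion_span K" "y \<in> octonion_span K"
  then obtain x' y' where "\<forall>a<8. x' a \<in> K" "\<forall>a<8. y' a \<in> K"
    "x = (\<Sum>a<8. F a (x' a))" "y = (\<Sum>a<8. F a (y' a))" unfolding octonion_span_def by blast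
  then show "x + y \<in> octonion_span K"
    using octonion_spanI[of "\<lambda>a. x' a + y' a" K] subspace_add[OF K] by (simp add: F_add sum.distrib)
next
  fix c x assume "x \<in> octonion_span K"
  then obtain x' where "\<forall>a<8. x' a \<in> K" "x = (\<Sum>a<8. F a (x' a))" unfolding octonion_span_def by blast
  then show "t c x \<in> octonion_span K"
    using octonion_spanI[of "\<lambda>a. t c (x' a)" K] subspace_scale[OF K] by (simp add: F_scale scale_sum_right)
qed

lemma octonion_span_superset:
  assumes K: "subspace K" and x: "x \<in> K" shows "x \<in> octonion_span K"
proof -
  have "(\<Sum>a<8. F a (if a = 0 then x else 0)) = x"
    by (simp add: sum_less_8 F_def f_0)
  then show ?thesis using octonion_spanI[of "\<lambda>a. if a = 0 then x else 0" K] x subspace_0[OF K] by simp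
qed

lemma octonion_span_f:
  assumes K: "subspace K" "\<And>y. y \<in> K \<Longrightarrow> g2_spinor y" and x: "x \<in> octonion_span K" and j: "j < 7"
  shows "f j x \<in> octonion_span K"
proof -
  obtain y where y: "\<And>a. a < 8 \<Longrightarrow> y a \<in> K" "x = (\<Sum>a<8. F a (y a))"
    using x unfolding octonion_span_def by blast
  have "f j x = (\<Sum>a<8. t (oct_sign j a) (F (oct_index j a) (y a)))"
    using y j K(2) by (simp add: f_sum f_F)
  also have "\<dots> = (\<Sum>a<8. t (oct_sign j (oct_index j a)) (F a (y (oct_index j a))))"
    by (rule sum.reindex_bij_witness[of _ "oct_index j" "oct_index j"])
       (use j in \<open>auto simp: oct_index_involution oct_index_less\<close>)
  also have "\<dots> = (\<Sum>a<8. F a (t (oct_sign j (oct_index j a)) (y (oct_index j a))))"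
    by (simp add: F_scale)
  finally show ?thesis
    using octonion_spanI[of "\<lambda>a. t (oct_sign j (oct_index j a)) (y (oct_index j a))" K]
      subspace_scale[OF K(1)] y j by (simp add: oct_index_less)
qed

text \<open>Meant for the operators of a second, orthogonal set of seven vectors, which commute with
  all \<open>f i\<close>.\<close>

lemma octonion_span_commuting:
  assumes h: "\<And>y. y \<in> K \<Longrightarrow> h y \<in> K" and l: "Vector_Spaces.linear t t h"
    and c: "\<And>i y. i < 7 \<Longrightarrow> h (f i y) = f i (h y)" and x: "x \<in> octonion_span K"
  shows "h x \<in> octonion_span K"
proof -
  obtain y where y: "\<And>a. a < 8 \<Longrightarrow> y a \<in> K" "x = (\<Sum>a<8. F a (y a))"
    using x unfolding octonion_span_def by blast
  have "h (\<Sum>a<8. F a (y a)) = (\<Sum>a<8. h (F a (y a)))"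
    using l by (simp add: module_hom.sum flip: module_hom_iff_linear)
  also have "\<dots> = (\<Sum>a<8. F a (h (y a)))" by (rule sum.cong) (auto simp: F_def c)
  finally show ?thesis using y octonion_spanI[of "\<lambda>a. h (y a)" K] h by simp
qed

lemma g2_spinor_commuting:
  assumes l: "Vector_Spaces.linear t t h" and c: "\<And>i y. i < 7 \<Longrightarrow> h (f i y) = f i (h y)"
    and x: "g2_spinor x"
  shows "g2_spinor (h x)"
  using x unfolding g2_spinor_def by (metis c mod_less_divisor zero_less_numeral)

definition line_of :: "'s \<Rightarrow> 's set" where "line_of x = range (\<lambda>c. t c x)"

lemma line_of_subspace: "subspace (line_of x)"
proof (rule subspaceI)
  show "0 \<in> line_of x" unfolding line_of_def by (rule image_eqI[of _ _ 0]) auto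
qed (auto simp: line_of_def scale_left_distrib[symmetric])

lemma line_of_self: "x \<in> line_of x"
  unfolding line_of_def by (rule image_eqI[of _ _ 1]) auto

lemma line_of_g2_spinor: "g2_spinor x \<Longrightarrow> y \<in> line_of x \<Longrightarrow> g2_spinor y"
  by (auto simp: line_of_def g2_spinor_scale)

lemma octonion_span_line_of: "y \<in> octonion_span (line_of x) \<Longrightarrow> \<exists>c. y = (\<Sum>a<8. t (c a) (F a x))"
proof -
  assume "y \<in> octonion_span (line_of x)"
  then obtain z where z: "\<And>a. a < 8 \<Longrightarrow> z a \<in> line_of x" "y = (\<Sum>a<8. F a (z a))"
    unfolding octonion_span_def by blast
  then have "\<forall>a. \<exists>c. a < 8 \<longrightarrow> z a = t c x" by (auto simp: line_of_def)
  then obtain c where "\<And>a. a < 8 \<Longrightarrow> z a = t (c a) x" by metis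
  then show ?thesis using z(2) by (auto simp: F_scale intro!: exI[of _ c] sum.cong)
qed

end

text \<open>With the coordinates of two vectors split into two groups, the hypothesis says that all
  mixed 2 by 2 minors vanish. If both groups are nonzero, the entries \<open>b' j0\<close> and
  \<open>a' j0\<close> at a nonzero position give a linear dependence of the two vectors.\<close>

lemma rank_one_cases:
  fixes a b a' b' :: "nat \<Rightarrow> complex"
  assumes h: "\<And>i j. i < n \<Longrightarrow> j < m \<Longrightarrow> a i * b' j = b i * a' j"
  shows "(\<forall>j<m. a' j = 0 \<and> b' j = 0) \<or> (\<forall>i<n. a i = 0 \<and> b i = 0) \<or>
    (\<exists>k l. (k \<noteq> 0 \<or> l \<noteq> 0) \<and> (\<forall>i<n. k * a i = l * b i) \<and> (\<forall>j<m. k * a' j = l * b' j))"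
proof (cases "(\<forall>j<m. a' j = 0 \<and> b' j = 0) \<or> (\<forall>i<n. a i = 0 \<and> b i = 0)")
  case False
  then obtain i0 j0 where i0: "i0 < n" "a i0 \<noteq> 0 \<or> b i0 \<noteq> 0" and j0: "j0 < m" "a' j0 \<noteq> 0 \<or> b' j0 \<noteq> 0"
    by blast
  have "b' j0 * a i = a' j0 * b i" if "i < n" for i using h[OF that j0(1)] by (simp add: mult.commute)
  moreover have "b' j0 * a' j = a' j0 * b' j" if "j < m" for j
  proof (cases "a i0 = 0")
    case True
    then show ?thesis using h[OF i0(1) that] h[OF i0(1) j0(1)] i0 by simp
  next
    case False
    have "a i0 * (b' j0 * a' j) = (b i0 * a' j0) * a' j" using h[OF i0(1) j0(1)] by (simp add: algebra_simps)
    also have "\<dots> = a i0 * (a' j0 * b' j)" using h[OF i0(1) that] by (simp add: algebra_simps)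
    finally show ?thesis using False by simp
  qed
  ultimately show ?thesis using j0(2) by blast
qed blast

context even_module
begin

lemma E_sum_sum:
  assumes "finite A" "finite C" "\<And>i. i \<in> A \<Longrightarrow> d i \<in> W" "\<And>j. j \<in> C \<Longrightarrow> d' j \<in> W"
  shows "E (\<Sum>i\<in>A. s (a i) (d i)) (\<Sum>j\<in>C. s (b j) (d' j)) z = (\<Sum>i\<in>A. \<Sum>j\<in>C. t (a i * b j) (E (d i) (d' j) z))"
proof -
  have "(\<Sum>j\<in>C. s (b j) (d' j)) \<in> W" using assms W by (intro V.subspace_sum) (auto simp: V.subspace_scale)
  then have "E (\<Sum>i\<in>A. s (a i) (d i)) (\<Sum>j\<in>C. s (b j) (d' j)) z
      = (\<Sum>i\<in>A. t (a i) (E (d i) (\<Sum>j\<in>C. s (b j) (d' j)) z))"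
    using assms W by (simp add: E_suml E_scalel V.subspace_scale)
  also have "\<dots> = (\<Sum>i\<in>A. \<Sum>j\<in>C. t (a i * b j) (E (d i) (d' j) z))"
    by (rule sum.cong) (use assms W in \<open>simp_all add: E_sumr E_scaler V.subspace_scale M.scale_sum_right\<close>)
  finally show ?thesis .
qed

end

section \<open>The half-spin module in an orthonormal frame\<close>

locale half_spin = spin_module s q UNIV t \<rho>
  for s :: "complex \<Rightarrow> 'v::ab_group_add \<Rightarrow> 'v" and q and t :: "complex \<Rightarrow> 's::ab_group_add \<Rightarrow> 's" and \<rho> +
  assumes nd: "nondegenerate q"

sublocale half_spin \<subseteq> half_spin_module
  by unfold_locales (use nd nontrivial in auto)

locale spin_frame = half_spin +
  fixes e
  assumes on: "orthonormal e 14" and sp: "V.span (e ` {..<14}) = UNIV"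
begin

abbreviation e' where "e' i \<equiv> e (i + 7)"

lemma on7: "orthonormal e 7" and on7': "orthonormal e' 7"
  using on by (simp_all add: orthonormal_def)

sublocale P: octonion_operators t "octonion_op e" by (rule octonion_operators_octonion_op[OF on7]) simp
sublocale P': octonion_operators t "octonion_op e'" by (rule octonion_operators_octonion_op[OF on7']) simp

abbreviation f where "f \<equiv> octonion_op e"
abbreviation f' where "f' \<equiv> octonion_op e'"

lemma E_f: "i < 7 \<Longrightarrow> j < 7 \<Longrightarrow> E (e i) (e j) z = - f i (f j z)"
  by (simp add: octonion_op_mult[OF on7])

lemma E_f': "i < 7 \<Longrightarrow> j < 7 \<Longrightarrow> E (e' i) (e' j) z = - f' i (f' j z)"
  by (simp add: octonion_op_mult[OF on7'])

lemma f_f': "i < 7 \<Longrightarrow> j < 7 \<Longrightarrow> f i (f' j z) = f' j (f i z)"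
  by (rule octonion_op_commute) (use on in \<open>auto simp: orthonormal_def\<close>)

lemma Bee: "i < 14 \<Longrightarrow> j < 14 \<Longrightarrow> B (e i) (e j) = (if i = j then 2 else 0)"
  using on by (simp add: orthonormal_def)

lemma qe: "i < 14 \<Longrightarrow> q (e i) = 1"
  using on orthonormal_q by blast

text \<open>The link between the two halves of the frame: a mixed product \<open>e i e' j\<close> is
  \<open>e i e 0\<close>, then this element, then \<open>e 7 e' j\<close>.\<close>

definition pivot where "pivot = E (e 0) (e 7)"

lemma pivot_simps: "pivot (- z) = - pivot z" "pivot (t c z) = t c (pivot z)" "pivot (y + z) = pivot y + pivot z"
  by (simp_all add: pivot_def E_minus E_scale E_plus)

lemma pivot_E: "0 < i \<Longrightarrow> i < 7 \<Longrightarrow> pivot (E (e i) (e 0) z) = - E (e i) (e 0) (pivot z)"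
proof -
  assume i: "0 < i" "i < 7"
  have "pivot (E (e i) (e 0) z) = - E (e 0) (e i) (E (e 7) (e 0) z)"
    unfolding pivot_def by (rule E_swap) (use i in \<open>auto simp: Bee\<close>)
  also have "\<dots> = E (e i) (e 0) (E (e 7) (e 0) z)" using i by (simp add: E_anti[of "e 0" "e i"] Bee)
  also have "\<dots> = - E (e i) (e 0) (pivot z)" using i by (simp add: E_anti[of "e 7" "e 0"] Bee E_minus pivot_def)
  finally show ?thesis .
qed

lemma pivot_E': "0 < i \<Longrightarrow> i < 7 \<Longrightarrow> pivot (E (e' i) (e' 0) z) = - E (e' i) (e' 0) (pivot z)"
proof -
  assume i: "0 < i" "i < 7"
  have "pivot (E (e' i) (e' 0) z) = - E (e 0) (e' i) (E (e 7) (e 7) z)"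
    unfolding pivot_def using i by (subst E_swap) (auto simp: Bee)
  then have 1: "pivot (E (e' i) (e' 0) z) = E (e' i) (e 0) z"
    using i by (simp add: E_self qe E_anti[of "e 0" "e' i"] Bee)
  have "E (e' i) (e' 0) (pivot z) = - E (e' i) (e 7) (E (e 7) (e 0) z)"
    by (simp add: pivot_def E_anti[of "e 0" "e 7"] Bee E_minus)
  also have "\<dots> = - E (e' i) (e 0) z" using i by (simp add: E_comp qe)
  finally show ?thesis using 1 by simp
qed

lemma pivot_f0: "pivot (f 0 z) = f 0 (pivot z)" and pivot_f'0: "pivot (f' 0 z) = f' 0 (pivot z)"
proof -
  have c: "pivot (E (e i) (e j) z) = E (e i) (e j) (pivot z)" if "i \<noteq> 0" "i \<noteq> 7" "j \<noteq> 0" "j \<noteq> 7" "i < 14" "j < 14" for i j z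
    unfolding pivot_def by (rule E_commute) (use that in \<open>auto simp: Bee\<close>)
  show "pivot (f 0 z) = f 0 (pivot z)" "pivot (f' 0 z) = f' 0 (pivot z)"
    by (simp_all add: octonion_op_def E_self qe c)
qed

lemma pivot_pivot: "pivot (pivot z) = - z"
proof -
  have "pivot (pivot z) = - pivot (E (e 7) (e 0) z)" by (simp add: pivot_def E_anti[of "e 0" "e 7"] Bee E_minus)
  also have "\<dots> = - z" by (simp add: pivot_def E_comp qe E_self)
  finally show ?thesis .
qed

text \<open>Up to sign the product of all \<open>e i\<close> with \<open>i < 14\<close>, which is central in the even Clifford algebra.\<close>

definition volume where "volume z = pivot (f 0 (f' 0 z))"

lemma volume_linear: "Vector_Spaces.linear t t volume"
  by (simp add: volume_def Vector_Spaces.linear_iff M.vector_space_axioms pivot_simps P.f_add P.f_scale P'.f_add P'.f_scale)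

lemma volume_volume: "volume (volume z) = - z"
  by (simp add: volume_def pivot_f0[symmetric] pivot_f'0[symmetric] f_f' pivot_pivot P.sq P'.sq P.f_minus P'.f_minus pivot_simps)

lemma volume_E: "i < 7 \<Longrightarrow> volume (E (e i) (e 0) z) = E (e i) (e 0) (volume z)"
proof (cases "i = 0")
  case False
  assume i: "i < 7"
  have "f 0 (E (e i) (e 0) z) = - E (e i) (e 0) (f 0 z)" for z
    using i False P.anti[of 0 i "f 0 z"] by (simp add: E_f P.f_minus)
  moreover have "f' 0 (E (e i) (e 0) z) = E (e i) (e 0) (f' 0 z)"
    using i by (simp add: E_f P'.f_minus f_f')
  ultimately show ?thesis
    using i False by (simp add: volume_def pivot_simps pivot_E E_minus P.f_minus)
qed (simp add: E_self qe)

lemma volume_E': "i < 7 \<Longrightarrow> volume (E (e' i) (e' 0) z) = E (e' i) (e' 0) (volume z)"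
proof (cases "i = 0")
  case False
  assume i: "i < 7"
  have "f' 0 (E (e' i) (e' 0) z) = - E (e' i) (e' 0) (f' 0 z)"
    using i False P'.anti[of 0 i "f' 0 z"] E_f'[OF i, of 0] by (simp add: P'.f_minus)
  moreover have "f 0 (E (e' i) (e' 0) z) = E (e' i) (e' 0) (f 0 z)" for z
    using i E_f'[OF i, of 0] by (simp add: P.f_minus f_f')
  ultimately show ?thesis
    using i False pivot_E'[of i] by (simp add: volume_def pivot_simps E_minus P.f_minus)
qed (simp add: E_self qe)

lemma volume_E_all: "i < 14 \<Longrightarrow> j < 14 \<Longrightarrow> volume (E (e i) (e j) z) = E (e i) (e j) (volume z)"
proof -
  have OP: "volume (pivot z) = pivot (volume z)" for z by (simp add: volume_def pivot_f0 pivot_f'0)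
  have neg: "volume (- z) = - volume z" for z by (simp add: volume_def pivot_simps P.f_minus P'.f_minus)
  have 1: "volume (E (e i) (e 0) z) = E (e i) (e 0) (volume z)" if "i < 14" for i z
  proof (cases "i < 7")
    case False
    have 2: "E (e i) (e 0) z = - E (e' (i - 7)) (e' 0) (pivot z)" for z
    proof -
      have "E (e i) (e 0) z = E (e i) (e 7) (E (e 7) (e 0) z)" by (simp add: E_comp qe)
      then show ?thesis using False by (simp add: pivot_def E_anti[of "e 7" "e 0"] Bee E_minus)
    qed
    have "i - 7 < 7" using that by simp
    then show ?thesis unfolding 2 neg by (simp only: volume_E' OP)
  qed (rule volume_E)
  have 2: "volume (E (e 0) (e j) z) = E (e 0) (e j) (volume z)" if "j < 14" for j z
  proof (cases "j = 0")
    case False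
    then show ?thesis using that by (simp add: E_anti[of "e 0" "e j"] Bee neg 1)
  qed (simp add: E_self qe)
  assume ij: "i < 14" "j < 14"
  have "E (e i) (e j) z = E (e i) (e 0) (E (e 0) (e j) z)" for z
    by (simp add: E_comp qe)
  then show "volume (E (e i) (e j) z) = E (e i) (e j) (volume z)"
    using ij by (simp add: 1 2)
qed

text \<open>Schur's lemma in concrete form: the volume operator has square -1 and commutes with the
  action, so by simplicity one of its eigenspaces for \<i> and -\<i> is everything.\<close>

lemma volume_scalar: "\<exists>c. c \<noteq> 0 \<and> (\<forall>z. volume z = t c z)"
proof -
  have Oa: "volume (x + y) = volume x + volume y" and Oc: "volume (t c x) = t c (volume x)" for x y c
    using volume_linear by (simp_all add: Vector_Spaces.linear_iff)
  let ?U = "{z. volume z = t \<i> z}"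
  have U: "M.subspace ?U"
    by (rule M.subspaceI) (use Oc[of 0 0] in \<open>auto simp: Oa Oc M.scale_right_distrib M.scale_left_commute\<close>)
  have inv: "i < 14 \<Longrightarrow> j < 14 \<Longrightarrow> z \<in> ?U \<Longrightarrow> E (e i) (e j) z \<in> ?U" for i j z
    by (simp add: volume_E_all E_scale)
  show ?thesis
  proof (cases "\<exists>x\<in>?U. x \<noteq> 0")
    case True
    then have "?U = UNIV" using simple_span[OF U sp[symmetric] inv] by blast
    then show ?thesis by (intro exI[of _ \<i>]) auto
  next
    case False
    have "volume z = t (- \<i>) z" for z
    proof -
      have "volume (volume z + t \<i> z) = t \<i> (volume z + t \<i> z)"
        by (simp add: volume_volume Oa Oc M.scale_right_distrib)
      then have "volume z + t \<i> z = 0" using False by blast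
      then show ?thesis by (simp add: eq_neg_iff_add_eq_0)
    qed
    then show ?thesis by (intro exI[of _ "- \<i>"]) auto
  qed
qed

text \<open>Up to sign, \<open>e i e' j\<close> is \<open>f i f' j\<close> times the volume element
  of the whole frame, which acts as a scalar. Mixed products thus reduce to the two octonionic
  actions.\<close>

lemma mixed: "\<exists>\<kappa>. \<kappa> \<noteq> 0 \<and> (\<forall>i<7. \<forall>j<7. \<forall>z. E (e i) (e' j) z = t \<kappa> (f i (f' j z)))"
proof -
  obtain c where c: "c \<noteq> 0" "\<And>z. volume z = t c z" using volume_scalar by blast
  have pivot: "pivot z = t c (f 0 (f' 0 z))" for z
    using c(2)[of "f 0 (f' 0 z)"] by (simp add: volume_def f_f' P.sq P'.sq P.f_minus P'.f_minus)
  have "E (e i) (e' j) z = t c (f i (f' j z))" if ij: "i < 7" "j < 7" for i j z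
  proof -
    have "E (e i) (e' j) z = E (e i) (e 0) (E (e 0) (e 7) (E (e 7) (e' j) z))"
      by (simp add: E_comp qe)
    also have "\<dots> = f i (f 0 (pivot (f' 0 (f' j z))))"
      using ij E_f'[of 0 j z] by (simp add: E_f pivot_def[symmetric] pivot_simps P.f_minus)
    also have "\<dots> = t c (f i (f' j z))"
      using ij by (simp add: pivot P.f_scale P'.sq P.sq P.f_minus)
    finally show ?thesis .
  qed
  then show ?thesis using c(1) by blast
qed

lemma simple_f:
  assumes U: "M.subspace U" and f: "\<And>i z. i < 7 \<Longrightarrow> z \<in> U \<Longrightarrow> f i z \<in> U"
    and f': "\<And>i z. i < 7 \<Longrightarrow> z \<in> U \<Longrightarrow> f' i z \<in> U" and x: "x \<in> U" "x \<noteq> 0"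
  shows "U = UNIV"
proof (rule simple_span[OF U sp[symmetric] _ x])
  obtain \<kappa> where k: "\<And>i j z. i < 7 \<Longrightarrow> j < 7 \<Longrightarrow> E (e i) (e' j) z = t \<kappa> (f i (f' j z))"
    using mixed by blast
  fix i j :: nat and z assume i: "i < 14" and j: "j < 14" and z: "z \<in> U"
  have m: "E (e i) (e' j) z \<in> U" if "i < 7" "j < 7" for i j
    using that z by (simp add: k f f' M.subspace_scale[OF U])
  consider "i < 7" "j < 7" | "i < 7" "j \<ge> 7" | "i \<ge> 7" "j < 7" | "i \<ge> 7" "j \<ge> 7" by linarith
  then show "E (e i) (e j) z \<in> U"
  proof cases
    case 1
    then show ?thesis using z by (simp add: E_f f M.subspace_neg[OF U])
  next
    case 2
    then show ?thesis using m[of i "j - 7"] j by simp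
  next
    case 3
    then show ?thesis using m[of j "i - 7"] i E_anti[of "e i" "e j" z] by (simp add: Bee M.subspace_neg[OF U])
  next
    case 4
    then show ?thesis using E_f'[of "i - 7" "j - 7" z] i j z by (simp add: f' M.subspace_neg[OF U])
  qed
qed

definition adapted :: "'b \<Rightarrow> bool" where
  "adapted x \<longleftrightarrow> x \<noteq> 0 \<and> P.g2_spinor x \<and> P'.g2_spinor x"

lemma f'_g2: "i < 7 \<Longrightarrow> P.g2_spinor x \<Longrightarrow> P.g2_spinor (f' i x)"
  by (rule P.g2_spinor_commuting[of "f' i"]) (auto intro: P'.lin simp: f_f')

text \<open>The \<open>f'\<close> operators commute with the \<open>f i\<close> and so preserve the
  space of \<open>g2_spinor\<close>s for \<open>f\<close>; the existence lemma for \<open>f'\<close>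
  is applied inside that space.\<close>

lemma adapted_exists: "\<exists>x. adapted x"
proof -
  obtain z :: 'b where z: "z \<noteq> 0" using nontrivial by blast
  obtain y where y: "y \<noteq> 0" "P.g2_spinor y"
    using P.g2_spinor_exists[of UNIV z] z by (auto simp: M.subspace_UNIV)
  have "\<exists>x\<in>{x. P.g2_spinor x}. x \<noteq> 0 \<and> P'.g2_spinor x"
    by (rule P'.g2_spinor_exists[OF P.subspace_g2_spinor _ _ y(1)])
       (use y f'_g2 in auto)
  then show ?thesis by (auto simp: adapted_def)
qed

lemma F'_g2: "P.g2_spinor x \<Longrightarrow> b < 8 \<Longrightarrow> P.g2_spinor (P'.F b x)"
  by (auto simp: P'.F_def f'_g2)

lemma F'_sum_g2: "P.g2_spinor x \<Longrightarrow> P.g2_spinor (\<Sum>b<8. t (c b) (P'.F b x))"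
  by (intro P.g2_spinor_sum P.g2_spinor_scale F'_g2) auto

text \<open>The octonionic span for \<open>f'\<close> of the line of \<open>x\<close> consists of
  \<open>g2_spinor\<close>s for \<open>f\<close>. Its octonionic span for \<open>f\<close> is stable
  under both families of operators, hence everything by simplicity.\<close>

lemma adapted_span:
  assumes x: "adapted x"
  shows "\<exists>c. z = (\<Sum>a<8. P.F a (\<Sum>b<8. t (c a b) (P'.F b x)))"
proof -
  let ?K = "P'.octonion_span (P'.line_of x)"
  have x': "P'.g2_spinor x" "P.g2_spinor x" "x \<noteq> 0" using x by (auto simp: adapted_def)
  have K: "M.subspace ?K" by (rule P'.octonion_span_subspace[OF P'.line_of_subspace])
  have Kg: "P.g2_spinor y" if "y \<in> ?K" for y
    using P'.octonion_span_line_of[OF that] F'_sum_g2[OF x'(2)] by blast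
  have "P.octonion_span ?K = UNIV"
  proof (rule simple_f)
    show "M.subspace (P.octonion_span ?K)" by (rule P.octonion_span_subspace[OF K])
    show "i < 7 \<Longrightarrow> z \<in> P.octonion_span ?K \<Longrightarrow> f i z \<in> P.octonion_span ?K" for i z
      by (rule P.octonion_span_f[OF K Kg])
    show "i < 7 \<Longrightarrow> z \<in> P.octonion_span ?K \<Longrightarrow> f' i z \<in> P.octonion_span ?K" for i z
      by (rule P.octonion_span_commuting[of _ "f' i"])
         (auto intro!: P'.lin P'.octonion_span_f P'.line_of_subspace P'.line_of_g2_spinor[OF x'(1)] simp: f_f')
    show "x \<in> P.octonion_span ?K"
      by (intro P.octonion_span_superset K P'.octonion_span_superset P'.line_of_subspace P'.line_of_self)
  qed (rule x')
  then obtain y where y: "\<And>a. a < 8 \<Longrightarrow> y a \<in> ?K" "z = (\<Sum>a<8. P.F a (y a))"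
    unfolding P.octonion_span_def by blast
  then have "\<forall>a. \<exists>c. a < 8 \<longrightarrow> y a = (\<Sum>b<8. t (c b) (P'.F b x))" using P'.octonion_span_line_of by blast
  then obtain c where "\<And>a. a < 8 \<Longrightarrow> y a = (\<Sum>b<8. t (c a b) (P'.F b x))" by metis
  then show ?thesis using y(2) by (intro exI[of _ c]) simp
qed

lemma adapted_independent:
  assumes x: "adapted x" and z: "(\<Sum>a<8. P.F a (\<Sum>b<8. t (c a b) (P'.F b x))) = 0" and ab: "a < 8" "b < 8"
  shows "c a b = 0"
proof -
  have x': "P'.g2_spinor x" "P.g2_spinor x" "x \<noteq> 0" using x by (auto simp: adapted_def)
  have "(\<Sum>b<8. t (c a b) (P'.F b x)) = 0"
    by (rule P.g2_spinor_components[OF _ z ab(1)]) (rule F'_sum_g2[OF x'(2)])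
  then show ?thesis using P'.F_independent[OF x'(1,3) _ ab(2)] by blast
qed

text \<open>Components with respect to \<open>P.F\<close> and then \<open>P'.F\<close> are unique,
  and \<open>y\<close> is its own component at index 0 for both; only the coefficient
  \<open>c 0 0\<close> of \<open>x\<close> remains.\<close>

lemma adapted_unique:
  assumes x: "adapted x" and y: "P.g2_spinor y" "P'.g2_spinor y"
  shows "\<exists>c. y = t c x"
proof -
  obtain c where c: "y = (\<Sum>a<8. P.F a (\<Sum>b<8. t (c a b) (P'.F b x)))" using adapted_span[OF x] by blast
  have x': "P'.g2_spinor x" "P.g2_spinor x" "x \<noteq> 0" using x by (auto simp: adapted_def)
  let ?w = "\<lambda>a. \<Sum>b<8. t (c a b) (P'.F b x)"
  have "(\<Sum>a<8. P.F a (?w a - (if a = 0 then y else 0))) = 0"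
  proof -
    have "(\<Sum>a<8. P.F a (?w a - (if a = 0 then y else 0))) = (\<Sum>a<8. P.F a (?w a)) - (\<Sum>a<(8::nat). if a = 0 then y else 0)"
      unfolding sum_subtractf[symmetric] by (rule sum.cong) (auto simp: P.F_def P.f_diff)
    then show ?thesis using c by simp
  qed
  then have "?w 0 - (if (0::nat) = 0 then y else 0) = 0"
    by (rule P.g2_spinor_component_0[rotated])
       (use M.subspace_diff[OF P.subspace_g2_spinor] F'_sum_g2[OF x'(2)] y(1) in auto)
  then have y1: "y = ?w 0" by simp
  have "(\<Sum>b<8. P'.F b (t (c 0 b) x - (if b = 0 then y else 0))) = 0"
  proof -
    have "(\<Sum>b<8. P'.F b (t (c 0 b) x - (if b = 0 then y else 0))) = ?w 0 - (\<Sum>b<(8::nat). if b = 0 then y else 0)"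
      unfolding sum_subtractf[symmetric] by (rule sum.cong) (auto simp: P'.F_def P'.f_diff P'.f_scale)
    then show ?thesis using y1 by simp
  qed
  then have "t (c 0 0) x - (if (0::nat) = 0 then y else 0) = 0"
    by (rule P'.g2_spinor_component_0[rotated])
       (use M.subspace_diff[OF P'.subspace_g2_spinor] P'.g2_spinor_scale[OF x'(1)] y(2) in auto)
  then show ?thesis by (intro exI[of _ "c 0 0"]) simp
qed

end

section \<open>Null pairs annihilating a spinor\<close>

context even_module
begin

lemma null_pair_expand:
  assumes e: "orthonormal e 7" "\<And>i. i < 7 \<Longrightarrow> e i \<in> W" and i: "a < 7" "b < 7" "c < 7" "d < 7"
  shows "E (e a + s k (e b)) (e c + s l (e d)) x =
    - (octonion_op e a (octonion_op e c x) + t l (octonion_op e a (octonion_op e d x))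
     + t k (octonion_op e b (octonion_op e c x)) + t (k * l) (octonion_op e b (octonion_op e d x)))"
proof -
  have W': "s k (e b) \<in> W" "s l (e d) \<in> W" "e c + s l (e d) \<in> W"
    using e i W by (simp_all add: V.subspace_scale V.subspace_add)
  have m: "E (e i) (e j) x = - octonion_op e i (octonion_op e j x)" if "i < 7" "j < 7" for i j
    using octonion_op_mult[OF e that] by simp
  show ?thesis
    using e i W' by (simp add: E_addl E_addr E_scalel E_scaler m M.scale_right_diff_distrib)
qed

text \<open>In the first five products the index pairs {1, 3}, {2, 6}, {4, 5} each complete 0 to a
  Fano line; in the last, {2, 4} and {3, 0} complete 1. The two factors carry opposite signs of
  \<i>, and the four terms of each expansion cancel by the multiplication table.\<close>

lemma null_pairs_annihilate:
  assumes e: "orthonormal e 7" "\<And>i. i < 7 \<Longrightarrow> e i \<in> W"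
    and x: "octonion_operators.g2_spinor (octonion_op e) x"
  shows "E (e 1 + s \<i> (e 3)) (e 2 + s (- \<i>) (e 6)) x = 0"
    "E (e 2 + s (- \<i>) (e 6)) (e 4 + s \<i> (e 5)) x = 0"
    "E (e 4 + s \<i> (e 5)) (e 1 + s (- \<i>) (e 3)) x = 0"
    "E (e 1 + s (- \<i>) (e 3)) (e 2 + s \<i> (e 6)) x = 0"
    "E (e 2 + s \<i> (e 6)) (e 4 + s (- \<i>) (e 5)) x = 0"
    "E (e 2 + s \<i> (e 4)) (e 3 + s (- \<i>) (e 0)) x = 0"
proof -
  interpret P: octonion_operators t "octonion_op e" by (rule octonion_operators_octonion_op[OF e])
  note E = P.g2_spinorD[OF x] P.g2_spinor_prod[OF x] P.sort
  show "E (e 1 + s \<i> (e 3)) (e 2 + s (- \<i>) (e 6)) x = 0"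
    "E (e 2 + s (- \<i>) (e 6)) (e 4 + s \<i> (e 5)) x = 0"
    "E (e 4 + s \<i> (e 5)) (e 1 + s (- \<i>) (e 3)) x = 0"
    "E (e 1 + s (- \<i>) (e 3)) (e 2 + s \<i> (e 6)) x = 0"
    "E (e 2 + s \<i> (e 6)) (e 4 + s (- \<i>) (e 5)) x = 0"
    "E (e 2 + s \<i> (e 4)) (e 3 + s (- \<i>) (e 0)) x = 0"
    by (subst null_pair_expand[OF e]; simp add: E algebra_simps)+
qed

lemma null_pair_isotropic:
  assumes e: "orthonormal e 7" and i: "a < 7" "b < 7" "c < 7" "d < 7" "distinct [a, b, c, d]"
    and k: "k * k = - 1" "l * l = - 1"
  shows "q (e a + s k (e b)) = 0" "q (e c + s l (e d)) = 0" "B (e a + s k (e b)) (e c + s l (e d)) = 0"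
    "s m (e a + s k (e b)) = s n (e c + s l (e d)) \<Longrightarrow> m = 0 \<and> n = 0"
proof -
  note o = orthonormalD[OF e] orthonormal_q[OF e]
  show "q (e a + s k (e b)) = 0" "q (e c + s l (e d)) = 0" "B (e a + s k (e b)) (e c + s l (e d)) = 0"
    using i k by (simp_all add: q_add q_scale B_simps o power2_eq_square)
  assume "s m (e a + s k (e b)) = s n (e c + s l (e d))"
  then have "B (e a) (s m (e a + s k (e b))) = B (e a) (s n (e c + s l (e d)))"
    "B (e c) (s m (e a + s k (e b))) = B (e c) (s n (e c + s l (e d)))" by simp_all
  then show "m = 0 \<and> n = 0" using i by (simp add: B_simps o)
qed

text \<open>Write \<open>x1, x2, x3\<close> for \<open>e 1 + i e 3\<close>, \<open>e 2 + i e 6\<close>, \<open>e 4 + i e 5\<close> and \<open>y1, y2, y3\<close> for the conjugates. Then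
  \<open>x1, y2, x3, y1, x2, y3\<close> is a chain of null pairs, and one further pair reaches \<open>e 0\<close>.\<close>

lemma null_pairs_connect:
  assumes e: "orthonormal e 7" "\<And>i. i < 7 \<Longrightarrow> e i \<in> W"
    and x: "octonion_operators.g2_spinor (octonion_op e) x"
    and Y: "V.subspace Y" and YZ: "Y \<inter> Z = {0}"
    and H: "\<And>u w. u \<in> V.span (e ` {..<7}) \<Longrightarrow> w \<in> V.span (e ` {..<7}) \<Longrightarrow> q u = 0 \<Longrightarrow> q w = 0 \<Longrightarrow>
      B u w = 0 \<Longrightarrow> (\<And>k l. s k u = s l w \<Longrightarrow> k = 0 \<and> l = 0) \<Longrightarrow> E u w x = 0 \<Longrightarrow>
      u \<in> Y \<and> w \<in> Y \<or> u \<in> Z \<and> w \<in> Z"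
    and start: "e 1 + s \<i> (e 3) \<in> Y"
  shows "V.span (e ` {..<7}) \<subseteq> Y"
proof -
  interpret P: octonion_operators t "octonion_op e" by (rule octonion_operators_octonion_op[OF e])
  have sp: "e a + s k (e b) \<in> V.span (e ` {..<7})" if "a < 7" "b < 7" for a b k
    using that by (intro V.span_add V.span_scale V.span_base) auto
  \<comment> \<open>\<open>H\<close> puts both vectors into \<open>Y\<close> or both into
    \<open>Z\<close>; they are nonzero and \<open>Y\<close>, \<open>Z\<close> meet only in 0, so
    membership in \<open>Y\<close> passes from one to the other.\<close>
  have pair: "(e a + s k (e b) \<in> Y \<longleftrightarrow> e c + s l (e d) \<in> Y)"
    if i: "a < 7" "b < 7" "c < 7" "d < 7" "distinct [a, b, c, d]" and k: "k * k = - 1" "l * l = - 1"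
      and 0: "E (e a + s k (e b)) (e c + s l (e d)) x = 0" for a b c d k l
  proof -
    note iso = null_pair_isotropic[OF e(1) i k]
    have "e a + s k (e b) \<noteq> 0" "e c + s l (e d) \<noteq> 0" using iso(4)[of 1 0] iso(4)[of 0 1] by auto
    then show ?thesis
      using H[OF sp sp iso(1-3) iso(4) 0] i YZ by blast
  qed
  note n = null_pairs_annihilate[OF e x]
  have y2: "e 2 + s (- \<i>) (e 6) \<in> Y"
    using pair[OF _ _ _ _ _ _ _ n(1)] start by simp
  then have x3: "e 4 + s \<i> (e 5) \<in> Y"
    using pair[OF _ _ _ _ _ _ _ n(2)] by simp
  then have y1: "e 1 + s (- \<i>) (e 3) \<in> Y"
    using pair[OF _ _ _ _ _ _ _ n(3)] by simp
  then have x2: "e 2 + s \<i> (e 6) \<in> Y"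
    using pair[OF _ _ _ _ _ _ _ n(4)] by simp
  then have y3: "e 4 + s (- \<i>) (e 5) \<in> Y"
    using pair[OF _ _ _ _ _ _ _ n(5)] by simp
  have half: "u \<in> Y" "v \<in> Y" if "u + s \<i> v \<in> Y" "u + s (- \<i>) v \<in> Y" for u v
  proof -
    have two: "s 2 z = z + z" for z using V.scale_left_distrib[of 1 1 z] by simp
    have "s (1/2) ((u + s \<i> v) + (u + s (- \<i>) v)) \<in> Y" using that Y V.subspace_add V.subspace_scale by blast
    moreover have "(u + s \<i> v) + (u + s (- \<i>) v) = s 2 u" by (simp add: two)
    ultimately show "u \<in> Y" by simp
    then have "s (- \<i>) ((u + s \<i> v) - u) \<in> Y" using that Y V.subspace_diff V.subspace_scale by blast
    then show "v \<in> Y" by simp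
  qed
  have e16: "e 1 \<in> Y" "e 3 \<in> Y" "e 2 \<in> Y" "e 6 \<in> Y" "e 4 \<in> Y" "e 5 \<in> Y"
    using half start y1 x2 y2 x3 y3 by blast+
  then have "e 2 + s \<i> (e 4) \<in> Y" using Y V.subspace_add V.subspace_scale by blast
  then have "e 3 + s (- \<i>) (e 0) \<in> Y"
    using pair[OF _ _ _ _ _ _ _ n(6)] by simp
  then have "s \<i> ((e 3 + s (- \<i>) (e 0)) - e 3) \<in> Y"
    using e16 Y V.subspace_diff V.subspace_scale by blast
  then have "e 0 \<in> Y" by simp
  then have "\<forall>i<7. e i \<in> Y" unfolding all_less_7 using e16 by simp
  then show ?thesis using Y by (intro V.span_minimal) auto
qed

text \<open>\<open>H\<close> abstracts two sources of the same information: the annihilator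
  computation, and invariance of a decomposition under unipotent elements. The first vector of the
  chain falls into \<open>Y\<close> or \<open>Z\<close>, and the connecting argument applies to
  either.\<close>

lemma null_pairs_summand:
  assumes e: "orthonormal e 7" "\<And>i. i < 7 \<Longrightarrow> e i \<in> W"
    and x: "octonion_operators.g2_spinor (octonion_op e) x"
    and Y: "V.subspace Y" and Z: "V.subspace Z" and YZ: "Y \<inter> Z = {0}"
    and H: "\<And>u w. u \<in> V.span (e ` {..<7}) \<Longrightarrow> w \<in> V.span (e ` {..<7}) \<Longrightarrow> q u = 0 \<Longrightarrow> q w = 0 \<Longrightarrow>
      B u w = 0 \<Longrightarrow> (\<And>k l. s k u = s l w \<Longrightarrow> k = 0 \<and> l = 0) \<Longrightarrow> E u w x = 0 \<Longrightarrow>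
      u \<in> Y \<and> w \<in> Y \<or> u \<in> Z \<and> w \<in> Z"
  shows "V.span (e ` {..<7}) \<subseteq> Y \<or> V.span (e ` {..<7}) \<subseteq> Z"
proof -
  interpret P: octonion_operators t "octonion_op e" by (rule octonion_operators_octonion_op[OF e])
  note n = null_pairs_annihilate[OF e x]
  have sp: "e a + s k (e b) \<in> V.span (e ` {..<7})" if "a < 7" "b < 7" for a b k
    using that by (intro V.span_add V.span_scale V.span_base) auto
  have i: "(1::nat) < 7" "(3::nat) < 7" "(2::nat) < 7" "(6::nat) < 7" "distinct [1, 3, 2, 6::nat]"
    and k: "\<i> * \<i> = - 1" "(- \<i>) * (- \<i>) = - 1" by simp_all
  note iso = null_pair_isotropic[OF e(1) i k]
  have "e 1 + s \<i> (e 3) \<in> Y \<or> e 1 + s \<i> (e 3) \<in> Z"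
    using H[OF sp[OF i(1,2)] sp[OF i(3,4)] iso(1-3) iso(4) n(1)] by blast
  moreover have "Z \<inter> Y = {0}" using YZ by blast
  ultimately show ?thesis
    using null_pairs_connect[OF e x Y YZ H] null_pairs_connect[OF e x Z, of Y] H by blast
qed

end

context half_spin
begin

section \<open>The decomposition attached to an adapted spinor\<close>

text \<open>With \<open>b = w - a\<close> the element \<open>1 + w u = (1 + a u) (1 + b u) = a (a + u) b (b + u)\<close> of the
  Clifford algebra is a product of four unit vectors.\<close>

lemma unipotent:
  assumes u: "q u = 0" and w: "q w = 0" and uw: "B u w = 0" and a: "q a = 1" "B a u = 0" "B a w = 0"
    and x: "E u w x = 0"
  shows "\<exists>g\<in>Spin UNIV. \<rho> g x = x \<and> implements g (\<lambda>v. v + s (B u v) w - s (B w v) u)"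
proof -
  define b where "b = w - a"
  have wu: "B w u = 0" "B w a = 0" "B u a = 0" using uw a by (simp_all add: B_sym)
  have Baa: "B a a = 2" "B u u = 0" "B w w = 0" using a u w by (simp_all add: B_self)
  have qs: "q (a + u) = 1" "q b = 1" "q (b + u) = 1"
    using assms by (simp_all add: q_add q_diff b_def B_simps wu)
  have bu: "B u b = 0" "B b u = 0" by (simp_all add: b_def B_simps uw wu a)
  define g where "g = (vec a \<otimes>\<^bsub>R\<^esub> vec (a + u)) \<otimes>\<^bsub>R\<^esub> (vec b \<otimes>\<^bsub>R\<^esub> vec (b + u))"
  have g: "g \<in> Spin UNIV" unfolding g_def using a qs by (intro Spin_mult Spin_pair) auto
  have "\<rho> g x = E a (a + u) (E b (b + u) x)"
    by (simp add: g_def rho_mult Cl0_pair E_def)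
  also have "\<dots> = x + E b u x + E a u x + E a u (E b u x)"
    by (simp add: E_addr E_plus E_self a qs)
  also have "E a u (E b u x) = 0"
    by (simp add: E_swap[of a u b u] bu E_self u E_zero)
  also have "x + E b u x + E a u x + 0 = x + E w u x"
    using E_addl[of b a u x] by (simp add: b_def)
  also have "E w u x = 0" using E_anti[of u w x] uw x by simp
  finally have 1: "\<rho> g x = x" by simp
  have "implements g ((reflect a \<circ> reflect (a + u)) \<circ> (reflect b \<circ> reflect (b + u)))"
    unfolding g_def using a qs by (intro implements_mult implements_vec) auto
  also have "(reflect a \<circ> reflect (a + u)) \<circ> (reflect b \<circ> reflect (b + u)) = (\<lambda>v. v + s (B u v) w - s (B w v) u)"
  proof
    fix v
    \<comment> \<open>The single factor \<open>c (c + u) = 1 + c u\<close> acts on vectors by this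
      formula, used for \<open>c = a\<close> and \<open>c = b\<close>.\<close>
    have S: "reflect c (reflect (c + u) v) = v + s (B u v) c - s (B c v) u - s (B u v) u"
      if c: "q c = 1" "B c u = 0" for c v
    proof -
      have "B c c = 2" "B u c = 0" using c by (simp_all add: B_self B_sym)
      then have "reflect c (reflect (c + u) v) = s (2 * B (c + u) v - B c v) c - (s (B (c + u) v) (c + u) - v)"
        using c by (simp add: reflect_def B_simps mult.commute)
      also have "\<dots> = v + s (B u v) c - s (B c v) u - s (B u v) u"
      proof -
        have "2 * B (c + u) v - B c v = B (c + u) v + B u v" by (simp add: B_simps)
        moreover have "s (2 * B u v) c = s (B u v) c + s (B u v) c"
          using V.scale_left_distrib[of "B u v" "B u v" c] by simp
        ultimately show ?thesis
          by (simp add: V.scale_right_distrib V.scale_left_distrib B_addl)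
      qed
      finally show ?thesis .
    qed
    have ab: "B a b = - 2" by (simp add: b_def B_simps a Baa)
    have "((reflect a \<circ> reflect (a + u)) \<circ> (reflect b \<circ> reflect (b + u))) v
      = (v + s (B u v) b - s (B b v) u - s (B u v) u) + s (B u v) a - s (B a v - 2 * B u v) u - s (B u v) u"
      by (simp add: S a qs bu B_simps ab Baa mult.commute)
    also have "\<dots> = v + s (B u v) w - s (B w v) u"
    proof -
      have w': "w = a + b" by (simp add: b_def)
      have "s (2 * B u v) u = s (B u v) u + s (B u v) u" using V.scale_left_distrib[of "B u v" "B u v" u] by simp
      then show ?thesis unfolding w'
        by (simp add: B_addl V.scale_right_distrib V.scale_left_distrib V.scale_left_diff_distrib algebra_simps)
    qed
    finally show "((reflect a \<circ> reflect (a + u)) \<circ> (reflect b \<circ> reflect (b + u))) v = v + s (B u v) w - s (B w v) u" .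
  qed
  finally show ?thesis using g 1 by blast
qed

text \<open>The operator in \<open>N\<close> is the bivector of \<open>u\<close> and
  \<open>w\<close>. Preserving both summands kills its mixed part. If neither the \<open>Y\<close>
  parts \<open>u1\<close>, \<open>w1\<close> nor the \<open>Z\<close> parts \<open>u2\<close>,
  \<open>w2\<close> both vanish, this makes \<open>u\<close> and \<open>w\<close> dependent.\<close>

lemma wedge_preserves_summand:
  assumes od: "orthogonal_decomposition s q Y Z" and ind: "\<And>k l. s k u = s l w \<Longrightarrow> k = 0 \<and> l = 0"
    and N: "\<And>v. v \<in> Y \<Longrightarrow> s (B u v) w - s (B w v) u \<in> Y" "\<And>v. v \<in> Z \<Longrightarrow> s (B u v) w - s (B w v) u \<in> Z"
  shows "u \<in> Y \<and> w \<in> Y \<or> u \<in> Z \<and> w \<in> Z"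
proof -
  have Y: "V.subspace Y" and Z: "V.subspace Z" and YZ: "\<And>y z. y \<in> Y \<Longrightarrow> z \<in> Z \<Longrightarrow> B y z = 0"
    and int: "Y \<inter> Z = {0}" and sum: "\<And>v. \<exists>y\<in>Y. \<exists>z\<in>Z. v = y + z"
    using od by (auto simp: orthogonal_decomposition_def)
  obtain u1 u2 w1 w2 where u: "u = u1 + u2" "u1 \<in> Y" "u2 \<in> Z" and w: "w = w1 + w2" "w1 \<in> Y" "w2 \<in> Z"
    using sum by metis
  have ZY: "B z y = 0" if "y \<in> Y" "z \<in> Z" for y z using YZ[OF that] by (simp add: B_sym)
  have rel: "s (B u2 v) w1 = s (B w2 v) u1" if v: "v \<in> Z" for v
  proof -
    have "s (B u2 v) w - s (B w2 v) u \<in> Z" using N(2)[OF v] v u w YZ by (simp add: B_simps)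
    moreover have "s (B u2 v) w2 - s (B w2 v) u2 \<in> Z" using u w Z V.subspace_diff V.subspace_scale by blast
    ultimately have "(s (B u2 v) w - s (B w2 v) u) - (s (B u2 v) w2 - s (B w2 v) u2) \<in> Z"
      using Z V.subspace_diff by blast
    moreover have "(s (B u2 v) w - s (B w2 v) u) - (s (B u2 v) w2 - s (B w2 v) u2) = s (B u2 v) w1 - s (B w2 v) u1"
      by (simp add: u w V.scale_right_distrib)
    moreover have "s (B u2 v) w1 - s (B w2 v) u1 \<in> Y" using u w Y V.subspace_diff V.subspace_scale by blast
    ultimately have "s (B u2 v) w1 - s (B w2 v) u1 \<in> Y \<inter> Z" by simp
    then show ?thesis by (simp add: int)
  qed
  have ndZ: "z = 0" if "z \<in> Z" "\<And>v. v \<in> Z \<Longrightarrow> B z v = 0" for z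
  proof (rule nondegenerateD)
    fix v obtain y v' where "y \<in> Y" "v' \<in> Z" "v = y + v'" using sum by blast
    then show "B z v = 0" using that ZY by (simp add: B_simps)
  qed
  show ?thesis
  proof (cases "(u1 = 0 \<and> w1 = 0) \<or> (u2 = 0 \<and> w2 = 0)")
    case True
    then show ?thesis using u w by auto
  next
    case False
    then obtain v where v: "v \<in> Z" "B u2 v \<noteq> 0 \<or> B w2 v \<noteq> 0" using ndZ u w by metis
    define l m where "l = B u2 v" and "m = B w2 v"
    have 1: "s l w1 = s m u1" and lm: "l \<noteq> 0 \<or> m \<noteq> 0" using rel v by (simp_all add: l_def m_def)
    have "\<exists>z. z \<noteq> 0 \<and> u1 = s l z \<and> w1 = s m z"
    proof (cases "l = 0")
      case True
      then have "m \<noteq> 0" "u1 = 0" using lm 1 by auto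
      then show ?thesis using False True by (intro exI[of _ "s (1 / m) w1"]) auto
    next
      case l: False
      have "s (1 / l) (s l w1) = s (1 / l) (s m u1)" using 1 by simp
      then have "w1 = s (m / l) u1" using l by simp
      then show ?thesis using l False by (intro exI[of _ "s (1 / l) u1"]) auto
    qed
    then obtain z where z: "z \<noteq> 0" "u1 = s l z" "w1 = s m z" by blast
    \<comment> \<open>Non-degeneracy on \<open>Z\<close> gives the \<open>Z\<close> parts the same
      ratio as the \<open>Y\<close> parts, which yields the dependence.\<close>
    have "s m u2 - s l w2 = 0"
    proof (rule ndZ)
      show "s m u2 - s l w2 \<in> Z" using u w Z V.subspace_diff V.subspace_scale by blast
      fix v' assume "v' \<in> Z"
      then have "s (B u2 v' * m) z = s (B w2 v' * l) z" using rel[of v'] z by simp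
      then show "B (s m u2 - s l w2) v' = 0" using z(1) by (simp add: B_simps mult.commute)
    qed
    then have "s m u = s l w" using 1 by (simp add: u w V.scale_right_distrib)
    then show ?thesis using ind lm by blast
  qed
qed

end

lemma sum_less_14: "(\<Sum>i<14. g i) = (\<Sum>i<7. g i) + (\<Sum>i<7. g (i + 7 :: nat))"
  for g :: "nat \<Rightarrow> 'a::comm_monoid_add"
  by (simp add: eval_nat_numeral add.assoc One_nat_def)

context spin_frame
begin

abbreviation V7 where "V7 \<equiv> V.span (e ` {..<7})"
abbreviation V7' where "V7' \<equiv> V.span (e' ` {..<7})"

lemma frame_expand:
  "u = (\<Sum>i<7. s (B (e i) u / 2) (e i)) + (\<Sum>i<7. s (B (e' i) u / 2) (e' i))"
  using orthonormal_expand[OF on, of u] sp by (simp add: sum_less_14)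

lemma V7_part: "(\<Sum>i<7. s (c i) (e i)) \<in> V7" and V7'_part: "(\<Sum>i<7. s (c i) (e' i)) \<in> V7'"
  by (rule V.span_sum, rule V.span_scale, rule V.span_base, simp)+

lemma V7I: "(\<And>i. i < 7 \<Longrightarrow> B (e' i) u = 0) \<Longrightarrow> u \<in> V7"
  by (subst frame_expand[of u]) (simp add: V7_part)

lemma V7'I: "(\<And>i. i < 7 \<Longrightarrow> B (e i) u = 0) \<Longrightarrow> u \<in> V7'"
  by (subst frame_expand[of u]) (simp add: V7'_part)

lemma frame_eqI: "(\<And>i. i < 7 \<Longrightarrow> B (e i) u = B (e i) v) \<Longrightarrow> (\<And>i. i < 7 \<Longrightarrow> B (e' i) u = B (e' i) v) \<Longrightarrow> u = v"
  by (subst frame_expand[of u], subst frame_expand[of v]) simp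

text \<open>The component of \<open>E u w x\<close> in the span of the \<open>f i (f' j x)\<close> has as coefficients the
  \<open>2 \<times> 2\<close> minors pairing the first seven coordinates of \<open>u, w\<close> with the last seven.\<close>

lemma annihilator_split:
  assumes x: "adapted x" and 0: "E u w x = 0" and ind: "\<And>k l. s k u = s l w \<Longrightarrow> k = 0 \<and> l = 0"
  shows "u \<in> V7 \<and> w \<in> V7 \<or> u \<in> V7' \<and> w \<in> V7'"
proof -
  have x': "P'.g2_spinor x" "P.g2_spinor x" "x \<noteq> 0" using x by (auto simp: adapted_def)
  obtain \<kappa> where k0: "\<kappa> \<noteq> 0" and k: "\<And>i j z. i < 7 \<Longrightarrow> j < 7 \<Longrightarrow> E (e i) (e' j) z = t \<kappa> (f i (f' j z))"
    using mixed by blast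
  define a a' b b' where "a i = B (e i) u / 2" and "a' i = B (e' i) u / 2"
    and "b i = B (e i) w / 2" and "b' i = B (e' i) w / 2" for i
  define ua ub wa wb where "ua = (\<Sum>i<7. s (a i) (e i))" and "ub = (\<Sum>i<7. s (a' i) (e' i))"
    and "wa = (\<Sum>i<7. s (b i) (e i))" and "wb = (\<Sum>i<7. s (b' i) (e' i))"
  have u: "u = ua + ub" and w: "w = wa + wb"
    unfolding ua_def ub_def wa_def wb_def a_def a'_def b_def b'_def by (rule frame_expand)+
  note O = P.octonion_span_subspace[OF P.line_of_subspace, of x]
  have "f i (f j x) \<in> P.octonion_span (P.line_of x)" if "i < 7" "j < 7" for i j
    using that P.line_of_g2_spinor[OF x'(2)]
    by (intro P.octonion_span_f P.line_of_subspace P.octonion_span_superset P.line_of_self) auto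
  then have "E (e i) (e j) x \<in> P.octonion_span (P.line_of x)" if "i < 7" "j < 7" for i j
    using that by (simp add: E_f M.subspace_neg[OF O])
  then have "E ua wa x \<in> P.octonion_span (P.line_of x)"
    unfolding ua_def wa_def
    by (subst E_sum_sum) (auto intro!: M.subspace_sum[OF O] M.subspace_scale[OF O])
  then obtain c where c: "E ua wa x = (\<Sum>a<8. t (c a) (P.F a x))" using P.octonion_span_line_of by blast
  have "P.g2_spinor (E (e' i) (e' j) x)" if "i < 7" "j < 7" for i j
    using that M.subspace_neg[OF P.subspace_g2_spinor] by (simp add: E_f' f'_g2 x')
  then have Y: "P.g2_spinor (E ub wb x)"
    unfolding ub_def wb_def by (subst E_sum_sum) (auto intro!: P.g2_spinor_sum P.g2_spinor_scale)
  define z where "z i = (\<Sum>j<7. t (\<kappa> * (a i * b' j - b i * a' j)) (f' j x))" for i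
  have zg: "P.g2_spinor (z i)" for i
    unfolding z_def by (intro P.g2_spinor_sum P.g2_spinor_scale f'_g2 x') simp
  have wab: "B wa ub = 0"
    unfolding wa_def ub_def by (simp add: B_simps Bee)
  have Z: "E ua wb x + E ub wa x = (\<Sum>i<7. f i (z i))"
  proof -
    have "E ua wb x = (\<Sum>i<7. \<Sum>j<7. t (a i * b' j) (t \<kappa> (f i (f' j x))))"
      unfolding ua_def wb_def by (subst E_sum_sum) (auto simp: k)
    moreover have "E ub wa x = - E wa ub x" using E_anti[of wa ub x] wab by simp
    moreover have "E wa ub x = (\<Sum>i<7. \<Sum>j<7. t (b i * a' j) (t \<kappa> (f i (f' j x))))"
      unfolding wa_def ub_def by (subst E_sum_sum) (auto simp: k)
    ultimately have "E ua wb x + E ub wa x =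
        (\<Sum>i<7. \<Sum>j<7. t (a i * b' j) (t \<kappa> (f i (f' j x))) - t (b i * a' j) (t \<kappa> (f i (f' j x))))"
      by (simp add: sum_subtractf)
    also have "\<dots> = (\<Sum>i<7. f i (z i))"
    proof (rule sum.cong)
      fix i assume "i \<in> {..<7::nat}"
      then have "f i (z i) = (\<Sum>j<7. t (\<kappa> * (a i * b' j - b i * a' j)) (f i (f' j x)))"
        by (simp add: z_def P.f_sum P.f_scale)
      also have "\<dots> = (\<Sum>j<7. t (a i * b' j) (t \<kappa> (f i (f' j x))) - t (b i * a' j) (t \<kappa> (f i (f' j x))))"
      proof (rule sum.cong)
        fix j
        have c: "\<kappa> * (a i * b' j - b i * a' j) = a i * b' j * \<kappa> - b i * a' j * \<kappa>"
          by (simp add: algebra_simps)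
        show "t (\<kappa> * (a i * b' j - b i * a' j)) (f i (f' j x)) =
            t (a i * b' j) (t \<kappa> (f i (f' j x))) - t (b i * a' j) (t \<kappa> (f i (f' j x)))"
          unfolding c by (simp add: M.scale_left_diff_distrib)
      qed simp
      finally show "(\<Sum>j<7. t (a i * b' j) (t \<kappa> (f i (f' j x))) - t (b i * a' j) (t \<kappa> (f i (f' j x)))) = f i (z i)"
        by simp
    qed simp
    finally show ?thesis .
  qed
  \<comment> \<open>The equation is sorted by \<open>P.F m\<close>: the purely second-half term
    joins index 0, and component \<open>Suc i\<close> is a multiple of \<open>x\<close> plus
    \<open>z i\<close>. Since \<open>z i\<close> is a combination of the \<open>f' j x\<close>, its
    coefficients vanish separately.\<close>
  define y where "y m = (case m of 0 \<Rightarrow> t (c 0) x + E ub wb x | Suc i \<Rightarrow> t (c (Suc i)) x + z i)" for m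
  have yg: "P.g2_spinor (y m)" for m
    using M.subspace_add[OF P.subspace_g2_spinor] P.g2_spinor_scale[OF x'(2)] Y zg
    by (auto simp: y_def split: nat.split)
  have shift: "(\<Sum>m<8. g m) = g 0 + (\<Sum>i<7. g (Suc i))" for g :: "nat \<Rightarrow> 'b"
    using sum.lessThan_Suc_shift[of g 7] by simp
  have "E u w x = E ua wa x + E ub wb x + (E ua wb x + E ub wa x)"
    by (simp add: u w E_addl E_addr)
  also have "\<dots> = (\<Sum>m<8. P.F m (y m))"
    unfolding c Z shift by (simp add: y_def P.f_add P.f_scale sum.distrib)
  finally have s0: "(\<Sum>m<8. P.F m (y m)) = 0" using 0 by simp
  have "a i * b' j = b i * a' j" if ij: "i < 7" "j < 7" for i j
  proof -
    have "y (Suc i) = 0" using P.g2_spinor_components[OF yg s0, of "Suc i"] ij by simp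
    then have "(\<Sum>m<8. t (case m of 0 \<Rightarrow> c (Suc i) | Suc j \<Rightarrow> \<kappa> * (a i * b' j - b i * a' j)) (P'.F m x)) = 0"
      unfolding shift by (simp add: y_def z_def)
    from P'.F_independent[OF x'(1,3) this, of "Suc j"] ij show ?thesis using k0 by simp
  qed
  then consider "\<forall>j<7. a' j = 0 \<and> b' j = 0" | "\<forall>i<7. a i = 0 \<and> b i = 0" |
    k l where "k \<noteq> 0 \<or> l \<noteq> 0" "\<forall>i<7. k * a i = l * b i" "\<forall>j<7. k * a' j = l * b' j"
    using rank_one_cases[of 7 7 a b' b a'] by blast
  then show ?thesis
  proof cases
    case 1
    then show ?thesis by (auto simp: a'_def b'_def intro!: V7I)
  next
    case 2
    then show ?thesis by (auto simp: a_def b_def intro!: V7'I)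
  next
    case (3 k l)
    then have "s k u = s l w"
      by (intro frame_eqI) (auto simp: a_def b_def a'_def b'_def B_simps)
    then show ?thesis using ind 3(1) by blast
  qed
qed

lemma V7_orthogonal: "u \<in> V7 \<Longrightarrow> w \<in> V7' \<Longrightarrow> B u w = 0"
proof -
  assume u: "u \<in> V7" and w: "w \<in> V7'"
  have 1: "B (e i) w = 0" if "i < 7" for i
    using w by (induction rule: V.span_induct_alt) (use that in \<open>auto simp: B_simps Bee\<close>)
  show ?thesis
    using u by (induction rule: V.span_induct_alt) (auto simp: B_simps 1)
qed

lemma V7_decomposition: "orthogonal_decomposition s q V7 V7'"
  unfolding orthogonal_decomposition_def
proof (intro conjI allI ballI)
  show "V7 \<inter> V7' = {0}"
  proof -
    have "u = 0" if "u \<in> V7" "u \<in> V7'" for u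
    proof (rule frame_eqI)
      show "i < 7 \<Longrightarrow> B (e i) u = B (e i) 0" for i
        using V7_orthogonal[of "e i" u] that by (simp add: V.span_base)
      show "i < 7 \<Longrightarrow> B (e' i) u = B (e' i) 0" for i
        using V7_orthogonal[of u "e' i"] that by (simp add: V.span_base B_sym)
    qed
    then show ?thesis by (auto intro: V.span_zero)
  qed
  fix v
  show "\<exists>w\<in>V7. \<exists>w'\<in>V7'. v = w + w'"
    by (rule bexI, rule bexI, rule frame_expand) (rule V7_part V7'_part)+
qed (auto simp: V7_orthogonal)

lemma V7_dim: "V.dim V7 = 7" "V.dim V7' = 7"
  using orthonormal_dim[OF on7] orthonormal_dim[OF on7'] by simp_all

lemma V7_neq: "V7 \<noteq> V7'"
proof
  assume "V7 = V7'"
  moreover have "e 0 \<in> V7" by (intro V.span_base) auto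
  ultimately show False using V7_orthogonal[of "e 0" "e 0"] by (simp add: Bee)
qed

lemma fin_dim: "finite_dimensional_vector_space s (e ` {..<14})"
  using orthonormal_independent[OF on] sp by unfold_locales auto

lemma dim7_subset_eq:
  assumes "V.subspace K" "V.subspace L" "V.dim K = 7" "V.dim L = 7" "K \<subseteq> L" shows "K = L"
  using finite_dimensional_vector_space.subspace_dim_equal[OF fin_dim, of K L] assms by simp

lemma summands_cover:
  assumes od: "orthogonal_decomposition s q Y Z" and d: "V.dim Y = 7" "V.dim Z = 7"
    and 1: "V7 \<subseteq> Y \<or> V7 \<subseteq> Z" and 2: "V7' \<subseteq> Y \<or> V7' \<subseteq> Z"
  shows "{Y, Z} = {V7, V7'}"
proof -
  have "V.subspace Y" "V.subspace Z" using od by (auto simp: orthogonal_decomposition_def)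
  then have "V7 = Y \<or> V7 = Z" "V7' = Y \<or> V7' = Z"
    using 1 2 d dim7_subset_eq V7_dim V.subspace_span by metis+
  then show ?thesis using V7_neq by auto
qed

lemma proj_stabilizerI: "g \<in> Spin UNIV \<Longrightarrow> \<rho> g x = x \<Longrightarrow> g \<in> proj_stabilizer t \<rho> (Spin UNIV) x"
  by (simp add: proj_stabilizer_def)

lemma null_pair_in_summand:
  assumes pd: "preserved_decomposition s q t \<rho> x Y Z"
    and u: "q u = 0" "q w = 0" "B u w = 0" and x: "E u w x = 0"
    and ind: "\<And>k l. s k u = s l w \<Longrightarrow> k = 0 \<and> l = 0"
    and a: "q a = 1" "B a u = 0" "B a w = 0"
  shows "u \<in> Y \<and> w \<in> Y \<or> u \<in> Z \<and> w \<in> Z"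
proof -
  define T where "T v = v + s (B u v) w - s (B w v) u" for v
  obtain g where g: "g \<in> Spin UNIV" "\<rho> g x = x" "implements g T"
    using unipotent[OF u a x] unfolding T_def[abs_def] by blast
  have od: "orthogonal_decomposition s q Y Z"
    using pd by (simp add: preserved_decomposition_def)
  have Y: "V.subspace Y" and Z: "V.subspace Z" using od by (auto simp: orthogonal_decomposition_def)
  have "spin_image s q g ` {Y, Z} = {Y, Z}"
    using pd proj_stabilizerI[OF g(1,2)] by (simp add: preserved_decomposition_def)
  then have "{T ` Y, T ` Z} = {Y, Z}" by (simp add: spin_image_eq[OF g(1,3)])
  then have "T ` Y = Y \<and> T ` Z = Z \<or> T ` Y = Z \<and> T ` Z = Y" by (simp only: doubleton_eq_iff)
  \<comment> \<open>\<open>T\<close> may exchange the two summands, but applied twice it returns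
    each to itself.\<close>
  then have TTY: "T ` (T ` Y) = Y" and TTZ: "T ` (T ` Z) = Z" by (elim disjE; simp only:)+
  have BB: "B u u = 0" "B w w = 0" "B w u = 0" using u by (simp_all add: B_self B_sym)
  \<comment> \<open>\<open>u\<close> and \<open>w\<close> span a totally isotropic plane, so
    \<open>T - 1\<close> has square zero and \<open>T\<close> applied twice is
    \<open>1 + 2 (T - 1)\<close>; halving recovers the bivector.\<close>
  have TT: "T (T v) = v + s 2 (s (B u v) w - s (B w v) u)" for v
  proof -
    have "B u (T v) = B u v" "B w (T v) = B w v" using u BB by (simp_all add: T_def B_simps)
    then have "T (T v) = T v + s (B u v) w - s (B w v) u" by (simp only: T_def[of "T v"])
    also have "\<dots> = v + ((s (B u v) w - s (B w v) u) + (s (B u v) w - s (B w v) u))" by (simp add: T_def)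
    also have "\<dots> = v + s 2 (s (B u v) w - s (B w v) u)"
      using V.scale_left_distrib[of 1 1 "s (B u v) w - s (B w v) u"] by simp
    finally show ?thesis .
  qed
  have N: "s (B u v) w - s (B w v) u \<in> A" if A: "T ` (T ` A) = A" "V.subspace A" "v \<in> A" for A v
  proof -
    have "T (T v) \<in> T ` (T ` A)" using A(3) by (intro imageI)
    then have "v + s 2 (s (B u v) w - s (B w v) u) \<in> A" unfolding A(1) TT .
    then have "s (1/2) (v + s 2 (s (B u v) w - s (B w v) u) - v) \<in> A"
      using A V.subspace_diff V.subspace_scale by blast
    then show ?thesis by simp
  qed
  show ?thesis
  proof (rule wedge_preserves_summand[OF od])
    show "k = 0 \<and> l = 0" if "s k u = s l w" for k l using that by (rule ind)
    show "s (B u v) w - s (B w v) u \<in> Y" if "v \<in> Y" for v using TTY Y that by (rule N)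
    show "s (B u v) w - s (B w v) u \<in> Z" if "v \<in> Z" for v using TTZ Z that by (rule N)
  qed
qed

lemma preserved_unique:
  assumes x: "adapted x" and pd: "preserved_decomposition s q t \<rho> x Y Z"
  shows "{Y, Z} = {V7, V7'}"
proof -
  have x': "P'.g2_spinor x" "P.g2_spinor x" using x by (auto simp: adapted_def)
  have od: "orthogonal_decomposition s q Y Z" and d: "V.dim Y = 7" "V.dim Z = 7"
    using pd by (auto simp: preserved_decomposition_def)
  have Y: "V.subspace Y" and Z: "V.subspace Z" and YZ: "Y \<inter> Z = {0}"
    using od by (auto simp: orthogonal_decomposition_def)
  have "e 0 \<in> V7" "e' 0 \<in> V7'"
    using V.span_base[OF imageI[of 0 "{..<7}" e]] V.span_base[OF imageI[of 0 "{..<7}" e']] by simp_all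
  \<comment> \<open>A unit vector of the opposite half is orthogonal to any pair in the given half
    and supplies the vector \<open>a\<close> for the unipotent element.\<close>
  then have 7: "u \<in> V7 \<Longrightarrow> B (e' 0) u = 0" and 0: "u \<in> V7' \<Longrightarrow> B (e 0) u = 0" for u
    using V7_orthogonal[of u "e' 0"] V7_orthogonal[of "e 0" u] by (simp_all add: B_sym[of "e 7"])
  have "V7 \<subseteq> Y \<or> V7 \<subseteq> Z"
  proof (rule null_pairs_summand[OF on7 UNIV_I x'(2) Y Z YZ])
    fix u w assume "u \<in> V7" "w \<in> V7" and 1: "q u = 0" "q w = 0" "B u w = 0" "E u w x = 0"
      and ind: "\<And>k l. s k u = s l w \<Longrightarrow> k = 0 \<and> l = 0"
    then have "q (e' 0) = 1" "B (e' 0) u = 0" "B (e' 0) w = 0" using 7 by (simp_all add: qe)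
    from null_pair_in_summand[OF pd 1 ind this] show "u \<in> Y \<and> w \<in> Y \<or> u \<in> Z \<and> w \<in> Z" .
  qed
  moreover have "V7' \<subseteq> Y \<or> V7' \<subseteq> Z"
  proof (rule null_pairs_summand[OF on7' UNIV_I x'(1) Y Z YZ])
    fix u w assume "u \<in> V7'" "w \<in> V7'" and 1: "q u = 0" "q w = 0" "B u w = 0" "E u w x = 0"
      and ind: "\<And>k l. s k u = s l w \<Longrightarrow> k = 0 \<and> l = 0"
    then have "q (e 0) = 1" "B (e 0) u = 0" "B (e 0) w = 0" using 0 by (simp_all add: qe)
    from null_pair_in_summand[OF pd 1 ind this] show "u \<in> Y \<and> w \<in> Y \<or> u \<in> Z \<and> w \<in> Z" .
  qed
  ultimately show ?thesis by (rule summands_cover[OF od d])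
qed

end

context half_spin
begin

lemma octonion_op_equivariant:
  assumes "g \<in> Spin UNIV" "implements g T"
  shows "\<rho> g (octonion_op e i z) = octonion_op (T \<circ> e) i (\<rho> g z)"
  using assms by (simp add: octonion_op_def rho_E)

lemma spin_frame_image:
  assumes e: "spin_frame s q t \<rho> e" and T: "isometry T"
  shows "spin_frame s q t \<rho> (T \<circ> e)"
proof -
  interpret F: spin_frame s q t \<rho> e by fact
  have o: "orthonormal (T \<circ> e) 14" using T F.on by (rule isometry_orthonormal)
  have "V.span ((T \<circ> e) ` {..<14}) = UNIV"
  proof (rule finite_dimensional_vector_space.subspace_dim_equal[OF F.fin_dim])
    show "V.dim UNIV \<le> V.dim (V.span ((T \<circ> e) ` {..<14}))"
      using orthonormal_dim[OF o] orthonormal_dim[OF F.on] F.sp by simp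
  qed auto
  then show ?thesis using o by unfold_locales
qed

text \<open>Transport of structure: \<open>g\<close> carries the operators of the frame
  \<open>e\<close> to those of \<open>T \<circ> e\<close>.\<close>

lemma adapted_image:
  assumes e: "spin_frame s q t \<rho> e" and T: "isometry T" and g: "g \<in> Spin UNIV" "implements g T"
    and x: "spin_frame.adapted s q \<rho> e x"
  shows "spin_frame.adapted s q \<rho> (T \<circ> e) (\<rho> g x)"
proof -
  interpret F: spin_frame s q t \<rho> e by fact
  interpret G: spin_frame s q t \<rho> "T \<circ> e" by (rule spin_frame_image[OF e T])
  have x': "x \<noteq> 0" "F.P.g2_spinor x" "F.P'.g2_spinor x" using x by (auto simp: F.adapted_def)
  have eq: "octonion_op (T \<circ> e) i (\<rho> g z) = \<rho> g (octonion_op e i z)" for e i z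
    using octonion_op_equivariant[OF g] by simp
  have eq': "octonion_op (\<lambda>i. (T \<circ> e) (i + 7)) i (\<rho> g z) = \<rho> g (octonion_op (\<lambda>i. e (i + 7)) i z)" for e i z
    using eq[of "\<lambda>i. e (i + 7)" i z] by (simp add: comp_def)
  have "\<rho> g x \<noteq> 0" using Spin_rho_inj[OF g(1), of x 0] Spin_rho_linear[OF g(1)] x'(1)
    by (metis M.scale_zero_left Vector_Spaces.linear_iff)
  then show ?thesis
    using x' unfolding G.adapted_def G.P.g2_spinor_def G.P'.g2_spinor_def F.P.g2_spinor_def F.P'.g2_spinor_def eq eq'
    by simp
qed

end

context spin_frame
begin

lemma adapted_scale: "adapted x \<Longrightarrow> c \<noteq> 0 \<Longrightarrow> adapted (t c x)"
  by (simp add: adapted_def P.g2_spinor_scale P'.g2_spinor_scale)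

text \<open>For \<open>g\<close> in the stabilizer, \<open>x\<close> is adapted to the moved frame
  as well. The null pairs of that frame annihilate \<open>x\<close>, hence lie in \<open>V7\<close>
  or in \<open>V7'\<close>; by dimension the moved halves are the old ones, possibly
  exchanged.\<close>

lemma adapted_preserved:
  assumes x: "adapted x" shows "preserved_decomposition s q t \<rho> x V7 V7'"
  unfolding preserved_decomposition_def
proof (intro conjI ballI V7_decomposition V7_dim)
  fix g assume "g \<in> proj_stabilizer t \<rho> (Spin UNIV) x"
  then have g: "g \<in> Spin UNIV" and gx: "M.span {\<rho> g x} = M.span {x}"
    by (auto simp: proj_stabilizer_def proj_point_def)
  obtain T where T: "isometry T" "implements g T" using Spin_implements[OF g] by blast
  have e: "spin_frame s q t \<rho> e" by unfold_locales
  interpret G: spin_frame s q t \<rho> "T \<circ> e" by (rule spin_frame_image[OF e T(1)])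
  have "x \<in> M.span {\<rho> g x}" unfolding gx by (rule M.span_base) simp
  then obtain c where c: "x = t c (\<rho> g x)" by (auto simp: M.span_singleton)
  have Gx: "G.adapted x"
    using G.adapted_scale[OF adapted_image[OF e T(1) g T(2) x], of c] c x
    by (metis M.scale_zero_left adapted_def)
  have Gx': "G.P'.g2_spinor x" "G.P.g2_spinor x" using Gx by (auto simp: G.adapted_def)
  have YZ: "V7 \<inter> V7' = {0}" using V7_decomposition by (simp add: orthogonal_decomposition_def)
  have "G.V7 \<subseteq> V7 \<or> G.V7 \<subseteq> V7'"
    by (rule null_pairs_summand[OF G.on7 UNIV_I Gx'(2) V.subspace_span V.subspace_span YZ])
       (rule annihilator_split[OF x]; blast)
  moreover have "G.V7' \<subseteq> V7 \<or> G.V7' \<subseteq> V7'"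
    by (rule null_pairs_summand[OF G.on7' UNIV_I Gx'(1) V.subspace_span V.subspace_span YZ])
       (rule annihilator_split[OF x]; blast)
  ultimately have cover: "{V7, V7'} = {G.V7, G.V7'}"
    by (rule G.summands_cover[OF V7_decomposition V7_dim])
  have im: "T ` V7 = G.V7" "T ` V7' = G.V7'"
  proof -
    have "module_hom s s T" using isometry_linear[OF T(1)] by (simp add: module_hom_iff_linear)
    from module_hom.span_image[OF this, of "e ` {..<7}"] module_hom.span_image[OF this, of "e' ` {..<7}"]
    show "T ` V7 = G.V7" "T ` V7' = G.V7'" by (simp_all add: image_image)
  qed
  have "spin_image s q g ` {V7, V7'} = {T ` V7, T ` V7'}"
    by (simp add: spin_image_eq[OF g T(2)])
  also have "\<dots> = {G.V7, G.V7'}" by (simp only: im)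
  finally show "spin_image s q g ` {V7, V7'} = {V7, V7'}" by (simp only: cover)
qed

end

context half_spin
begin

section \<open>Density of the orbit of an adapted spinor\<close>

text \<open>Gram-Schmidt over the complex numbers: a projected vector may be isotropic, so a second
  one is kept in reserve, and normalization uses a complex square root.\<close>

lemma orthonormal_extend:
  assumes e: "orthonormal e n" and sp: "V.span (e ` {..<n}) \<noteq> UNIV"
  shows "\<exists>v. orthonormal (e(n := v)) (Suc n)"
proof -
  define pr where "pr x = x - (\<Sum>i<n. s (B (e i) x / 2) (e i))" for x
  have Bpr: "B (e j) (pr x) = 0" if "j < n" for j x
  proof -
    have "(\<Sum>i<n. B (e i) x / 2 * B (e j) (e i)) = (\<Sum>i<n. if i = j then B (e i) x else 0)"
      by (rule sum.cong) (use e that in \<open>auto simp: orthonormalD\<close>)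
    then show ?thesis using that by (simp add: pr_def B_simps)
  qed
  obtain v where v: "v \<notin> V.span (e ` {..<n})" using sp by blast
  have "pr v \<noteq> 0"
  proof
    assume "pr v = 0"
    then have "v = (\<Sum>i<n. s (B (e i) v / 2) (e i))" by (simp add: pr_def)
    also have "\<dots> \<in> V.span (e ` {..<n})" by (intro V.span_sum V.span_scale V.span_base) auto
    finally show False using v by contradiction
  qed
  then obtain x where x: "B (pr v) x \<noteq> 0" using nondegenerateD by blast
  have "B (pr v) (\<Sum>i<n. s (B (e i) x / 2) (e i)) = 0"
    by (simp add: B_simps B_sym[of "pr v"] Bpr)
  then have px: "B (pr v) (pr x) \<noteq> 0" using x by (simp add: pr_def[of x] B_diffr)
  \<comment> \<open>If both projections are isotropic, \<open>q\<close> of their sum equals their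
    polar value, which is nonzero.\<close>
  have "\<exists>y. q y \<noteq> 0 \<and> (\<forall>j<n. B (e j) y = 0)"
  proof (cases "q (pr v) = 0 \<and> q (pr x) = 0")
    case True
    then show ?thesis using px by (intro exI[of _ "pr v + pr x"]) (simp add: q_add B_addr Bpr)
  next
    case False
    then show ?thesis using Bpr by blast
  qed
  then obtain y where y: "q y \<noteq> 0" "\<And>j. j < n \<Longrightarrow> B (e j) y = 0" by blast
  define c where "c = csqrt (q y)"
  have c: "c\<^sup>2 = q y" "c \<noteq> 0" using y by (auto simp: c_def)
  let ?v = "s (1 / c) y"
  have "q ?v = 1" using c y by (simp add: q_scale power_divide)
  then have "B ?v ?v = 2" by (simp add: B_self)
  moreover have "B (e j) ?v = 0" "B ?v (e j) = 0" if "j < n" for j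
    using y(2)[OF that] by (simp_all add: B_scaler B_scalel B_sym[of y])
  ultimately have "orthonormal (e(n := ?v)) (Suc n)"
    using e by (auto simp: orthonormal_def less_Suc_eq)
  then show ?thesis by blast
qed

lemma spin_frame_exists:
  assumes d: "V.dim UNIV = 14" shows "\<exists>e. spin_frame s q t \<rho> e"
proof -
  have "\<exists>e. orthonormal e n" if "n \<le> 14" for n
    using that
  proof (induction n)
    case 0
    then show ?case by (simp add: orthonormal_def)
  next
    case (Suc n)
    then obtain e where e: "orthonormal e n" by auto
    have "V.span (e ` {..<n}) \<noteq> UNIV" using orthonormal_dim[OF e] d Suc.prems by (metis Suc_n_not_le_n)
    then show ?case using orthonormal_extend[OF e] by blast
  qed
  then obtain e where e: "orthonormal e 14" by blast
  obtain Bs where Bs: "V.independent Bs" "UNIV \<subseteq> V.span Bs" "card Bs = 14"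
    using V.basis_exists[of UNIV] d by metis
  \<comment> \<open>\<open>card\<close> is 0 on infinite sets, so a basis with \<open>card\<close>
    14 is finite.\<close>
  then have "finite Bs" by (metis card.infinite zero_neq_numeral)
  then have "finite_dimensional_vector_space s Bs"
    using Bs by (intro finite_dimensional_vector_space.intro V.vector_space_axioms
      finite_dimensional_vector_space_axioms.intro) auto
  then have "V.span (e ` {..<14}) = UNIV"
    using orthonormal_dim[OF e] d by (intro finite_dimensional_vector_space.subspace_dim_equal) auto
  then show ?thesis using e by (intro exI[of _ e]) unfold_locales
qed

end


section \<open>Polynomial functions and directional derivatives\<close>

lemma polynomial_function_on_line:
  fixes f :: "'b::ab_group_add \<Rightarrow> complex" and sc :: "complex \<Rightarrow> 'b \<Rightarrow> 'b"
  assumes "f \<in> polynomial_functions sc" "vector_space sc"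
  shows "\<exists>p. \<forall>c. f (x + sc c y) = poly p c"
  using assms(1)
proof induction
  case (const c)
  show ?case by (rule exI[of _ "[:c:]"]) simp
next
  case (linear f)
  then show ?case by (intro exI[of _ "[:f x, f y:]"]) (simp add: Vector_Spaces.linear_iff)
next
  case (add f g)
  then show ?case by (metis poly_add)
next
  case (mult f g)
  then show ?case by (metis poly_mult)
qed

text \<open>\<open>f' y\<close> is the derivative in direction \<open>y\<close>. Being polynomial
  again, it can be differentiated further; being linear in \<open>y\<close>, it need only be tested
  on spanning directions.\<close>

lemma polynomial_function_derivative:
  fixes f :: "'b::ab_group_add \<Rightarrow> complex" and sc :: "complex \<Rightarrow> 'b \<Rightarrow> 'b"
  assumes "f \<in> polynomial_functions sc" and vs: "vector_space sc"
  shows "\<exists>f'. (\<forall>y. f' y \<in> polynomial_functions sc) \<and> (\<forall>x. Vector_Spaces.linear sc (*) (\<lambda>y. f' y x)) \<and>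
    (\<forall>x y. ((\<lambda>c. f (x + sc c y)) has_field_derivative f' y x) (at 0))"
  using assms(1)
proof induction
  case (const c)
  have "vector_space ((*) :: complex \<Rightarrow> complex \<Rightarrow> complex)" by unfold_locales (simp_all add: algebra_simps)
  then show ?case
    using vs by (intro exI[of _ "\<lambda>y x. 0"]) (auto intro: polynomial_functions.const simp: Vector_Spaces.linear_iff)
next
  case (linear f)
  interpret T: vector_space sc by fact
  have "((\<lambda>c. f (x + sc c y)) has_field_derivative f y) (at 0)" for x y
    using linear by (auto simp: Vector_Spaces.linear_iff intro!: derivative_eq_intros)
  then show ?case
    using linear by (intro exI[of _ "\<lambda>y x. f y"]) (auto intro: polynomial_functions.const)
next
  case (add f g)
  then obtain f' g' where
    f': "\<And>y. f' y \<in> polynomial_functions sc" "\<And>x. Vector_Spaces.linear sc (*) (\<lambda>y. f' y x)"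
      "\<And>x y. ((\<lambda>c. f (x + sc c y)) has_field_derivative f' y x) (at 0)"
    and g': "\<And>y. g' y \<in> polynomial_functions sc" "\<And>x. Vector_Spaces.linear sc (*) (\<lambda>y. g' y x)"
      "\<And>x y. ((\<lambda>c. g (x + sc c y)) has_field_derivative g' y x) (at 0)"
    by blast
  show ?case
    using f' g' by (intro exI[of _ "\<lambda>y x. f' y x + g' y x"])
      (auto intro!: polynomial_functions.add derivative_intros simp: Vector_Spaces.linear_iff algebra_simps)
next
  case (mult f g)
  interpret T: vector_space sc by fact
  obtain f' g' where
    f': "\<And>y. f' y \<in> polynomial_functions sc" "\<And>x. Vector_Spaces.linear sc (*) (\<lambda>y. f' y x)"
      "\<And>x y. ((\<lambda>c. f (x + sc c y)) has_field_derivative f' y x) (at 0)"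
    and g': "\<And>y. g' y \<in> polynomial_functions sc" "\<And>x. Vector_Spaces.linear sc (*) (\<lambda>y. g' y x)"
      "\<And>x y. ((\<lambda>c. g (x + sc c y)) has_field_derivative g' y x) (at 0)"
    using mult.IH by blast
  have "((\<lambda>c. f (x + sc c y) * g (x + sc c y)) has_field_derivative f x * g' y x + f' y x * g x) (at 0)" for x y
    using DERIV_mult[OF f'(3)[of x y] g'(3)[of x y]] by (simp add: algebra_simps)
  then show ?case
    using f' g' mult.hyps by (intro exI[of _ "\<lambda>y x. f x * g' y x + f' y x * g x"])
      (auto intro!: polynomial_functions.add polynomial_functions.mult simp: Vector_Spaces.linear_iff algebra_simps)
qed

context spin_frame
begin

text \<open>The point \<open>x\<close> is hit by \<open>u = v = e 0\<close>, so this says that the line through \<open>x\<close> and the tangent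
  space of the orbit of \<open>x\<close> together span the whole space.\<close>

lemma tangent_space:
  assumes x: "adapted x" and U: "M.subspace U"
    and E: "\<And>i j. i < 14 \<Longrightarrow> j < 14 \<Longrightarrow> E (e i) (e j) x \<in> U"
  shows "U = UNIV"
proof -
  have x': "P'.g2_spinor x" "P.g2_spinor x" using x by (auto simp: adapted_def)
  obtain \<kappa> where k0: "\<kappa> \<noteq> 0" and k: "\<And>i j z. i < 7 \<Longrightarrow> j < 7 \<Longrightarrow> E (e i) (e' j) z = t \<kappa> (f i (f' j z))"
    using mixed by blast
  have xU: "x \<in> U" using E[of 0 0] by (simp add: E_self qe)
  have ff: "f i (f j x) \<in> U" if "i < 7" "j < 7" for i j
    using E[of i j] that M.subspace_neg[OF U, of "E (e i) (e j) x"] by (simp add: E_f)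
  have ff': "f' i (f' j x) \<in> U" if "i < 7" "j < 7" for i j
    using E[of "i + 7" "j + 7"] that M.subspace_neg[OF U, of "E (e' i) (e' j) x"] by (simp add: E_f')
  have neg: "- z \<in> U \<Longrightarrow> z \<in> U" for z using M.subspace_neg[OF U, of "- z"] by simp
  have "\<forall>i<7. f i x \<in> U"
    unfolding all_less_7
    using ff[of 0 1] ff[of 1 2] ff[of 2 3] ff[of 3 4] ff[of 4 5] ff[of 5 6] ff[of 0 6] neg[of "f 2 x"]
    by (simp add: P.g2_spinorD[OF x'(2)])
  then have f: "f i x \<in> U" if "i < 7" for i using that by blast
  have "\<forall>i<7. f' i x \<in> U"
    unfolding all_less_7
    using ff'[of 0 1] ff'[of 1 2] ff'[of 2 3] ff'[of 3 4] ff'[of 4 5] ff'[of 5 6] ff'[of 0 6] neg[of "f' 2 x"]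
    by (simp add: P'.g2_spinorD[OF x'(1)])
  then have f': "f' i x \<in> U" if "i < 7" for i using that by blast
  have mix: "f i (f' j x) \<in> U" if "i < 7" "j < 7" for i j
    using E[of i "j + 7"] that M.subspace_scale[OF U, of "E (e i) (e' j) x" "1 / \<kappa>"] k0 by (simp add: k)
  have "P.F a (P'.F b x) \<in> U" if "a < 8" "b < 8" for a b
    using that xU f f' mix by (auto simp: P.F_def P'.F_def)
  then have "P.F a (\<Sum>b<8. t (c a b) (P'.F b x)) \<in> U" if "a < 8" for a c
    unfolding P.F_sum[OF that]
    by (intro M.subspace_sum[OF U]) (simp add: P.F_scale that M.subspace_scale[OF U])
  then have sU: "(\<Sum>a<8. P.F a (\<Sum>b<8. t (c a b) (P'.F b x))) \<in> U" for c
    by (intro M.subspace_sum[OF U]) simp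
  have "z \<in> U" for z
  proof -
    obtain c where "z = (\<Sum>a<8. P.F a (\<Sum>b<8. t (c a b) (P'.F b x)))" using adapted_span[OF x, of z] by blast
    then show ?thesis using sU[of c] by (simp only:)
  qed
  then show ?thesis by blast
qed

text \<open>For a unit vector \<open>u\<close> the line \<open>z + r E u v z = E u (u + r v) z\<close> through a point \<open>z\<close> of the cone stays
  in the cone as long as \<open>q (u + r v) \<noteq> 0\<close>, so \<open>f\<close> has zero derivative at \<open>z\<close> in all directions \<open>E u v z\<close>.\<close>

lemma derivative_vanishes_on_cone:
  fixes f :: "'b \<Rightarrow> complex"
  assumes x: "adapted x"
    and van: "\<And>c g. c \<noteq> 0 \<Longrightarrow> g \<in> Spin UNIV \<Longrightarrow> f (t c (\<rho> g x)) = 0"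
    and Df: "\<And>x. Vector_Spaces.linear t (*) (\<lambda>y. Df y x)"
      "\<And>x y. ((\<lambda>c. f (x + t c y)) has_field_derivative Df y x) (at 0)"
    and c: "c \<noteq> 0" and g: "g \<in> Spin UNIV"
  shows "Df y (t c (\<rho> g x)) = 0"
proof -
  define z where "z = t c (\<rho> g x)"
  obtain T where T: "isometry T" "implements g T" using Spin_implements[OF g] by blast
  have gl: "\<rho> g (y + y') = \<rho> g y + \<rho> g y'" "\<rho> g (t k y) = t k (\<rho> g y)" for y y' k
    using Spin_rho_linear[OF g] by (simp_all add: Vector_Spaces.linear_iff)
  have fl: "Df (y + y') z = Df y z + Df y' z" "Df (t k y) z = k * Df y z" for y y' k
    using Df(1)[of z] by (simp_all add: Vector_Spaces.linear_iff)
  have EE: "Df (E (T (e i)) (T (e j)) z) z = 0" if ij: "i < 14" "j < 14" for i j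
  proof -
    define u v where "u = T (e i)" and "v = T (e j)"
    have qu: "q u = 1" using ij T(1) by (simp add: u_def isometry_q qe)
    have in_cone: "f (z + t r (E u v z)) = 0" if r: "q (u + s r v) \<noteq> 0" for r
    proof -
      define k where "k = csqrt (q (u + s r v))"
      have k: "k\<^sup>2 = q (u + s r v)" "k \<noteq> 0" using r by (auto simp: k_def)
      define w where "w = s (1 / k) (u + s r v)"
      have "q w = 1" using k r by (simp add: w_def q_scale power_divide)
      then have G: "vec u \<otimes>\<^bsub>R\<^esub> vec w \<in> Spin UNIV" using qu by (intro Spin_pair) auto
      have "z + t r (E u v z) = E u (u + s r v) z" by (simp add: E_addr E_scaler E_self qu)
      also have "u + s r v = s k w" using k by (simp add: w_def)
      also have "E u (s k w) z = t k (t c (\<rho> (vec u \<otimes>\<^bsub>R\<^esub> vec w) (\<rho> g x)))"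
        by (simp add: E_scaler z_def E_scale) (simp add: E_def)
      also have "\<dots> = t (k * c) (\<rho> (vec u \<otimes>\<^bsub>R\<^esub> vec w \<otimes>\<^bsub>R\<^esub> g) x)"
        by (simp add: Spin_rho_mult[OF G g])
      finally show ?thesis using van[OF _ Spin_mult[OF G g], of "k * c"] k c by simp
    qed
    \<comment> \<open>The value at \<open>r = 0\<close> is 1, so by continuity the line stays in the
      cone for small \<open>r\<close>, where \<open>f\<close> is constantly 0.\<close>
    have qr: "q (u + s r v) = 1 + r\<^sup>2 * q v + r * B u v" for r
      by (simp add: q_add q_scale B_scaler qu)
    have "((\<lambda>r. 1 + r\<^sup>2 * q v + r * B u v) \<longlongrightarrow> 1 + 0\<^sup>2 * q v + 0 * B u v) (at 0)"
      by (intro tendsto_intros)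
    then have "\<forall>\<^sub>F r in at 0. 1 + r\<^sup>2 * q v + r * B u v \<noteq> 0"
      by (intro tendsto_imp_eventually_ne) auto
    then have "\<forall>\<^sub>F r in nhds 0. f (z + t r (E u v z)) = 0"
      unfolding eventually_nhds_conv_at using in_cone[of 0] in_cone qr qu by (auto elim!: eventually_mono)
    then have "((\<lambda>r. f (z + t r (E u v z))) has_field_derivative 0) (at 0) \<longleftrightarrow>
        ((\<lambda>r. 0 :: complex) has_field_derivative 0) (at 0)"
      by (intro DERIV_cong_ev) auto
    then have "((\<lambda>r. f (z + t r (E u v z))) has_field_derivative 0) (at 0)" by simp
    then have "Df (E u v z) z = 0" by (rule DERIV_unique[OF Df(2)[of z "E u v z"]])
    then show ?thesis by (simp only: u_def v_def)
  qed
  \<comment> \<open>Directions are pulled back by \<open>g\<close>, so that the tangent space at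
    \<open>x\<close> itself decides.\<close>
  have U: "M.subspace {y. Df (\<rho> g y) z = 0}"
    by (rule M.subspaceI) (use fl(2)[of 0 0] gl(2)[of 0 0] in \<open>auto simp: gl fl\<close>)
  have "{y. Df (\<rho> g y) z = 0} = UNIV"
  proof (rule tangent_space[OF x U])
    fix i j :: nat assume ij: "i < 14" "j < 14"
    have "E (T (e i)) (T (e j)) z = t c (\<rho> g (E (e i) (e j) x))"
      using rho_E[OF g T(2), of "e i" "e j" x] by (simp add: z_def E_scale)
    then show "E (e i) (e j) x \<in> {y. Df (\<rho> g y) z = 0}" using EE[OF ij] c by (simp add: fl)
  qed
  then have all: "Df (\<rho> g w) z = 0" for w by blast
  obtain h where "h \<in> Spin UNIV" "g \<otimes>\<^bsub>R\<^esub> h = \<one>\<^bsub>R\<^esub>" using Spin_inverse[OF g] by blast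
  then have "\<rho> g (\<rho> h y) = y" using Spin_rho_mult[OF g, of h y] by (simp add: rho_1)
  then show ?thesis using all[of "\<rho> h y"] by (simp add: z_def)
qed

text \<open>Induction over all such \<open>f\<close> at once: a directional derivative is again
  polynomial and vanishes on the cone, and coefficient \<open>n\<close> of \<open>pderiv p\<close>
  is \<open>Suc n\<close> times coefficient \<open>Suc n\<close> of \<open>p\<close>.\<close>

lemma Taylor_coefficients_vanish:
  fixes f :: "'b \<Rightarrow> complex"
  assumes x: "adapted x" and f: "f \<in> polynomial_functions t"
    and van: "\<And>c g. c \<noteq> 0 \<Longrightarrow> g \<in> Spin UNIV \<Longrightarrow> f (t c (\<rho> g x)) = 0"
    and p: "\<And>c. f (x + t c y) = poly p c"
  shows "coeff p n = 0"
  using f van p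
proof (induction n arbitrary: f p)
  case 0
  then have "poly p 0 = f x" by (metis M.scale_zero_left add.right_neutral)
  also have "\<dots> = 0" using 0(2)[OF _ Spin_1, of 1] by (simp add: rho_1)
  finally show ?case by (simp add: poly_0_coeff_0)
next
  case (Suc n)
  obtain Df where Df: "\<And>y. Df y \<in> polynomial_functions t" "\<And>x. Vector_Spaces.linear t (*) (\<lambda>y. Df y x)"
      "\<And>x y. ((\<lambda>c. f (x + t c y)) has_field_derivative Df y x) (at 0)"
    using polynomial_function_derivative[OF Suc.prems(1) M.vector_space_axioms] by blast
  have "Df y (x + t c y) = poly (pderiv p) c" for c
  proof -
    have "f (x + t c y + t r y) = poly p (c + r)" for r
      using Suc.prems(3)[of "c + r"] by (simp add: M.scale_left_distrib add.assoc)
    then have "((\<lambda>r. poly p (c + r)) has_field_derivative Df y (x + t c y)) (at 0)"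
      using Df(3)[of "x + t c y" y] by simp
    moreover have "((\<lambda>r. poly p (c + r)) has_field_derivative poly (pderiv p) c) (at 0)"
      using DERIV_shift[of "poly p" "poly (pderiv p) c" 0 c] poly_DERIV[of p c] by (simp add: add.commute)
    ultimately show ?thesis by (rule DERIV_unique)
  qed
  then have "coeff (pderiv p) n = 0"
    by (intro Suc.IH[of "Df y"] Df(1) derivative_vanishes_on_cone[OF x Suc.prems(2) Df(2,3)]) auto
  then show ?case by (simp add: coeff_pderiv del: of_nat_Suc)
qed

text \<open>Otherwise \<open>f\<close> vanishes on the cone over the orbit, by homogeneity. Its
  restriction to the line from \<open>x\<close> to \<open>z\<close> is then the zero polynomial,
  contradicting the value at parameter 1.\<close>

lemma orbit_dense:
  fixes f :: "'b \<Rightarrow> complex"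
  assumes x: "adapted x" and f: "f \<in> homogeneous_polynomials t" and z: "f z \<noteq> 0"
  shows "\<exists>g\<in>Spin UNIV. f (\<rho> g x) \<noteq> 0"
proof (rule ccontr)
  assume "\<not> ?thesis"
  then have 0: "f (\<rho> g x) = 0" if "g \<in> Spin UNIV" for g using that by blast
  obtain d :: nat where Df: "f \<in> polynomial_functions t" "\<And>c z. f (t c z) = c ^ d * f z"
    using f by (auto simp: homogeneous_polynomials_def)
  obtain p where p: "\<And>c. f (x + t c (z - x)) = poly p c"
    using polynomial_function_on_line[OF Df(1) M.vector_space_axioms] by blast
  have "coeff p n = 0" for n
    by (rule Taylor_coefficients_vanish[OF x Df(1) _ p]) (simp add: Df(2) 0)
  then have "p = 0" by (simp add: poly_eq_iff)
  then show False using p[of 1] z by simp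
qed

text \<open>The orbit of an adapted \<open>x\<close> meets the open orbit of \<open>y\<close>, so
  \<open>y\<close> is a multiple of a translate of \<open>x\<close>; the frame is moved by the same
  group element.\<close>

lemma open_orbit_adapted:
  assumes y: "in_open_orbit t \<rho> (Spin UNIV) y"
  shows "\<exists>d. spin_frame s q t \<rho> d \<and> spin_frame.adapted s q \<rho> d y"
proof -
  have e: "spin_frame s q t \<rho> e" by unfold_locales
  obtain x where x: "adapted x" using adapted_exists by blast
  have y0: "y \<noteq> 0" and zo: "zariski_open t (proj_orbit t \<rho> (Spin UNIV) y)"
    using y by (auto simp: in_open_orbit_def)
  obtain Fs where Fs: "Fs \<subseteq> homogeneous_polynomials t"
    and orb: "proj_orbit t \<rho> (Spin UNIV) y = {proj_point t z | z. z \<noteq> 0 \<and> (\<exists>f\<in>Fs. f z \<noteq> 0)}"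
    using zo by (auto simp: zariski_open_def)
  \<comment> \<open>The open orbit contains the point of \<open>y\<close>, which provides a
    polynomial that is somewhere nonzero.\<close>
  have "proj_point t (\<rho> \<one>\<^bsub>R\<^esub> y) \<in> proj_orbit t \<rho> (Spin UNIV) y"
    using Spin_1 by (auto simp: proj_orbit_def)
  then obtain z f where f: "f \<in> Fs" "f z \<noteq> 0" unfolding orb by blast
  then obtain g where g: "g \<in> Spin UNIV" "f (\<rho> g x) \<noteq> 0"
    using orbit_dense[OF x] Fs by blast
  have nz: "\<rho> h w \<noteq> 0" if "h \<in> Spin UNIV" "w \<noteq> 0" for h w
    using that Spin_rho_inj[OF that(1), of w 0] Spin_rho_linear[OF that(1)]
    by (metis M.scale_zero_left Vector_Spaces.linear_iff)
  have "proj_point t (\<rho> g x) \<in> proj_orbit t \<rho> (Spin UNIV) y"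
    unfolding orb using f(1) g nz x by (auto simp: adapted_def)
  then obtain g' where g': "g' \<in> Spin UNIV" and eq: "proj_point t (\<rho> g x) = proj_point t (\<rho> g' y)"
    by (auto simp: proj_orbit_def)
  have "\<rho> g' y \<in> M.span {\<rho> g x}" using eq by (simp add: proj_point_def M.span_base)
  then obtain c where c: "\<rho> g' y = t c (\<rho> g x)" by (auto simp: M.span_singleton)
  obtain h where h: "h \<in> Spin UNIV" "h \<otimes>\<^bsub>R\<^esub> g' = \<one>\<^bsub>R\<^esub>" using Spin_inverse[OF g'] by blast
  have "y = \<rho> h (\<rho> g' y)" using Spin_rho_mult[OF h(1) g', of y] h by (simp add: rho_1)
  also have "\<dots> = t c (\<rho> (h \<otimes>\<^bsub>R\<^esub> g) x)"
    using Spin_rho_linear[OF h(1)] by (simp add: c Spin_rho_mult h(1) g(1) Vector_Spaces.linear_iff)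
  finally have yc: "y = t c (\<rho> (h \<otimes>\<^bsub>R\<^esub> g) x)" .
  have hg: "h \<otimes>\<^bsub>R\<^esub> g \<in> Spin UNIV" using h g Spin_mult by blast
  obtain T where T: "isometry T" "implements (h \<otimes>\<^bsub>R\<^esub> g) T" using Spin_implements[OF hg] by blast
  interpret G: spin_frame s q t \<rho> "T \<circ> e" by (rule spin_frame_image[OF e T(1)])
  have "c \<noteq> 0" using yc y0 by auto
  then have "G.adapted y" using G.adapted_scale[OF adapted_image[OF e T(1) hg T(2) x]] yc by simp
  then show ?thesis using G.spin_frame_axioms by blast
qed

end

section \<open>Tensor products\<close>

lemma lookup_free_scale: "Poly_Mapping.lookup (free_scale c f) k = c * Poly_Mapping.lookup f k"
  by (simp add: free_scale_def map.rep_eq when_def)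

lemma vector_space_free_scale: "vector_space (free_scale :: complex \<Rightarrow> ('k \<Rightarrow>\<^sub>0 complex) \<Rightarrow> _)"
  by unfold_locales
    (rule poly_mapping_eqI, simp add: lookup_free_scale lookup_add algebra_simps)+

lemma free_scale_single: "free_scale c (Poly_Mapping.single k d) = Poly_Mapping.single k (c * d)"
  by (rule poly_mapping_eqI) (simp add: lookup_free_scale lookup_single when_def)

interpretation free: vector_space "free_scale :: complex \<Rightarrow> ('k \<Rightarrow>\<^sub>0 complex) \<Rightarrow> _"
  by (rule vector_space_free_scale)

lemma free_sum_singles:
  fixes f :: "'k \<Rightarrow>\<^sub>0 complex"
  shows "f = (\<Sum>k\<in>Poly_Mapping.keys f. free_scale (Poly_Mapping.lookup f k) (Poly_Mapping.single k 1))"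
proof (rule poly_mapping_eqI)
  fix k
  have "(\<Sum>k'\<in>Poly_Mapping.keys f. Poly_Mapping.lookup f k' * (1 when k' = k)) = (\<Sum>k'\<in>Poly_Mapping.keys f. if k' = k then Poly_Mapping.lookup f k' else 0)"
    by (rule sum.cong) (auto simp: when_def)
  also have "\<dots> = Poly_Mapping.lookup f k" by (simp add: in_keys_iff)
  finally show "Poly_Mapping.lookup f k = Poly_Mapping.lookup (\<Sum>k\<in>Poly_Mapping.keys f. free_scale (Poly_Mapping.lookup f k) (Poly_Mapping.single k 1)) k"
    by (simp add: lookup_sum lookup_free_scale lookup_single)
qed

lemma subspace_tensor_relations: "Modules.module.subspace free_scale (tensor_relations ta tb)"
  unfolding tensor_relations_def by (rule free.subspace_span)

lemma tensor_class_eq_iff: "tensor_class ta tb f = tensor_class ta tb g \<longleftrightarrow> f - g \<in> tensor_relations ta tb"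
proof
  note S = subspace_tensor_relations[of ta tb]
  assume "tensor_class ta tb f = tensor_class ta tb g"
  moreover have "f \<in> tensor_class ta tb f" using free.subspace_0[OF S] by (simp add: tensor_class_def)
  ultimately show "f - g \<in> tensor_relations ta tb" by (simp add: tensor_class_def)
next
  note S = subspace_tensor_relations[of ta tb]
  assume fg: "f - g \<in> tensor_relations ta tb"
  have "h - f \<in> tensor_relations ta tb \<longleftrightarrow> h - g \<in> tensor_relations ta tb" for h
    using free.subspace_add[OF S, of "h - f" "f - g"] free.subspace_diff[OF S, of "h - g" "f - g"] fg by auto
  then show "tensor_class ta tb f = tensor_class ta tb g" by (simp add: tensor_class_def)
qed

lemma tensor_relationsI:
  "Poly_Mapping.single (x + x', y) 1 - (Poly_Mapping.single (x, y) 1 + Poly_Mapping.single (x', y) 1) \<in> tensor_relations ta tb"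
  "Poly_Mapping.single (x, y + y') 1 - (Poly_Mapping.single (x, y) 1 + Poly_Mapping.single (x, y') 1) \<in> tensor_relations ta tb"
  "Poly_Mapping.single (ta c x, y) 1 - Poly_Mapping.single (x, y) c \<in> tensor_relations ta tb"
  "Poly_Mapping.single (x, tb c y) 1 - Poly_Mapping.single (x, y) c \<in> tensor_relations ta tb"
  unfolding tensor_relations_def by (rule free.span_base, blast)+

context
  fixes ta :: "complex \<Rightarrow> 'a::ab_group_add \<Rightarrow> 'a" and tb :: "complex \<Rightarrow> 'b::ab_group_add \<Rightarrow> 'b"
  assumes va: "vector_space ta" and vb: "vector_space tb"
begin

lemma tensor_sum_left:
  "Poly_Mapping.single (\<Sum>a\<in>A. ta (c a) (x a), y) 1
    - (\<Sum>a\<in>A. free_scale (c a) (Poly_Mapping.single (x a, y) 1)) \<in> tensor_relations ta tb" if "finite A"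
  using that
proof (induction A rule: finite_induct)
  interpret a: vector_space ta by (rule va)
  case empty
  show ?case using tensor_relationsI(3)[of ta 0 0 y tb] by simp
next
  case (insert a A)
  note S = subspace_tensor_relations[of ta tb]
  have "Poly_Mapping.single (ta (c a) (x a), y) 1 - free_scale (c a) (Poly_Mapping.single (x a, y) 1) \<in> tensor_relations ta tb"
    using tensor_relationsI(3)[of ta "c a" "x a" y tb] by (simp add: free_scale_single)
  from free.subspace_add[OF S free.subspace_add[OF S this insert.IH]
    tensor_relationsI(1)[of "ta (c a) (x a)" "\<Sum>a\<in>A. ta (c a) (x a)" y ta tb]]
  show ?case using insert.hyps by (simp add: algebra_simps)
qed

lemma tensor_sum_right:
  "Poly_Mapping.single (x, \<Sum>a\<in>A. tb (c a) (y a)) 1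
    - (\<Sum>a\<in>A. free_scale (c a) (Poly_Mapping.single (x, y a) 1)) \<in> tensor_relations ta tb" if "finite A"
  using that
proof (induction A rule: finite_induct)
  interpret a: vector_space tb by (rule vb)
  case empty
  show ?case using tensor_relationsI(4)[of x tb 0 0 ta] by simp
next
  case (insert a A)
  note S = subspace_tensor_relations[of ta tb]
  have "Poly_Mapping.single (x, tb (c a) (y a)) 1 - free_scale (c a) (Poly_Mapping.single (x, y a) 1) \<in> tensor_relations ta tb"
    using tensor_relationsI(4)[of x tb "c a" "y a" ta] by (simp add: free_scale_single)
  from free.subspace_add[OF S free.subspace_add[OF S this insert.IH]
    tensor_relationsI(2)[of x "tb (c a) (y a)" "\<Sum>a\<in>A. tb (c a) (y a)" ta tb]]
  show ?case using insert.hyps by (simp add: algebra_simps)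
qed

text \<open>The elements congruent to such a combination form a subspace, and bilinearity modulo the
  relations puts every generator into it.\<close>

lemma tensor_normal_form:
  fixes ba :: "nat \<Rightarrow> 'a" and bb :: "nat \<Rightarrow> 'b"
  assumes ba: "\<And>x. \<exists>c. x = (\<Sum>a<n. ta (c a) (ba a))" and bb: "\<And>y. \<exists>c. y = (\<Sum>b<m. tb (c b) (bb b))"
  shows "\<exists>c. f - (\<Sum>a<n. \<Sum>b<m. free_scale (c a b) (Poly_Mapping.single (ba a, bb b) 1)) \<in> tensor_relations ta tb"
proof -
  note S = subspace_tensor_relations[of ta tb]
  let ?z = "\<lambda>c. \<Sum>a<n. \<Sum>b<m. free_scale (c a b) (Poly_Mapping.single (ba a, bb b) (1::complex))"
  let ?N = "{f. \<exists>c. f - ?z c \<in> tensor_relations ta tb}"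
  have zadd: "?z (\<lambda>a b. c a b + d a b) = ?z c + ?z d" for c d
    by (simp add: free.scale_left_distrib sum.distrib)
  have zsc: "?z (\<lambda>a b. k * c a b) = free_scale k (?z c)" for k c
    by (simp add: free.scale_sum_right)
  have N: "free.subspace ?N"
  proof (rule free.subspaceI)
    show "0 \<in> ?N" using free.subspace_0[OF S] by (intro CollectI exI[of _ "\<lambda>_ _. 0"]) simp
  next
    fix f g assume "f \<in> ?N" "g \<in> ?N"
    then obtain c d where "f - ?z c \<in> tensor_relations ta tb" "g - ?z d \<in> tensor_relations ta tb" by blast
    from free.subspace_add[OF S this] have "(f + g) - ?z (\<lambda>a b. c a b + d a b) \<in> tensor_relations ta tb"
      unfolding zadd by (simp add: algebra_simps)
    then show "f + g \<in> ?N" by (intro CollectI exI)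
  next
    fix k f assume "f \<in> ?N"
    then obtain c where "f - ?z c \<in> tensor_relations ta tb" by blast
    from free.subspace_scale[OF S this, of k] have "free_scale k f - ?z (\<lambda>a b. k * c a b) \<in> tensor_relations ta tb"
      unfolding zsc by (simp add: free.scale_right_diff_distrib)
    then show "free_scale k f \<in> ?N" by (intro CollectI exI)
  qed
  have "Poly_Mapping.single (x, y) 1 \<in> ?N" for x y
  proof -
    obtain c where c: "x = (\<Sum>a<n. ta (c a) (ba a))" using ba by blast
    obtain d where d: "y = (\<Sum>b<m. tb (d b) (bb b))" using bb by blast
    have "Poly_Mapping.single (ba a, y) 1 - (\<Sum>b<m. free_scale (d b) (Poly_Mapping.single (ba a, bb b) 1)) \<in> tensor_relations ta tb" for a
      unfolding d by (rule tensor_sum_right) simp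
    then have "(\<Sum>a<n. free_scale (c a) (Poly_Mapping.single (ba a, y) 1 - (\<Sum>b<m. free_scale (d b) (Poly_Mapping.single (ba a, bb b) 1)))) \<in> tensor_relations ta tb"
      by (intro free.subspace_sum[OF S] free.subspace_scale[OF S])
    moreover have "Poly_Mapping.single (x, y) 1 - (\<Sum>a<n. free_scale (c a) (Poly_Mapping.single (ba a, y) 1)) \<in> tensor_relations ta tb"
      unfolding c by (rule tensor_sum_left) simp
    ultimately have "(Poly_Mapping.single (x, y) 1 - (\<Sum>a<n. free_scale (c a) (Poly_Mapping.single (ba a, y) 1)))
        + (\<Sum>a<n. free_scale (c a) (Poly_Mapping.single (ba a, y) 1 - (\<Sum>b<m. free_scale (d b) (Poly_Mapping.single (ba a, bb b) 1)))) \<in> tensor_relations ta tb"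
      using free.subspace_add[OF S] by blast
    also have "(Poly_Mapping.single (x, y) 1 - (\<Sum>a<n. free_scale (c a) (Poly_Mapping.single (ba a, y) 1)))
        + (\<Sum>a<n. free_scale (c a) (Poly_Mapping.single (ba a, y) 1 - (\<Sum>b<m. free_scale (d b) (Poly_Mapping.single (ba a, bb b) 1))))
        = Poly_Mapping.single (x, y) 1 - ?z (\<lambda>a b. c a * d b)"
      by (simp add: free.scale_right_diff_distrib sum_subtractf free.scale_sum_right)
    finally show ?thesis by (intro CollectI exI)
  qed
  then have "Poly_Mapping.single k 1 \<in> ?N" for k by (cases k) (simp only:)
  then have "(\<Sum>k\<in>Poly_Mapping.keys f. free_scale (Poly_Mapping.lookup f k) (Poly_Mapping.single k 1)) \<in> ?N"
    by (intro free.subspace_sum[OF N] free.subspace_scale[OF N])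
  then have "f \<in> ?N" by (subst free_sum_singles[of f])
  then show ?thesis by (simp only: mem_Collect_eq)
qed

text \<open>The universal property with a criterion for isomorphism: \<open>L\<close> extends
  \<beta> linearly and kills the relations. Normal forms and \<open>ind\<close> give injectivity,
  and \<open>sp\<close> gives surjectivity.\<close>

lemma tensor_lift:
  fixes t :: "complex \<Rightarrow> 's::ab_group_add \<Rightarrow> 's" and \<beta> :: "'a \<Rightarrow> 'b \<Rightarrow> 's"
    and ba :: "nat \<Rightarrow> 'a" and bb :: "nat \<Rightarrow> 'b"
  assumes vt: "vector_space t"
    and bl: "\<And>y. Vector_Spaces.linear ta t (\<lambda>x. \<beta> x y)" "\<And>x. Vector_Spaces.linear tb t (\<beta> x)"
    and ba: "\<And>x. \<exists>c. x = (\<Sum>a<n. ta (c a) (ba a))" and bb: "\<And>y. \<exists>c. y = (\<Sum>b<m. tb (c b) (bb b))"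
    and sp: "\<And>z. \<exists>c. z = (\<Sum>a<n. \<Sum>b<m. t (c a b) (\<beta> (ba a) (bb b)))"
    and ind: "\<And>c a b. (\<Sum>a<n. \<Sum>b<m. t (c a b) (\<beta> (ba a) (bb b))) = 0 \<Longrightarrow> a < n \<Longrightarrow> b < m \<Longrightarrow> c a b = 0"
  shows "\<exists>\<Phi>. tensor_isomorphism ta tb t \<Phi> \<and> (\<forall>x y. \<Phi> (pure_tensor ta tb x y) = \<beta> x y)"
proof -
  interpret t: vector_space t by (rule vt)
  note S = subspace_tensor_relations[of ta tb]
  define L where "L f = (\<Sum>k\<in>Poly_Mapping.keys f. t (Poly_Mapping.lookup f k) (\<beta> (fst k) (snd k)))" for f :: "'a \<times> 'b \<Rightarrow>\<^sub>0 complex"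
  have Lsup: "L f = (\<Sum>k\<in>K. t (Poly_Mapping.lookup f k) (\<beta> (fst k) (snd k)))" if "finite K" "Poly_Mapping.keys f \<subseteq> K" for f K
    unfolding L_def by (rule sum.mono_neutral_left) (use that in \<open>auto simp: in_keys_iff\<close>)
  have Ladd: "L (f + g) = L f + L g" for f g
  proof -
    let ?K = "Poly_Mapping.keys f \<union> Poly_Mapping.keys g"
    have "L (f + g) = (\<Sum>k\<in>?K. t (Poly_Mapping.lookup (f + g) k) (\<beta> (fst k) (snd k)))"
      using keys_add[of f g] by (intro Lsup) auto
    also have "\<dots> = (\<Sum>k\<in>?K. t (Poly_Mapping.lookup f k) (\<beta> (fst k) (snd k))) + (\<Sum>k\<in>?K. t (Poly_Mapping.lookup g k) (\<beta> (fst k) (snd k)))"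
      by (simp add: lookup_add t.scale_left_distrib sum.distrib)
    finally show ?thesis using Lsup[of ?K f] Lsup[of ?K g] by simp
  qed
  have Lsc: "L (free_scale c f) = t c (L f)" for c f
  proof -
    have "L (free_scale c f) = (\<Sum>k\<in>Poly_Mapping.keys f. t (Poly_Mapping.lookup (free_scale c f) k) (\<beta> (fst k) (snd k)))"
      by (rule Lsup) (auto simp: in_keys_iff lookup_free_scale)
    then show ?thesis by (simp add: lookup_free_scale L_def t.scale_sum_right)
  qed
  have Ldiff: "L (f - g) = L f - L g" for f g
    using Ladd[of f "free_scale (-1) g"] Lsc[of "-1" g] by simp
  have Lsum': "L (sum h A) = (\<Sum>a\<in>A. L (h a))" for h and A :: "nat set"
    by (induction A rule: infinite_finite_induct) (simp_all add: Ladd, simp_all add: L_def)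
  have Lsg: "L (Poly_Mapping.single (x, y) c) = t c (\<beta> x y)" for x y c
    using Lsup[of "{(x, y)}" "Poly_Mapping.single (x, y) c"] by simp
  have Lrel: "L f = 0" if "f \<in> tensor_relations ta tb" for f
    using that unfolding tensor_relations_def
  proof (induction rule: free.span_induct_alt)
    case base
    then show ?case by (simp add: L_def)
  next
    case (step c x y)
    have "L x = 0"
      using step.hyps bl by (auto simp: Ldiff Ladd Lsg Vector_Spaces.linear_iff)
    then show ?case using step by (simp add: Ladd Lsc)
  qed
  \<comment> \<open>A coset is evaluated at a chosen representative; the value is independent of the
    choice because \<open>L\<close> kills the relations.\<close>
  define \<Phi> where "\<Phi> C = L (SOME f. C = tensor_class ta tb f)" for C
  have Phi: "\<Phi> (tensor_class ta tb f) = L f" for f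
  proof -
    have "tensor_class ta tb f = tensor_class ta tb (SOME g. tensor_class ta tb f = tensor_class ta tb g)"
      by (rule someI) (rule refl)
    then have "L (f - (SOME g. tensor_class ta tb f = tensor_class ta tb g)) = 0"
      by (intro Lrel) (simp add: tensor_class_eq_iff)
    then show ?thesis by (simp add: \<Phi>_def Ldiff)
  qed
  have Lz: "L (\<Sum>a<n. \<Sum>b<m. free_scale (c a b) (Poly_Mapping.single (ba a, bb b) 1))
      = (\<Sum>a<n. \<Sum>b<m. t (c a b) (\<beta> (ba a) (bb b)))" for c
    by (simp add: Lsum' Lsc Lsg)
  have "inj_on \<Phi> (range (tensor_class ta tb))"
  proof (rule inj_onI, clarify)
    fix f g assume "\<Phi> (tensor_class ta tb f) = \<Phi> (tensor_class ta tb g)"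
    then have 0: "L (f - g) = 0" by (simp add: Phi Ldiff)
    obtain c where c: "(f - g) - (\<Sum>a<n. \<Sum>b<m. free_scale (c a b) (Poly_Mapping.single (ba a, bb b) 1)) \<in> tensor_relations ta tb"
      using tensor_normal_form[OF ba bb] by blast
    then have "(\<Sum>a<n. \<Sum>b<m. t (c a b) (\<beta> (ba a) (bb b))) = 0"
      using Lrel[OF c] 0 by (simp add: Ldiff Lz)
    then have "(\<Sum>a<n. \<Sum>b<m. free_scale (c a b) (Poly_Mapping.single (ba a, bb b) (1::complex))) = 0"
      using ind by (intro sum.neutral ballI) simp
    then show "tensor_class ta tb f = tensor_class ta tb g" using c by (simp add: tensor_class_eq_iff)
  qed
  moreover have "\<exists>f. z = \<Phi> (tensor_class ta tb f)" for z
  proof -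
    obtain c where "z = (\<Sum>a<n. \<Sum>b<m. t (c a b) (\<beta> (ba a) (bb b)))" using sp by blast
    then show ?thesis unfolding Phi Lz[of c, symmetric] by (rule exI)
  qed
  ultimately have "bij_betw \<Phi> (range (tensor_class ta tb)) UNIV" unfolding bij_betw_def by blast
  then have "tensor_isomorphism ta tb t \<Phi>"
    by (simp add: tensor_isomorphism_def Phi Ladd Lsc)
  moreover have "\<Phi> (pure_tensor ta tb x y) = \<beta> x y" for x y
    by (simp add: pure_tensor_def Phi Lsg)
  ultimately show ?thesis by blast
qed

end

section \<open>The spin module of a seven-dimensional space\<close>

locale spin7 = spin_module s q W t \<rho>
  for s :: "complex \<Rightarrow> 'v::ab_group_add \<Rightarrow> 'v" and q and W
    and t :: "complex \<Rightarrow> 's::ab_group_add \<Rightarrow> 's" and \<rho> +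
  fixes e \<chi>
  assumes on: "orthonormal e 7" and W_span: "W = V.span (e ` {..<7})"
    and g2: "octonion_operators.g2_spinor (octonion_op e) \<chi>" and nz: "\<chi> \<noteq> 0"
begin

lemma eW: "i < 7 \<Longrightarrow> e i \<in> W"
  unfolding W_span by (rule V.span_base) simp

sublocale P: octonion_operators t "octonion_op e" by (rule octonion_operators_octonion_op[OF on eW])

abbreviation f where "f \<equiv> octonion_op e"

lemma E_f: "i < 7 \<Longrightarrow> j < 7 \<Longrightarrow> E (e i) (e j) z = - f i (f j z)"
  using octonion_op_mult[OF on eW] by simp

lemma W_expand: "u \<in> W \<Longrightarrow> u = (\<Sum>i<7. s (B (e i) u / 2) (e i))"
  using orthonormal_expand[OF on] by (simp add: W_span)

lemma F_spanning: "\<exists>c. z = (\<Sum>a<8. t (c a) (P.F a \<chi>))"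
proof -
  note O = P.octonion_span_subspace[OF P.line_of_subspace, of \<chi>]
  have "P.octonion_span (P.line_of \<chi>) = UNIV"
  proof (rule simple_span[OF O W_span])
    show "\<chi> \<in> P.octonion_span (P.line_of \<chi>)"
      by (intro P.octonion_span_superset P.line_of_subspace P.line_of_self)
    fix i j :: nat and z assume "i < 7" "j < 7" "z \<in> P.octonion_span (P.line_of \<chi>)"
    then have "f i (f j z) \<in> P.octonion_span (P.line_of \<chi>)"
      by (intro P.octonion_span_f P.line_of_subspace) (auto intro: P.line_of_g2_spinor[OF g2])
    then show "E (e i) (e j) z \<in> P.octonion_span (P.line_of \<chi>)"
      using \<open>i < 7\<close> \<open>j < 7\<close> by (simp add: E_f M.subspace_neg[OF O])
  qed (rule nz)
  then show ?thesis using P.octonion_span_line_of by blast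
qed

text \<open>Entries at indices 8 and above are unspecified, hence the bound \<open>a < 8\<close> in
  the rules below.\<close>

definition coord :: "'s \<Rightarrow> nat \<Rightarrow> complex" where
  "coord z = (SOME c. z = (\<Sum>a<8. t (c a) (P.F a \<chi>)))"

lemma coord_expand: "z = (\<Sum>a<8. t (coord z a) (P.F a \<chi>))"
  unfolding coord_def using F_spanning by (rule someI_ex)

lemma coord_unique:
  assumes "z = (\<Sum>a<8. t (c a) (P.F a \<chi>))" "a < 8" shows "coord z a = c a"
proof -
  have "(\<Sum>a<8. t (coord z a - c a) (P.F a \<chi>)) = 0"
    using coord_expand[of z] assms(1) by (simp add: M.scale_left_diff_distrib sum_subtractf)
  from P.F_independent[OF g2 nz this assms(2)] show ?thesis by simp
qed

lemma coord_add: "a < 8 \<Longrightarrow> coord (x + y) a = coord x a + coord y a"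
proof (rule coord_unique)
  show "x + y = (\<Sum>a<8. t (coord x a + coord y a) (P.F a \<chi>))"
    unfolding M.scale_left_distrib sum.distrib coord_expand[symmetric] ..
qed

lemma coord_scale: "a < 8 \<Longrightarrow> coord (t k x) a = k * coord x a"
proof (rule coord_unique)
  show "t k x = (\<Sum>a<8. t (k * coord x a) (P.F a \<chi>))"
    unfolding M.scale_scale[symmetric] M.scale_sum_right[symmetric] coord_expand[symmetric] ..
qed

lemma coord_f: "j < 7 \<Longrightarrow> a < 8 \<Longrightarrow> coord (f j x) a = oct_sign j (oct_index j a) * coord x (oct_index j a)"
proof (rule coord_unique)
  assume j: "j < 7"
  show "f j x = (\<Sum>a<8. t (oct_sign j (oct_index j a) * coord x (oct_index j a)) (P.F a \<chi>))"
    unfolding P.f_F_sum[OF g2 j, symmetric] coord_expand[symmetric] ..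
qed

lemma coord_F: "a < 8 \<Longrightarrow> b < 8 \<Longrightarrow> coord (P.F a \<chi>) b = (if a = b then 1 else 0)"
proof (rule coord_unique)
  assume a: "a < 8"
  have "(\<Sum>b<8. t (if a = b then 1 else 0) (P.F b \<chi>)) = (\<Sum>b<8. if a = b then P.F a \<chi> else 0)"
    by (rule sum.cong) auto
  also have "\<dots> = P.F a \<chi>" using a by simp
  finally show "P.F a \<chi> = (\<Sum>b<8. t (if a = b then 1 else 0) (P.F b \<chi>))" by simp
qed

text \<open>The form for which the eight vectors \<open>P.F a \<chi>\<close> are
  orthonormal.\<close>

definition bil :: "'s \<Rightarrow> 's \<Rightarrow> complex" where
  "bil x y = (\<Sum>a<8. coord x a * coord y a)"

lemma bil_add: "bil (x + y) z = bil x z + bil y z" "bil z (x + y) = bil z x + bil z y"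
  and bil_scale: "bil (t k x) z = k * bil x z" "bil z (t k x) = k * bil z x"
  by (simp_all add: bil_def coord_add coord_scale sum.distrib algebra_simps sum_distrib_left)

lemma bil_sym: "bil x y = bil y x"
  by (simp add: bil_def mult.commute)

lemma bil_minus: "bil (- x) z = - bil x z" "bil z (- x) = - bil z x"
  using bil_scale(1)[of "-1" x z] bil_scale(2)[of z "-1" x] by simp_all

lemma bil_0: "bil 0 z = 0" "bil z 0 = 0"
  using bil_scale(1)[of 0 0 z] bil_scale(2)[of z 0 0] by simp_all

lemma bil_sum: "bil (sum g A) z = (\<Sum>a\<in>A. bil (g a) z)" "bil z (sum g A) = (\<Sum>a\<in>A. bil z (g a))"
  by (induction A rule: infinite_finite_induct) (simp_all add: bil_0 bil_add)

text \<open>Each \<open>f j\<close> permutes the orthonormal basis up to sign.\<close>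

lemma bil_f_f: "j < 7 \<Longrightarrow> bil (f j x) (f j y) = bil x y"
proof -
  assume j: "j < 7"
  have "bil (f j x) (f j y) = (\<Sum>a<8. coord x (oct_index j a) * coord y (oct_index j a))"
    unfolding bil_def
  proof (rule sum.cong)
    fix a assume "a \<in> {..<8::nat}"
    then have "coord (f j x) a * coord (f j y) a = (oct_sign j (oct_index j a) * oct_sign j (oct_index j a)) *
        (coord x (oct_index j a) * coord y (oct_index j a))"
      using j by (simp add: coord_f)
    then show "coord (f j x) a * coord (f j y) a = coord x (oct_index j a) * coord y (oct_index j a)" by simp
  qed simp
  also have "\<dots> = bil x y"
    unfolding bil_def
    by (rule sum.reindex_bij_witness[of _ "oct_index j" "oct_index j"])
       (use j in \<open>auto simp: oct_index_involution oct_index_less\<close>)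
  finally show ?thesis .
qed

lemma bil_f: "j < 7 \<Longrightarrow> bil (f j x) y = - bil x (f j y)"
  using bil_f_f[of j x "f j y"] by (simp add: P.sq bil_minus minus_equation_iff[of "bil (f j x) y"])

text \<open>Up to sign this is multiplication by \<open>u\<close> times the volume element, which is
  even because the dimension is odd. It lets unit vectors be treated one at a time in the proof of
  invariance.\<close>

definition clifford_action :: "'v \<Rightarrow> 's \<Rightarrow> 's" where
  "clifford_action u x = (\<Sum>i<7. t (B (e i) u / 2) (f i x))"

lemma clifford_action_twice: "u \<in> W \<Longrightarrow> v \<in> W \<Longrightarrow> clifford_action u (clifford_action v x) = - E u v x"
proof -
  assume u: "u \<in> W" and v: "v \<in> W"
  have "E u v x = (\<Sum>i<7. \<Sum>j<7. t (B (e i) u / 2 * (B (e j) v / 2)) (E (e i) (e j) x))"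
    by (subst W_expand[OF u], subst W_expand[OF v], rule E_sum_sum) (simp_all add: eW)
  also have "\<dots> = - clifford_action u (clifford_action v x)"
    by (simp add: E_f clifford_action_def P.f_sum P.f_scale M.scale_sum_right sum_negf)
  finally show ?thesis by simp
qed

lemma bil_clifford_action: "bil (clifford_action u x) y = - bil x (clifford_action u y)"
  by (simp add: clifford_action_def bil_sum bil_scale bil_f sum_negf)

lemma bil_E:
  assumes "u \<in> W" "v \<in> W" "q u = 1" "q v = 1"
  shows "bil (E u v x) (E u v x) = bil x x"
proof -
  have sq: "clifford_action u (clifford_action u z) = - z" if "u \<in> W" "q u = 1" for u z
    using that by (simp add: clifford_action_twice E_self)
  have isom: "bil (clifford_action u z) (clifford_action u z) = bil z z" if "u \<in> W" "q u = 1" for u z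
    by (simp add: bil_clifford_action sq[OF that] bil_minus)
  have "E u v x = - clifford_action u (clifford_action v x)" using assms by (simp add: clifford_action_twice)
  then show ?thesis using assms by (simp add: bil_minus isom)
qed

lemma bil_Spin: "g \<in> Spin W \<Longrightarrow> bil (\<rho> g x) (\<rho> g x) = bil x x"
proof (induction g arbitrary: x rule: Spin_induct)
  case one
  then show ?case by (simp add: rho_1)
next
  case (pair u v)
  then show ?case using bil_E by (simp add: E_def)
next
  case (mult g h)
  then show ?case by (simp add: Spin_rho_mult)
qed

lemma chi_generic: "off_invariant_quadric t \<rho> (Spin W) \<chi>"
proof -
  define Q where "Q x = bil x x" for x
  have pol: "polar_form Q x y = 2 * bil x y" for x y
    by (simp add: polar_form_def Q_def bil_add bil_sym[of y x])
  have "quadratic_form t Q"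
  proof -
    have "vector_space ((*) :: complex \<Rightarrow> complex \<Rightarrow> complex)" by unfold_locales (simp_all add: algebra_simps)
    then show ?thesis
      unfolding quadratic_form_def Vector_Spaces.linear_iff pol
      by (simp add: Q_def bil_add bil_scale power2_eq_square M.vector_space_axioms algebra_simps)
  qed
  moreover have "nondegenerate Q"
    unfolding nondegenerate_def pol
  proof (intro allI impI)
    fix x assume x: "\<forall>y. 2 * bil x y = 0"
    have "coord x a = 0" if a: "a < 8" for a
    proof -
      have "0 = (\<Sum>b<8. coord x b * coord (P.F a \<chi>) b)" using x by (simp add: bil_def)
      also have "\<dots> = (\<Sum>b<8. if a = b then coord x b else 0)"
        by (rule sum.cong) (use a in \<open>auto simp: coord_F\<close>)
      also have "\<dots> = coord x a" using a by simp
      finally show ?thesis by simp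
    qed
    then show "x = 0" by (subst coord_expand) simp
  qed
  moreover have "Q \<chi> \<noteq> 0"
  proof -
    \<comment> \<open>\<chi> is the basis vector of index 0, so its value is 1.\<close>
    have "Q \<chi> = (\<Sum>a<(8::nat). if a = 0 then 1 else 0)"
      unfolding Q_def bil_def using coord_F[of 0] by (intro sum.cong) auto
    then show ?thesis by simp
  qed
  ultimately show ?thesis unfolding off_invariant_quadric_def using bil_Spin Q_def by auto
qed

end

lemma (in spin_module) spin7_exists:
  assumes on: "orthonormal e 7" and W: "W = V.span (e ` {..<7})"
  shows "\<exists>x. spin7 s q W t \<rho> e x"
proof -
  have eW: "i < 7 \<Longrightarrow> e i \<in> W" for i unfolding W by (rule V.span_base) simp
  interpret P: octonion_operators t "octonion_op e" by (rule octonion_operators_octonion_op[OF on eW])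
  from nontrivial obtain x where "x \<noteq> 0" "P.g2_spinor x"
    using P.g2_spinor_exists[OF M.subspace_UNIV] by auto
  then have "spin7 s q W t \<rho> e x" using on W by unfold_locales
  then show ?thesis by blast
qed

section \<open>Decomposability\<close>

lemma (in quadratic_space) Spin_UNIV: "g \<in> Spin W \<Longrightarrow> g \<in> Spin UNIV"
  by (induction rule: Spin_induct) (auto intro: Spin_1 Spin_pair Spin_mult)

text \<open>One frame of the whole space supplies the frames of both summands, so that the operators
  on the three modules can be compared index by index.\<close>

locale tensor_frame = spin_frame s q t \<rho> e +
  A: spin7 s q "Modules.module.span s (e ` {..<7})" ta \<rho>a e \<chi> +
  A': spin7 s q "Modules.module.span s ((\<lambda>i. e (i + 7)) ` {..<7})" tb \<rho>b "\<lambda>i. e (i + 7)" \<chi>'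
  for s :: "complex \<Rightarrow> 'v::ab_group_add \<Rightarrow> 'v" and q
    and t :: "complex \<Rightarrow> 's::ab_group_add \<Rightarrow> 's" and \<rho> and e
    and ta :: "complex \<Rightarrow> 'a::ab_group_add \<Rightarrow> 'a" and \<rho>a \<chi>
    and tb :: "complex \<Rightarrow> 'b::ab_group_add \<Rightarrow> 'b" and \<rho>b \<chi>' +
  fixes \<psi> assumes psi: "adapted \<psi>"
begin

lemma psi': "P'.g2_spinor \<psi>" "P.g2_spinor \<psi>" "\<psi> \<noteq> 0"
  using psi by (auto simp: adapted_def)

definition right_part :: "'b \<Rightarrow> 's" where
  "right_part y = (\<Sum>b<8. t (A'.coord y b) (P'.F b \<psi>))"

text \<open>The bilinear map matching the basis vectors built from \<chi> and \<chi>' with those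
  built from \<psi>; it is the candidate for the equivariant isomorphism.\<close>

definition pairing :: "'a \<Rightarrow> 'b \<Rightarrow> 's" where
  "pairing x y = (\<Sum>a<8. t (A.coord x a) (P.F a (right_part y)))"

lemma right_part_g2: "P.g2_spinor (right_part y)"
  unfolding right_part_def by (rule F'_sum_g2[OF psi'(2)])

lemma right_part_linear: "right_part (y + y') = right_part y + right_part y'" "right_part (tb k y) = t k (right_part y)"
  by (simp_all add: right_part_def A'.coord_add A'.coord_scale M.scale_left_distrib sum.distrib M.scale_sum_right)

lemma pairing_linear_left: "pairing (x + x') y = pairing x y + pairing x' y" "pairing (ta k x) y = t k (pairing x y)"
  by (simp_all add: pairing_def A.coord_add A.coord_scale M.scale_left_distrib sum.distrib M.scale_sum_right)

lemma pairing_linear_right: "pairing x (y + y') = pairing x y + pairing x y'" "pairing x (tb k y) = t k (pairing x y)"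
  by (simp_all add: pairing_def right_part_linear P.F_add P.F_scale M.scale_right_distrib sum.distrib
      M.scale_sum_right mult.commute)

lemma pairing_minus: "pairing (- x) y = - pairing x y" "pairing x (- y) = - pairing x y"
  using pairing_linear_left(2)[of "-1" x y] pairing_linear_right(2)[of x "-1" y] by simp_all

lemma pairing_0: "pairing 0 y = 0" "pairing x 0 = 0"
  using pairing_linear_left(2)[of 0 0 y] pairing_linear_right(2)[of x 0 0] by simp_all

lemma pairing_sum: "pairing (sum g I) y = (\<Sum>i\<in>I. pairing (g i) y)" "pairing x (sum h I) = (\<Sum>i\<in>I. pairing x (h i))"
  by (induction I rule: infinite_finite_induct) (simp_all add: pairing_0 pairing_linear_left pairing_linear_right)

text \<open>The same octonion table governs both sides: once for \<chi>, once for the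
  \<open>g2_spinor\<close> \<open>right_part y\<close>.\<close>

lemma pairing_f: "j < 7 \<Longrightarrow> pairing (A.f j x) y = f j (pairing x y)"
  unfolding pairing_def P.f_F_sum[OF right_part_g2] by (rule sum.cong) (simp_all add: A.coord_f)

lemma right_part_f: "j < 7 \<Longrightarrow> right_part (A'.f j y) = f' j (right_part y)"
  unfolding right_part_def P'.f_F_sum[OF psi'(1)] by (rule sum.cong) (simp_all add: A'.coord_f)

lemma f'_F: "j < 7 \<Longrightarrow> a < 8 \<Longrightarrow> f' j (P.F a z) = P.F a (f' j z)"
  by (auto simp: P.F_def f_f')

lemma pairing_f': "j < 7 \<Longrightarrow> pairing x (A'.f j y) = f' j (pairing x y)"
  by (simp add: pairing_def right_part_f P'.f_sum P'.f_scale f'_F)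

lemma pairing_E:
  assumes "u \<in> V7" "v \<in> V7" shows "pairing (A.E u v x) y = E u v (pairing x y)"
proof -
  have "A.E u v x = (\<Sum>i<7. \<Sum>j<7. ta (B (e i) u / 2 * (B (e j) v / 2)) (A.E (e i) (e j) x))"
    by (subst A.W_expand[OF assms(1)], subst A.W_expand[OF assms(2)], rule A.E_sum_sum) (simp_all add: A.eW)
  moreover have "E u v z = (\<Sum>i<7. \<Sum>j<7. t (B (e i) u / 2 * (B (e j) v / 2)) (E (e i) (e j) z))" for z
    by (subst A.W_expand[OF assms(1)], subst A.W_expand[OF assms(2)], rule E_sum_sum) simp_all
  moreover have "pairing (A.E (e i) (e j) x) y = E (e i) (e j) (pairing x y)" if "i < 7" "j < 7" for i j
    using that by (simp add: A.E_f E_f pairing_minus pairing_f)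
  ultimately show ?thesis by (simp add: pairing_sum pairing_linear_left)
qed

lemma pairing_E':
  assumes "u \<in> V7'" "v \<in> V7'" shows "pairing x (A'.E u v y) = E u v (pairing x y)"
proof -
  have "A'.E u v y = (\<Sum>i<7. \<Sum>j<7. tb (B (e' i) u / 2 * (B (e' j) v / 2)) (A'.E (e' i) (e' j) y))"
    by (subst A'.W_expand[OF assms(1)], subst A'.W_expand[OF assms(2)], rule A'.E_sum_sum) (simp_all add: A'.eW)
  moreover have "E u v z = (\<Sum>i<7. \<Sum>j<7. t (B (e' i) u / 2 * (B (e' j) v / 2)) (E (e' i) (e' j) z))" for z
    by (subst A'.W_expand[OF assms(1)], subst A'.W_expand[OF assms(2)], rule E_sum_sum) simp_all
  moreover have "pairing x (A'.E (e' i) (e' j) y) = E (e' i) (e' j) (pairing x y)" if "i < 7" "j < 7" for i j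
    using that A'.E_f[OF that] by (simp add: E_f' pairing_minus pairing_f')
  ultimately show ?thesis by (simp add: pairing_sum pairing_linear_right)
qed

lemma pairing_Spin: "g \<in> Spin V7 \<Longrightarrow> pairing (\<rho>a g x) y = \<rho> g (pairing x y)"
proof (induction g arbitrary: x rule: Spin_induct)
  case one
  then show ?case by (simp add: rho_1 A.rho_1)
next
  case (pair u v)
  then show ?case using pairing_E[of u v] by (simp add: E_def A.E_def)
next
  case (mult g h)
  then show ?case by (simp add: A.Spin_rho_mult Spin_rho_mult Spin_UNIV)
qed

lemma pairing_Spin': "g \<in> Spin V7' \<Longrightarrow> pairing x (\<rho>b g y) = \<rho> g (pairing x y)"
proof (induction g arbitrary: y rule: Spin_induct)
  case one
  then show ?case by (simp add: rho_1 A'.rho_1)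
next
  case (pair u v)
  then show ?case using pairing_E'[of u v] by (simp add: E_def A'.E_def)
next
  case (mult g h)
  then show ?case by (simp add: A'.Spin_rho_mult Spin_rho_mult Spin_UNIV)
qed

lemma pairing_F_F: "a < 8 \<Longrightarrow> b < 8 \<Longrightarrow> pairing (A.P.F a \<chi>) (A'.P.F b \<chi>') = P.F a (P'.F b \<psi>)"
proof -
  assume a: "a < 8" and b: "b < 8"
  have "right_part (A'.P.F b \<chi>') = (\<Sum>b'<8. if b = b' then P'.F b \<psi> else 0)"
    unfolding right_part_def by (rule sum.cong) (use b in \<open>auto simp: A'.coord_F\<close>)
  then have 1: "right_part (A'.P.F b \<chi>') = P'.F b \<psi>" using b by simp
  have "pairing (A.P.F a \<chi>) (A'.P.F b \<chi>') = (\<Sum>a'<8. if a = a' then P.F a (P'.F b \<psi>) else 0)"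
    unfolding pairing_def 1 by (rule sum.cong) (use a in \<open>auto simp: A.coord_F\<close>)
  then show ?thesis using a by simp
qed

lemma F_sum_double: "(\<Sum>a<8. P.F a (\<Sum>b<8. t (c a b) (P'.F b \<psi>))) = (\<Sum>a<8. \<Sum>b<8. t (c a b) (P.F a (P'.F b \<psi>)))"
  by (rule sum.cong) (simp_all add: P.F_sum P.F_scale)

text \<open>The 64 products of basis vectors go to the 64 vectors attached to \<psi>, a basis of the
  half-spin module.\<close>

lemma equivariant_iso:
  "\<exists>\<Phi>. equivariant_tensor_isomorphism s q V7 V7' ta \<rho>a tb \<rho>b t \<rho> \<Phi> \<and> (\<forall>x y. \<Phi> (pure_tensor ta tb x y) = pairing x y)"
proof -
  have "\<exists>\<Phi>. tensor_isomorphism ta tb t \<Phi> \<and> (\<forall>x y. \<Phi> (pure_tensor ta tb x y) = pairing x y)"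
  proof (rule tensor_lift[OF A.M.vector_space_axioms A'.M.vector_space_axioms M.vector_space_axioms])
    show "Vector_Spaces.linear ta t (\<lambda>x. pairing x y)" for y
      by (simp add: Vector_Spaces.linear_iff pairing_linear_left A.M.vector_space_axioms M.vector_space_axioms)
    show "Vector_Spaces.linear tb t (pairing x)" for x
      by (simp add: Vector_Spaces.linear_iff pairing_linear_right A'.M.vector_space_axioms M.vector_space_axioms)
    show "\<exists>c. x = (\<Sum>a<8. ta (c a) (A.P.F a \<chi>))" for x by (rule A.F_spanning)
    show "\<exists>c. y = (\<Sum>b<8. tb (c b) (A'.P.F b \<chi>'))" for y by (rule A'.F_spanning)
    show "\<exists>c. z = (\<Sum>a<8. \<Sum>b<8. t (c a b) (pairing (A.P.F a \<chi>) (A'.P.F b \<chi>')))" for z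
      using adapted_span[OF psi, of z] unfolding F_sum_double by (simp add: pairing_F_F)
    show "c a b = 0" if "(\<Sum>a<8. \<Sum>b<8. t (c a b) (pairing (A.P.F a \<chi>) (A'.P.F b \<chi>'))) = 0" "a < 8" "b < 8" for c a b
      using adapted_independent[OF psi, of c a b] that unfolding F_sum_double by (simp add: pairing_F_F)
  qed
  then obtain \<Phi> where \<Phi>: "tensor_isomorphism ta tb t \<Phi>" "\<And>x y. \<Phi> (pure_tensor ta tb x y) = pairing x y"
    by blast
  have "equivariant_tensor_isomorphism s q V7 V7' ta \<rho>a tb \<rho>b t \<rho> \<Phi>"
    unfolding equivariant_tensor_isomorphism_def
  proof (intro conjI ballI allI \<Phi>(1))
    fix g h x y assume g: "g \<in> Spin V7" and h: "h \<in> Spin V7'"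
    have "pairing (\<rho>a g x) (\<rho>b h y) = \<rho> g (\<rho> h (pairing x y))"
      using pairing_Spin[OF g, of x "\<rho>b h y"] pairing_Spin'[OF h, of x y] by (simp only:)
    then show "\<Phi> (pure_tensor ta tb (\<rho>a g x) (\<rho>b h y)) = \<rho> (g \<otimes>\<^bsub>R\<^esub> h) (\<Phi> (pure_tensor ta tb x y))"
      using g h by (simp add: \<Phi>(2) Spin_rho_mult Spin_UNIV)
  qed
  then show ?thesis using \<Phi>(2) by blast
qed

lemma pure_tensor_chi_nonzero: "pure_tensor ta tb \<chi> \<chi>' \<noteq> tensor_class ta tb 0"
proof
  obtain \<Phi> where ti: "tensor_isomorphism ta tb t \<Phi>" and p: "\<And>x y. \<Phi> (pure_tensor ta tb x y) = pairing x y"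
    using equivariant_iso by (auto simp: equivariant_tensor_isomorphism_def)
  assume 0: "pure_tensor ta tb \<chi> \<chi>' = tensor_class ta tb 0"
  have "\<Phi> (tensor_class ta tb (0 + 0)) = \<Phi> (tensor_class ta tb 0) + \<Phi> (tensor_class ta tb 0)"
    using ti unfolding tensor_isomorphism_def by blast
  then have "pairing \<chi> \<chi>' = 0" using p[of \<chi> \<chi>'] 0 by simp
  then show False using pairing_F_F[of 0 0] psi'(3) by simp
qed

text \<open>The operators \<open>f\<close> and \<open>f'\<close> are actions of elements of the two spin groups, so the image of \<open>\<chi> \<otimes> \<chi>'\<close>
  satisfies the same equations as \<open>\<psi>\<close>, which determine \<open>\<psi>\<close> up to a scalar.\<close>

lemma equivariant_iso_chi:
  assumes \<Phi>: "equivariant_tensor_isomorphism s q V7 V7' ta \<rho>a tb \<rho>b t \<rho> \<Phi>"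
  shows "proj_point t \<psi> = proj_point t (\<Phi> (pure_tensor ta tb \<chi> \<chi>'))"
proof -
  have ti: "tensor_isomorphism ta tb t \<Phi>"
    and eq: "\<And>g h x y. g \<in> Spin V7 \<Longrightarrow> h \<in> Spin V7' \<Longrightarrow>
      \<Phi> (pure_tensor ta tb (\<rho>a g x) (\<rho>b h y)) = \<rho> (g \<otimes>\<^bsub>R\<^esub> h) (\<Phi> (pure_tensor ta tb x y))"
    using \<Phi> by (simp_all add: equivariant_tensor_isomorphism_def)
  define p where "p x y = \<Phi> (pure_tensor ta tb x y)" for x y
  have e7: "e i \<in> V7" "e' i \<in> V7'" if "i < 7" for i using A.eW A'.eW that by simp_all
  \<comment> \<open>Products of two frame vectors lie in the spin group, so group equivariance
    covers them and, by composition, the operators \<open>f\<close>; the step \<open>r\<close> does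
    the same for \<open>f'\<close>.\<close>
  have l: "p (A.E (e i) (e j) x) y = E (e i) (e j) (p x y)" if "i < 7" "j < 7" for i j x y
  proof -
    have "vec (e i) \<otimes>\<^bsub>R\<^esub> vec (e j) \<in> Spin V7" using that e7 by (intro Spin_pair) (auto simp: qe)
    from eq[OF this Spin_1, of x y] show ?thesis by (simp add: p_def A'.rho_1 A.E_def E_def)
  qed
  have r: "p x (A'.E (e' i) (e' j) y) = E (e' i) (e' j) (p x y)" if "i < 7" "j < 7" for i j x y
  proof -
    have "vec (e' i) \<otimes>\<^bsub>R\<^esub> vec (e' j) \<in> Spin V7'" using that e7 by (intro Spin_pair) (auto simp: qe)
    from eq[OF Spin_1 this, of x y] show ?thesis by (simp add: p_def A.rho_1 A'.E_def E_def)
  qed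
  have fl: "p (A.f i x) y = f i (p x y)" if "i < 7" for i x y
    using that by (simp add: A.octonion_op_def octonion_op_def l)
  have fr: "p x (A'.f i y) = f' i (p x y)" if "i < 7" for i x y
  proof -
    have n: "(0::nat) < 7" "(1::nat) < 7" "(2::nat) < 7" "(3::nat) < 7" "(4::nat) < 7" "(5::nat) < 7" "(6::nat) < 7"
      by simp_all
    show ?thesis
      unfolding A'.octonion_op_def octonion_op_def
        r[OF that n(1)] r[OF n(3,2)] r[OF n(4,5)] r[OF n(6,7)] ..
  qed
  let ?z = "p \<chi> \<chi>'"
  have "P.g2_spinor ?z"
    unfolding P.g2_spinor_def
  proof (intro allI impI)
    fix k :: nat assume k: "k < 7"
    have "f k (f ((k + 1) mod 7) ?z) = p (A.f k (A.f ((k + 1) mod 7) \<chi>)) \<chi>'" using k by (simp add: fl)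
    also have "A.f k (A.f ((k + 1) mod 7) \<chi>) = A.f ((k + 3) mod 7) \<chi>"
      using A.g2 k unfolding A.P.g2_spinor_def by blast
    also have "p (A.f ((k + 3) mod 7) \<chi>) \<chi>' = f ((k + 3) mod 7) ?z" by (simp add: fl)
    finally show "f k (f ((k + 1) mod 7) ?z) = f ((k + 3) mod 7) ?z" .
  qed
  moreover have "P'.g2_spinor ?z"
    unfolding P'.g2_spinor_def
  proof (intro allI impI)
    fix k :: nat assume k: "k < 7"
    have "f' k (f' ((k + 1) mod 7) ?z) = p \<chi> (A'.f k (A'.f ((k + 1) mod 7) \<chi>'))" using k by (simp add: fr)
    also have "A'.f k (A'.f ((k + 1) mod 7) \<chi>') = A'.f ((k + 3) mod 7) \<chi>'"
      using A'.g2 k unfolding A'.P.g2_spinor_def by blast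
    also have "p \<chi> (A'.f ((k + 3) mod 7) \<chi>') = f' ((k + 3) mod 7) ?z" by (simp add: fr)
    finally show "f' k (f' ((k + 1) mod 7) ?z) = f' ((k + 3) mod 7) ?z" .
  qed
  ultimately obtain c where c: "?z = t c \<psi>" using adapted_unique[OF psi] by blast
  have "?z \<noteq> 0"
  proof
    assume 0: "?z = 0"
    have inj: "inj_on \<Phi> (range (tensor_class ta tb))"
      using ti by (simp add: tensor_isomorphism_def bij_betw_def)
    have "\<Phi> (tensor_class ta tb (0 + 0)) = \<Phi> (tensor_class ta tb 0) + \<Phi> (tensor_class ta tb 0)"
      using ti unfolding tensor_isomorphism_def by blast
    then have "\<Phi> (tensor_class ta tb 0) = 0" by simp
    then have "pure_tensor ta tb \<chi> \<chi>' = tensor_class ta tb 0"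
      using 0 inj_onD[OF inj, of "pure_tensor ta tb \<chi> \<chi>'" "tensor_class ta tb 0"] by (simp add: p_def pure_tensor_def)
    then show False using pure_tensor_chi_nonzero by contradiction
  qed
  then have "c \<noteq> 0" using c by auto
  then have "M.span {\<psi>} = M.span {t c \<psi>}"
    using M.span_image_scale[of "{\<psi>}" "\<lambda>_. c"] by simp
  then show ?thesis using c by (simp add: proj_point_def p_def)
qed

end

section \<open>The tensor statement for both orders of the summands\<close>

context spin_frame
begin

lemma decomposable:
  fixes ta :: "complex \<Rightarrow> 'x::ab_group_add \<Rightarrow> 'x" and tb :: "complex \<Rightarrow> 'y::ab_group_add \<Rightarrow> 'y"
  assumes x: "adapted x" and a: "spin_representation s q V7 ta \<rho>a" and b: "spin_representation s q V7' tb \<rho>b"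
  shows "(\<exists>\<Phi>. equivariant_tensor_isomorphism s q V7 V7' ta \<rho>a tb \<rho>b t \<rho> \<Phi>) \<and>
    (\<forall>\<Phi>. equivariant_tensor_isomorphism s q V7 V7' ta \<rho>a tb \<rho>b t \<rho> \<Phi> \<longrightarrow>
      (\<exists>z z'. off_invariant_quadric ta \<rho>a (Spin V7) z \<and> off_invariant_quadric tb \<rho>b (Spin V7') z' \<and>
        proj_point t x = proj_point t (\<Phi> (pure_tensor ta tb z z'))))"
proof -
  obtain \<chi> where 1: "spin7 s q V7 ta \<rho>a e \<chi>"
    using spin_module.spin7_exists[OF spin_moduleI[OF V.vector_space_axioms qf V.subspace_span a] on7 refl] by blast
  obtain \<chi>' where 2: "spin7 s q V7' tb \<rho>b e' \<chi>'"
    using spin_module.spin7_exists[OF spin_moduleI[OF V.vector_space_axioms qf V.subspace_span b] on7' refl] by blast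
  interpret T: tensor_frame s q t \<rho> e ta \<rho>a \<chi> tb \<rho>b \<chi>' x
    by (intro tensor_frame.intro spin_frame_axioms 1 2 tensor_frame_axioms.intro x)
  show ?thesis using T.equivariant_iso T.equivariant_iso_chi T.A.chi_generic T.A'.chi_generic by blast
qed

text \<open>Decompositions are unordered, while the tensor statement names its factors in order;
  exchanging the halves of the frame covers the reversed order.\<close>

definition swapped :: "nat \<Rightarrow> 'a" where "swapped i = (if i < 7 then e (i + 7) else e (i - 7))"

lemma swapped_image: "swapped ` {..<14} = e ` {..<14}" "swapped ` {..<7} = e' ` {..<7}"
  "(\<lambda>i. swapped (i + 7)) ` {..<7} = e ` {..<7}"
proof -
  show "swapped ` {..<14} = e ` {..<14}"
  proof
    show "e ` {..<14} \<subseteq> swapped ` {..<14}"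
    proof
      fix v assume "v \<in> e ` {..<14}"
      then obtain i where i: "i < 14" "v = e i" by blast
      have "v = swapped (if i < 7 then i + 7 else i - 7)" using i by (auto simp: swapped_def)
      then show "v \<in> swapped ` {..<14}" by (rule image_eqI) (use i in auto)
    qed
  qed (auto simp: swapped_def)
qed (auto simp: swapped_def)

lemma swapped_frame: "spin_frame s q t \<rho> swapped"
proof -
  have "orthonormal swapped 14" using Bee by (auto simp: orthonormal_def swapped_def)
  moreover have "V.span (swapped ` {..<14}) = UNIV" using sp by (simp add: swapped_image)
  ultimately show ?thesis by unfold_locales
qed

lemma swapped_adapted:
  assumes "adapted x" shows "spin_frame.adapted s q \<rho> swapped x"
proof -
  interpret G: spin_frame s q t \<rho> swapped by (rule swapped_frame)
  have 1: "octonion_op swapped i z = f' i z" if "i < 7" for i z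
    using that by (simp add: octonion_op_def swapped_def)
  have 2: "octonion_op (\<lambda>i. swapped (i + 7)) i z = f i z" if "i < 7" for i z
    using that by (simp add: octonion_op_def swapped_def)
  show ?thesis
    using assms unfolding G.adapted_def adapted_def G.P.g2_spinor_def G.P'.g2_spinor_def P.g2_spinor_def P'.g2_spinor_def
    by (simp add: 1 2)
qed

end

theorem proposition2p2p1:
  fixes s :: "complex \<Rightarrow> 'v::ab_group_add \<Rightarrow> 'v"
    and q :: "'v \<Rightarrow> complex"
    and t :: "complex \<Rightarrow> 's::ab_group_add \<Rightarrow> 's"
    and \<rho> :: "'v cl \<Rightarrow> 's \<Rightarrow> 's"
    and \<psi> :: 's
  assumes "vector_space s" and "vector_space.dim s (UNIV :: 'v set) = 14"
    and "quadratic_form s q" and "nondegenerate q"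
    and "spin_representation s q UNIV t \<rho>"
    and "in_open_orbit t \<rho> (spin_group s q UNIV) \<psi>"
  shows "(\<exists>!D. \<exists>W W'. D = {W, W'} \<and> preserved_decomposition s q t \<rho> \<psi> W W') \<and>
    (\<forall>W W'. preserved_decomposition s q t \<rho> \<psi> W W' \<longrightarrow>
      (\<forall>(t7 :: complex \<Rightarrow> 'a::ab_group_add \<Rightarrow> 'a) \<rho>7
        (t7' :: complex \<Rightarrow> 'b::ab_group_add \<Rightarrow> 'b) \<rho>7'.
        spin_representation s q W t7 \<rho>7 \<and> spin_representation s q W' t7' \<rho>7' \<longrightarrow>
        (\<exists>\<Phi>. equivariant_tensor_isomorphism s q W W' t7 \<rho>7 t7' \<rho>7' t \<rho> \<Phi>) \<and>
        (\<forall>\<Phi>. equivariant_tensor_isomorphism s q W W' t7 \<rho>7 t7' \<rho>7' t \<rho> \<Phi> \<longrightarrow>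
          (\<exists>x x'. off_invariant_quadric t7 \<rho>7 (spin_group s q W) x \<and>
                  off_invariant_quadric t7' \<rho>7' (spin_group s q W') x' \<and>
                  proj_point t \<psi> = proj_point t (\<Phi> (pure_tensor t7 t7' x x'))))))"
proof -
  interpret V: vector_space s by fact
  interpret H: half_spin s q t \<rho>
    by (intro half_spin.intro spin_moduleI half_spin_axioms.intro) (use assms in auto)
  obtain d where "spin_frame s q t \<rho> d" using H.spin_frame_exists[OF assms(2)] by blast
  \<comment> \<open>Genericity is turned into a frame to which \<psi> is adapted; both claims are
    then read off from that frame.\<close>
  then obtain e where e: "spin_frame s q t \<rho> e" "spin_frame.adapted s q \<rho> e \<psi>"
    using spin_frame.open_orbit_adapted assms(6) by blast
  interpret F: spin_frame s q t \<rho> e by (rule e(1))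
  interpret G: spin_frame s q t \<rho> F.swapped by (rule F.swapped_frame)
  show ?thesis
  proof (rule conjI)
    show "\<exists>!D. \<exists>W W'. D = {W, W'} \<and> preserved_decomposition s q t \<rho> \<psi> W W'"
    proof (rule ex1I[of _ "{F.V7, F.V7'}"])
      show "\<exists>W W'. {F.V7, F.V7'} = {W, W'} \<and> preserved_decomposition s q t \<rho> \<psi> W W'"
        using F.adapted_preserved[OF e(2)] by blast
    next
      fix D assume "\<exists>W W'. D = {W, W'} \<and> preserved_decomposition s q t \<rho> \<psi> W W'"
      then show "D = {F.V7, F.V7'}" using F.preserved_unique[OF e(2)] by blast
    qed
  next
    show "\<forall>W W'. preserved_decomposition s q t \<rho> \<psi> W W' \<longrightarrow>
      (\<forall>(t7 :: complex \<Rightarrow> 'a::ab_group_add \<Rightarrow> 'a) \<rho>7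
        (t7' :: complex \<Rightarrow> 'b::ab_group_add \<Rightarrow> 'b) \<rho>7'.
        spin_representation s q W t7 \<rho>7 \<and> spin_representation s q W' t7' \<rho>7' \<longrightarrow>
        (\<exists>\<Phi>. equivariant_tensor_isomorphism s q W W' t7 \<rho>7 t7' \<rho>7' t \<rho> \<Phi>) \<and>
        (\<forall>\<Phi>. equivariant_tensor_isomorphism s q W W' t7 \<rho>7 t7' \<rho>7' t \<rho> \<Phi> \<longrightarrow>
          (\<exists>x x'. off_invariant_quadric t7 \<rho>7 (spin_group s q W) x \<and>
                  off_invariant_quadric t7' \<rho>7' (spin_group s q W') x' \<and>
                  proj_point t \<psi> = proj_point t (\<Phi> (pure_tensor t7 t7' x x')))))"
      (is "\<forall>W W'. ?pd W W' \<longrightarrow> (\<forall>t7 \<rho>7 t7' \<rho>7'. ?sr W W' t7 \<rho>7 t7' \<rho>7' \<longrightarrow> ?C W W' t7 \<rho>7 t7' \<rho>7')")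
    proof (intro allI impI)
      fix W W' and t7 :: "complex \<Rightarrow> 'a \<Rightarrow> 'a" and \<rho>7 and t7' :: "complex \<Rightarrow> 'b \<Rightarrow> 'b" and \<rho>7'
      assume pd: "?pd W W'" and "?sr W W' t7 \<rho>7 t7' \<rho>7'"
      then have sr: "spin_representation s q W t7 \<rho>7" "spin_representation s q W' t7' \<rho>7'" by blast+
      have "{W, W'} = {F.V7, F.V7'}" by (rule F.preserved_unique[OF e(2) pd])
      then consider "W = F.V7" "W' = F.V7'" | "W = F.V7'" "W' = F.V7" by (auto simp: doubleton_eq_iff)
      then show "?C W W' t7 \<rho>7 t7' \<rho>7'"
      proof cases
        case 1
        show ?thesis using F.decomposable[OF e(2) sr[unfolded 1]] unfolding 1 .
      next
        case 2
        then have GW: "W = G.V7" "W' = G.V7'" by (simp_all add: F.swapped_image)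
        show ?thesis
          using G.decomposable[OF F.swapped_adapted[OF e(2)] sr[unfolded GW]] unfolding GW .
      qed
    qed
  qed
qed

end
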